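(* Let $G$ be a finite group and $k$ a field of characteristic zero, or of characteristic $p>0$ where $p$ does not divide the order of $G$. Then the Mackey algebra $\mu_k(G)$ is a symmetric $k$-algebra.
   Context: Conventions: for $g\in G$ and $H\leqslant G$, ${}^gH=gHg^{-1}$ and $H^g=g^{-1}Hg$. Symmetric algebra: for a commutative ring $R$, an $R$-algebra $A$ is symmetric if it is a finitely generated projective $R$-module and there is an $R$-bilinear form $b$ on $A$ with $b(xy,z)=b(x,yz)$ and $b(x,y)=b(y,x)$ for all $x,y,z\in A$, which is non-degenerate, i.e. $x\mapsto b(x,-)$ is an isomorphism of $R$-modules $A\to \mathrm{Hom}_R(A,R)$. Mackey algebra: $\mu_R(G)$ is the unital associative $R$-algebra with generators $t^K_H$, $r^K_H$, $c_{g,H}$ for $H\leqslant K\leqslant G$, $g\in G$, and relations: $\sum_{H\leqslant G}t^H_H=1$; $t^H_H=r^H_H=c_{h,H}$ for $h\in H$; $t^L_Kt^K_H=t^L_H$ and $r^K_Hr^L_K=r^L_H$ for $H\leqslant K\leqslant L$; $c_{g',{}^gH}c_{g,H}=c_{g'g,H}$; $t^{{}^gK}_{{}^gH}c_{g,H}=c_{g,K}t^K_H$ and $r^{{}^gK}_{{}^gH}c_{g,K}=c_{g,H}r^K_H$ for $H\leqslant K$; $r^H_Lt^H_K=\sum_{h\in[L\backslash H/K]}t^L_{L\cap{}^hK}\,c_{h,L^h\cap K}\,r^K_{L^h\cap K}$ for $L,K\leqslant H$; all other products of generators are zero. *)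

theory Defs
  imports
    "HOL-Algebra.Multiplicative_Group"
    "HOL-Algebra.QuotRing"
    "Jordan_Normal_Form.Missing_VectorSpace"
begin

section \<open>Modules and symmetric algebras\<close>

text \<open>The additive order of the identity; it is \<open>0\<close> if that order is infinite.\<close>

definition ring_characteristic :: "('r, 'm) ring_scheme \<Rightarrow> nat" where
  "ring_characteristic R = group.ord (add_monoid R) \<one>\<^bsub>R\<^esub>"

definition regular_module :: "('r, 'm) ring_scheme \<Rightarrow> ('r, 'r) module" where
  "regular_module R =
     \<lparr>carrier = carrier R, mult = mult R, one = \<one>\<^bsub>R\<^esub>, zero = \<zero>\<^bsub>R\<^esub>, add = add R, smult = mult R\<rparr>"

text \<open>The free module on a set \<open>X\<close>: finitely supported functions, extensional outside \<open>X\<close>.\<close>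

definition free_module :: "('r, 'm) ring_scheme \<Rightarrow> 'x set \<Rightarrow> ('r, 'x \<Rightarrow> 'r) module" where
  "free_module R X =
     (ring.func_space R X)
       \<lparr>carrier := {f \<in> X \<rightarrow>\<^sub>E carrier R. finite {x \<in> X. f x \<noteq> \<zero>\<^bsub>R\<^esub>}}\<rparr>"

definition finitely_generated_module ::
    "('r, 'm) ring_scheme \<Rightarrow> ('r, 'a, 'n) module_scheme \<Rightarrow> bool" where
  "finitely_generated_module R M \<longleftrightarrow>
     module R M \<and> (\<exists>S. finite S \<and> S \<subseteq> carrier M \<and> module.span R M S = carrier M)"

text \<open>Projective means direct summand of a free module, i.e. retract of one. Taking the basis \<open>X\<close>
  inside the element type of \<open>M\<close> is no restriction, since a projective \<open>M\<close> is a direct summand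
  of the free module on its own carrier.\<close>

definition projective_module ::
    "('r, 'm) ring_scheme \<Rightarrow> ('r, 'a, 'n) module_scheme \<Rightarrow> bool" where
  "projective_module R M \<longleftrightarrow>
     module R M \<and>
     (\<exists>(X :: 'a set) i p.
        i \<in> module_hom R M (free_module R X) \<and>
        p \<in> module_hom R (free_module R X) M \<and>
        (\<forall>x \<in> carrier M. p (i x) = x))"

text \<open>The library locale \<^locale>\<open>algebra\<close> only covers commutative algebras.\<close>

locale unital_algebra = module R A + A: ring A
  for R :: "('r, 'm) ring_scheme" (structure)
  and A :: "('r, 'a, 'n) module_scheme" (structure) +
  assumes smult_mult_left: "\<lbrakk>a \<in> carrier R; x \<in> carrier A; y \<in> carrier A\<rbrakk> \<Longrightarrow>
      (a \<odot>\<^bsub>A\<^esub> x) \<otimes>\<^bsub>A\<^esub> y = a \<odot>\<^bsub>A\<^esub> (x \<otimes>\<^bsub>A\<^esub> y)"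
    and smult_mult_right: "\<lbrakk>a \<in> carrier R; x \<in> carrier A; y \<in> carrier A\<rbrakk> \<Longrightarrow>
      x \<otimes>\<^bsub>A\<^esub> (a \<odot>\<^bsub>A\<^esub> y) = a \<odot>\<^bsub>A\<^esub> (x \<otimes>\<^bsub>A\<^esub> y)"

text \<open>\<open>Hom\<^sub>R(M, R)\<close> with pointwise operations; a linear form is represented by its extensional
  restriction to the carrier of \<open>M\<close>.\<close>

definition dual_module ::
    "('r, 'm) ring_scheme \<Rightarrow> ('r, 'a, 'n) module_scheme \<Rightarrow> ('r, 'a \<Rightarrow> 'r) module" where
  "dual_module R M =
     (ring.func_space R (carrier M))
       \<lparr>carrier := module_hom R M (regular_module R) \<inter> extensional (carrier M)\<rparr>"

definition bilinear_form ::
    "('r, 'm) ring_scheme \<Rightarrow> ('r, 'a, 'n) module_scheme \<Rightarrow> ('a \<Rightarrow> 'a \<Rightarrow> 'r) \<Rightarrow> bool" where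
  "bilinear_form R M b \<longleftrightarrow>
     (\<forall>x \<in> carrier M. (\<lambda>y. b x y) \<in> module_hom R M (regular_module R)) \<and>
     (\<forall>y \<in> carrier M. (\<lambda>x. b x y) \<in> module_hom R M (regular_module R))"

definition nondegenerate_form ::
    "('r, 'm) ring_scheme \<Rightarrow> ('r, 'a, 'n) module_scheme \<Rightarrow> ('a \<Rightarrow> 'a \<Rightarrow> 'r) \<Rightarrow> bool" where
  "nondegenerate_form R M b \<longleftrightarrow>
     (\<lambda>x. restrict (b x) (carrier M)) \<in> module_hom R M (dual_module R M) \<and>
     bij_betw (\<lambda>x. restrict (b x) (carrier M)) (carrier M) (carrier (dual_module R M))"

definition symmetric_algebra ::
    "('r, 'm) ring_scheme \<Rightarrow> ('r, 'a, 'n) module_scheme \<Rightarrow> bool" where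
  "symmetric_algebra R A \<longleftrightarrow>
     unital_algebra R A \<and>
     finitely_generated_module R A \<and>
     projective_module R A \<and>
     (\<exists>b. bilinear_form R A b \<and>
          (\<forall>x \<in> carrier A. \<forall>y \<in> carrier A. \<forall>z \<in> carrier A.
             b (x \<otimes>\<^bsub>A\<^esub> y) z = b x (y \<otimes>\<^bsub>A\<^esub> z)) \<and>
          (\<forall>x \<in> carrier A. \<forall>y \<in> carrier A. b x y = b y x) \<and>
          nondegenerate_form R A b)"


section \<open>Algebras given by generators and relations\<close>

text \<open>The free unital associative algebra on \<open>X\<close>: the free module on the words over \<open>X\<close>, with
  the product extending concatenation of words. The coefficient of \<open>w\<close> in a product is a sum over
  the ways of cutting \<open>w\<close> in two.\<close>

definition free_algebra :: "('r, 'm) ring_scheme \<Rightarrow> 'x set \<Rightarrow> ('r, 'x list \<Rightarrow> 'r) module" where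
  "free_algebra R X =
     (free_module R (lists X))
       \<lparr>mult := (\<lambda>f g. \<lambda>w\<in>lists X. \<Oplus>\<^bsub>R\<^esub>i\<in>{..length w}. f (take i w) \<otimes>\<^bsub>R\<^esub> g (drop i w)),
        one := (\<lambda>w\<in>lists X. if w = [] then \<one>\<^bsub>R\<^esub> else \<zero>\<^bsub>R\<^esub>)\<rparr>"

definition free_gen :: "('r, 'm) ring_scheme \<Rightarrow> 'x set \<Rightarrow> 'x \<Rightarrow> ('x list \<Rightarrow> 'r)" where
  "free_gen R X x = (\<lambda>w\<in>lists X. if w = [x] then \<one>\<^bsub>R\<^esub> else \<zero>\<^bsub>R\<^esub>)"

text \<open>The quotient ring by a two-sided ideal, with the induced scalar multiplication on cosets.\<close>

definition quotient_algebra :: "('r, 'a, 'n) module_scheme \<Rightarrow> 'a set \<Rightarrow> ('r, 'a set) module" where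
  "quotient_algebra A I =
     ring.extend (A Quot I) (module.fields (\<lambda>a C. \<Union>x\<in>C. I +>\<^bsub>A\<^esub> (a \<odot>\<^bsub>A\<^esub> x)))"

definition presented_algebra ::
    "('r, 'm) ring_scheme \<Rightarrow> 'x set \<Rightarrow> (('x list \<Rightarrow> 'r) \<times> ('x list \<Rightarrow> 'r)) set \<Rightarrow>
     ('r, ('x list \<Rightarrow> 'r) set) module" where
  "presented_algebra R X E =
     (let F = free_algebra R X
      in quotient_algebra F (Idl\<^bsub>F\<^esub> {u \<ominus>\<^bsub>F\<^esub> v | u v. (u, v) \<in> E}))"


section \<open>The Mackey algebra\<close>

text \<open>\<open>Tr K H\<close>, \<open>Res K H\<close> and \<open>Conj g H\<close> stand for $t^K_H$, $r^K_H$ and $c_{g,H}$.\<close>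

datatype 'g mackey_gen = Tr "'g set" "'g set" | Res "'g set" "'g set" | Conj 'g "'g set"

definition conj_subgroup :: "('g, 'm) monoid_scheme \<Rightarrow> 'g \<Rightarrow> 'g set \<Rightarrow> 'g set" where
  "conj_subgroup G g H = (g <#\<^bsub>G\<^esub> H) #>\<^bsub>G\<^esub> (inv\<^bsub>G\<^esub> g)"

definition double_coset_reps ::
    "('g, 'm) monoid_scheme \<Rightarrow> 'g set \<Rightarrow> 'g set \<Rightarrow> 'g set \<Rightarrow> 'g set \<Rightarrow> bool" where
  "double_coset_reps G L H K D \<longleftrightarrow>
     D \<subseteq> H \<and> (\<forall>x \<in> H. \<exists>!h. h \<in> D \<and> x \<in> (L #>\<^bsub>G\<^esub> h) <#>\<^bsub>G\<^esub> K)"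

definition mackey_gens :: "('g, 'm) monoid_scheme \<Rightarrow> 'g mackey_gen set" where
  "mackey_gens G =
     {Tr K H | K H. subgroup K G \<and> subgroup H G \<and> H \<subseteq> K} \<union>
     {Res K H | K H. subgroup K G \<and> subgroup H G \<and> H \<subseteq> K} \<union>
     {Conj g H | g H. g \<in> carrier G \<and> subgroup H G}"

text \<open>Each generator is regarded as a morphism between subgroups:
  \<open>Tr K H\<close> from \<open>H\<close> to \<open>K\<close>, \<open>Res K H\<close> from \<open>K\<close> to \<open>H\<close>, and \<open>Conj g H\<close> from \<open>H\<close> to its
  conjugate.\<close>

primrec gen_source :: "'g mackey_gen \<Rightarrow> 'g set" where
  "gen_source (Tr K H) = H"
| "gen_source (Res K H) = K"
| "gen_source (Conj g H) = H"

primrec gen_target :: "('g, 'm) monoid_scheme \<Rightarrow> 'g mackey_gen \<Rightarrow> 'g set" where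
  "gen_target G (Tr K H) = K"
| "gen_target G (Res K H) = H"
| "gen_target G (Conj g H) = conj_subgroup G g H"

text \<open>The defining relations, as pairs of elements of an algebra \<open>A\<close> in which the generators are
  interpreted by \<open>e\<close>.

  \<^item> In \<open>mackey\<close>, $L^h$ is the conjugate of \<open>L\<close> by the inverse of \<open>h\<close>. The relation is imposed for
    every system \<open>D\<close> of double coset representatives; by the relations for conjugations the right
    hand side does not depend on \<open>D\<close>.
  \<^item> In \<open>zero\<close>, the ``other'' products that vanish are those of non-composable generators. Products
    such as $t^K_H r^L_H$, which are the left hand side of no other relation but are composable,
    must not be killed: $t^H_H r^H_H$ is the idempotent $t^H_H$, and these sum to \<open>1\<close>.\<close>

inductive_set mackey_relations ::
    "('g, 'm) monoid_scheme \<Rightarrow> ('a, 'n) ring_scheme \<Rightarrow> ('g mackey_gen \<Rightarrow> 'a) \<Rightarrow> ('a \<times> 'a) set"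
  for G :: "('g, 'm) monoid_scheme" and A :: "('a, 'n) ring_scheme" and e :: "'g mackey_gen \<Rightarrow> 'a"
where
  unit: "(\<Oplus>\<^bsub>A\<^esub>H\<in>{H. subgroup H G}. e (Tr H H), \<one>\<^bsub>A\<^esub>) \<in> mackey_relations G A e"
| tr_res_id: "subgroup H G \<Longrightarrow> (e (Tr H H), e (Res H H)) \<in> mackey_relations G A e"
| res_conj_id: "\<lbrakk>subgroup H G; h \<in> H\<rbrakk> \<Longrightarrow>
    (e (Res H H), e (Conj h H)) \<in> mackey_relations G A e"
| tr_tr: "\<lbrakk>subgroup H G; subgroup K G; subgroup L G; H \<subseteq> K; K \<subseteq> L\<rbrakk> \<Longrightarrow>
    (e (Tr L K) \<otimes>\<^bsub>A\<^esub> e (Tr K H), e (Tr L H)) \<in> mackey_relations G A e"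
| res_res: "\<lbrakk>subgroup H G; subgroup K G; subgroup L G; H \<subseteq> K; K \<subseteq> L\<rbrakk> \<Longrightarrow>
    (e (Res K H) \<otimes>\<^bsub>A\<^esub> e (Res L K), e (Res L H)) \<in> mackey_relations G A e"
| conj_conj: "\<lbrakk>subgroup H G; g \<in> carrier G; g' \<in> carrier G\<rbrakk> \<Longrightarrow>
    (e (Conj g' (conj_subgroup G g H)) \<otimes>\<^bsub>A\<^esub> e (Conj g H), e (Conj (g' \<otimes>\<^bsub>G\<^esub> g) H))
      \<in> mackey_relations G A e"
| tr_conj: "\<lbrakk>subgroup H G; subgroup K G; H \<subseteq> K; g \<in> carrier G\<rbrakk> \<Longrightarrow>
    (e (Tr (conj_subgroup G g K) (conj_subgroup G g H)) \<otimes>\<^bsub>A\<^esub> e (Conj g H),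
     e (Conj g K) \<otimes>\<^bsub>A\<^esub> e (Tr K H)) \<in> mackey_relations G A e"
| res_conj: "\<lbrakk>subgroup H G; subgroup K G; H \<subseteq> K; g \<in> carrier G\<rbrakk> \<Longrightarrow>
    (e (Res (conj_subgroup G g K) (conj_subgroup G g H)) \<otimes>\<^bsub>A\<^esub> e (Conj g K),
     e (Conj g H) \<otimes>\<^bsub>A\<^esub> e (Res K H)) \<in> mackey_relations G A e"
| mackey: "\<lbrakk>subgroup H G; subgroup K G; subgroup L G; K \<subseteq> H; L \<subseteq> H; double_coset_reps G L H K D\<rbrakk> \<Longrightarrow>
    (e (Res H L) \<otimes>\<^bsub>A\<^esub> e (Tr H K),
     \<Oplus>\<^bsub>A\<^esub>h\<in>D. e (Tr L (L \<inter> conj_subgroup G h K))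
               \<otimes>\<^bsub>A\<^esub> e (Conj h (conj_subgroup G (inv\<^bsub>G\<^esub> h) L \<inter> K))
               \<otimes>\<^bsub>A\<^esub> e (Res K (conj_subgroup G (inv\<^bsub>G\<^esub> h) L \<inter> K))) \<in> mackey_relations G A e"
| zero: "\<lbrakk>x \<in> mackey_gens G; y \<in> mackey_gens G; gen_source x \<noteq> gen_target G y\<rbrakk> \<Longrightarrow>
    (e x \<otimes>\<^bsub>A\<^esub> e y, \<zero>\<^bsub>A\<^esub>) \<in> mackey_relations G A e"

definition mackey_algebra ::
    "('r, 'm) ring_scheme \<Rightarrow> ('g, 'n) monoid_scheme \<Rightarrow>
     ('r, ('g mackey_gen list \<Rightarrow> 'r) set) module" where
  "mackey_algebra R G =
     (let X = mackey_gens G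
      in presented_algebra R X (mackey_relations G (free_algebra R X) (free_gen R X)))"

end

theory Submission
  imports Defs
begin

text \<open>For every subgroup \<open>P\<close> of \<open>G\<close>, the Mackey algebra acts on the left cosets of all subgroups that
  are fixed by \<open>P\<close>, and words in the generators act by matrices that count paths; the Mackey relation
  becomes a count of double cosets. Summing the traces of these matrices over all \<open>P\<close> gives a
  symmetric trace form.

  The algebra is spanned by the standard elements $t^K_L c_g r^H_{L^g}$. The entry at \<open>P\<close> in position
  \<open>(K, g H)\<close> of the matrix of a standard element with middle group \<open>L\<close> vanishes if \<open>P\<close> is larger
  than \<open>L\<close>; if both have the same order, it is nonzero only if the standard element is also
  $t^K_P c_g r^H_{P^g}$. Summed over all ways to write one standard element in this form, these
  entries give \<open>card K * card H / card L\<close>, a unit of \<open>k\<close>, so the matrices separate the elements of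
  the algebra. The same triangularity, now with the index of \<open>P\<close>
  in \<open>G\<close> as diagonal coefficient, recovers by induction on \<open>card P\<close> all matrix entries of an element
  from the traces of its products with standard elements, so the trace form is nondegenerate.\<close>

section \<open>Nondegenerate trace forms over a field\<close>

text \<open>A standard element stands for a span G/K <- G/L -> G/H of transitive G-sets, and its
  matrix at \<open>P\<close> counts the \<open>P\<close>-fixed points of the middle set that lie
  over a pair of fixed points. The triangularity is thus that of the table of marks. The
  presentation alone gives spanning but no independence: the relations might kill standard elements
  or identify more of them than expected. No basis is ever established. A reconstruction of every
  element from its matrix entries takes its place, and repeated indices of one standard element are
  harmless as long as their total weight is invertible. Nondegeneracy of the trace form needs more
  than faithful matrices. It rests on equivariance: left translation moves (P, x, y) to (gPg^{-1},
  gx, gy) without changing the entry, so each orbit carries a single unknown, and pairing with a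
  suitable standard element sums this unknown over its orbit. The weights add up to the index of
  \<open>P\<close>; this is the second place, after the reconstruction, where divisors of the order
  of G have to be invertible.\<close>

lemma (in vectorspace) injective_endomorphism_surjective:
  assumes fd: fin_dim and lin: "linear_map K V V T" and inj: "inj_on T (carrier V)"
  shows "T ` carrier V = carrier V"
proof -
  interpret T: linear_map K V V T by (fact lin)
  obtain B where B: "finite B" "basis B" using finite_basis_exists[OF fd] by blast
  have BV: "B \<subseteq> carrier V" and li: "lin_indpt B" using B(2) by (auto simp: basis_def)
  have TB: "T ` B \<subseteq> carrier V" using BV T.T_im by auto
  have "lin_indpt (T ` B)"
  proof (rule finite_lin_indpt2)
    fix a assume a: "a \<in> T ` B \<rightarrow> carrier K" and 0: "lincomb a (T ` B) = \<zero>\<^bsub>V\<^esub>"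
    have "T (lincomb (a \<circ> T) B) = T \<zero>\<^bsub>V\<^esub>"
      unfolding T.lincomb_linear_image[OF inj BV a B(1), symmetric] 0 by simp
    moreover have c: "a \<circ> T \<in> B \<rightarrow> carrier K" using a by auto
    moreover have "lincomb (a \<circ> T) B \<in> carrier V" by (rule lincomb_closed[OF BV c])
    ultimately have "lincomb (a \<circ> T) B = \<zero>\<^bsub>V\<^esub>"
      by (rule_tac inj_onD[OF inj]) simp_all
    from not_lindepD[OF li B(1) subset_refl c this] show "\<forall>v\<in>T ` B. a v = \<zero>\<^bsub>K\<^esub>" by auto
  qed (use B TB in auto)
  moreover have "card (T ` B) = card B" using card_image inj_on_subset[OF inj BV] by blast
  ultimately have gen: "span (T ` B) = carrier V"
    using dim_li_is_basis[OF fd _ TB] dim_basis[OF B] B(1) by (simp add: basis_def)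
  have "span (T ` B) \<subseteq> T ` carrier V"
    using T.im_is_submodule BV by (intro span_is_subset) (auto simp: T.im_def)
  with gen show ?thesis using T.T_im by auto
qed

lemma (in ring) free_module_finite:
  assumes "finite X" shows "free_module R X = func_space X"
  using assms by (simp add: free_module_def func_space_def)

text \<open>Coordinates are linear because they invert the linear map \<open>lincomb\<close>. The
  two maps together exhibit \<open>V\<close> as a retract of the function space on \<open>B\<close>,
  which is the form of projectivity required later.\<close>

lemma (in vectorspace) basis_coordinates:
  assumes B: "finite B" "basis B"
  obtains c where "c \<in> module_hom K V (func_space B)"
    and "\<And>x. x \<in> carrier V \<Longrightarrow> lincomb (c x) B = x"
proof -
  have BV: "B \<subseteq> carrier V" using B(2) by (simp add: basis_def)
  have ex1: "\<exists>!a. a \<in> B \<rightarrow>\<^sub>E carrier K \<and> lincomb a B = v" if "v \<in> carrier V" for v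
    using basis_criterion[OF B(1) BV] B(2) that by simp
  define c where "c v = (THE a. a \<in> B \<rightarrow>\<^sub>E carrier K \<and> lincomb a B = v)" for v
  have c: "c v \<in> B \<rightarrow>\<^sub>E carrier K \<and> lincomb (c v) B = v" if "v \<in> carrier V" for v
    unfolding c_def by (rule theI'[OF ex1[OF that]])
  have uniq: "a = c (lincomb a B)" if "a \<in> B \<rightarrow>\<^sub>E carrier K" for a
  proof -
    have v: "lincomb a B \<in> carrier V" using that BV by (intro lincomb_closed) auto
    show ?thesis using ex1[OF v] c[OF v] that by metis
  qed
  interpret F: module K "func_space B" by (rule func_space_is_module)
  interpret L: linear_map K "func_space B" V "\<lambda>a. lincomb a B"
    by (rule lincomb_is_linear[OF B(1) BV])
  have car: "carrier (func_space B) = B \<rightarrow>\<^sub>E carrier K" by (simp add: func_space_def)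
  have "c \<in> module_hom K V (func_space B)"
    unfolding module_hom_def
  proof (safe)
    fix x assume "x \<in> carrier V" then show "c x \<in> carrier (func_space B)" using c car by simp
  next
    fix x y assume "x \<in> carrier V" "y \<in> carrier V"
    then have "c x \<oplus>\<^bsub>func_space B\<^esub> c y \<in> B \<rightarrow>\<^sub>E carrier K"
      "lincomb (c x \<oplus>\<^bsub>func_space B\<^esub> c y) B = x \<oplus>\<^bsub>V\<^esub> y"
      using c L.f_add F.a_closed unfolding car[symmetric] by auto
    then show "c (x \<oplus>\<^bsub>V\<^esub> y) = c x \<oplus>\<^bsub>func_space B\<^esub> c y" using uniq by metis
  next
    fix r x assume "r \<in> carrier K" "x \<in> carrier V"
    then have "r \<odot>\<^bsub>func_space B\<^esub> c x \<in> B \<rightarrow>\<^sub>E carrier K"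
      "lincomb (r \<odot>\<^bsub>func_space B\<^esub> c x) B = r \<odot>\<^bsub>V\<^esub> x"
      using c L.f_smult F.smult_closed unfolding car[symmetric] by auto
    then show "c (r \<odot>\<^bsub>V\<^esub> x) = r \<odot>\<^bsub>func_space B\<^esub> c x" using uniq by metis
  qed
  then show thesis using c by (intro that) auto
qed

lemma module_hom_regularD:
  assumes "f \<in> module_hom R M (regular_module R)"
  shows "\<And>x. x \<in> carrier M \<Longrightarrow> f x \<in> carrier R"
    and "\<And>x y. x \<in> carrier M \<Longrightarrow> y \<in> carrier M \<Longrightarrow> f (x \<oplus>\<^bsub>M\<^esub> y) = f x \<oplus>\<^bsub>R\<^esub> f y"
    and "\<And>a x. a \<in> carrier R \<Longrightarrow> x \<in> carrier M \<Longrightarrow> f (a \<odot>\<^bsub>M\<^esub> x) = a \<otimes>\<^bsub>R\<^esub> f x"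
  using assms by (auto simp: module_hom_def regular_module_def)

lemma module_hom_regularI:
  assumes "\<And>x. x \<in> carrier M \<Longrightarrow> f x \<in> carrier R"
    and "\<And>x y. x \<in> carrier M \<Longrightarrow> y \<in> carrier M \<Longrightarrow> f (x \<oplus>\<^bsub>M\<^esub> y) = f x \<oplus>\<^bsub>R\<^esub> f y"
    and "\<And>a x. a \<in> carrier R \<Longrightarrow> x \<in> carrier M \<Longrightarrow> f (a \<odot>\<^bsub>M\<^esub> x) = a \<otimes>\<^bsub>R\<^esub> f x"
  shows "f \<in> module_hom R M (regular_module R)"
  using assms by (auto simp: module_hom_def regular_module_def)

lemma (in module) linear_forms_agree_on_span:
  assumes f: "f \<in> module_hom R M (regular_module R)" and g: "g \<in> module_hom R M (regular_module R)"
    and S: "S \<subseteq> carrier M" "\<And>x. x \<in> S \<Longrightarrow> f x = g x" and x: "x \<in> span S"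
  shows "f x = g x"
proof -
  note f = module_hom_regularD[OF f] and g = module_hom_regularD[OF g]
  have "submodule R {x \<in> carrier M. f x = g x} M"
  proof (rule submodule.intro)
    have "f \<zero>\<^bsub>M\<^esub> = \<zero>" "g \<zero>\<^bsub>M\<^esub> = \<zero>"
      using f(3)[of \<zero> "\<zero>\<^bsub>M\<^esub>"] g(3)[of \<zero> "\<zero>\<^bsub>M\<^esub>"] f(1) g(1) by auto
    then show "\<zero>\<^bsub>M\<^esub> \<in> {x \<in> carrier M. f x = g x}" by simp
  qed (use f g module_axioms in auto)
  then have "span S \<subseteq> {x \<in> carrier M. f x = g x}"
    using S by (intro span_is_subset) auto
  with x show ?thesis by auto
qed

text \<open>Over a field a trace form that separates points gives an injective, hence bijective, map
  from a finite-dimensional algebra to its dual.\<close>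

theorem symmetric_algebra_if_trace_form:
  assumes k: "field k" and A: "unital_algebra k A"
    and S: "finite S" "S \<subseteq> carrier A" "module.span k A S = carrier A"
    and tr: "\<tau> \<in> module_hom k A (regular_module k)"
    and comm: "\<And>x y. x \<in> carrier A \<Longrightarrow> y \<in> carrier A \<Longrightarrow> \<tau> (x \<otimes>\<^bsub>A\<^esub> y) = \<tau> (y \<otimes>\<^bsub>A\<^esub> x)"
    and nondeg: "\<And>x. x \<in> carrier A \<Longrightarrow> (\<And>y. y \<in> carrier A \<Longrightarrow> \<tau> (x \<otimes>\<^bsub>A\<^esub> y) = \<zero>\<^bsub>k\<^esub>) \<Longrightarrow> x = \<zero>\<^bsub>A\<^esub>"
  shows "symmetric_algebra k A"
proof -
  interpret A: unital_algebra k A by (fact A)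
  interpret k: field k by (fact k)
  interpret V: vectorspace k A by unfold_locales
  have fd: "V.fin_dim" unfolding V.fin_dim_def using S by blast
  obtain B where B: "finite B" "V.basis B" using V.finite_basis_exists[OF fd] by blast
  have BV: "B \<subseteq> carrier A" and Bspan: "A.span B = carrier A"
    using B(2) by (auto simp: V.basis_def)
  obtain c where c: "c \<in> module_hom k A (A.func_space B)"
    and lc: "\<And>x. x \<in> carrier A \<Longrightarrow> A.lincomb (c x) B = x"
    using V.basis_coordinates[OF B] by blast
  interpret L: linear_map k "A.func_space B" A "\<lambda>a. A.lincomb a B"
    by (rule V.lincomb_is_linear[OF B(1) BV])
  have proj: "projective_module k A"
    unfolding projective_module_def using c L.f_hom lc A.module_axioms A.free_module_finite[OF B(1)]
    by (intro conjI exI[of _ B] exI[of _ c] exI[of _ "\<lambda>a. A.lincomb a B"]) auto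
  define b where "b x y = \<tau> (x \<otimes>\<^bsub>A\<^esub> y)" for x y
  note trD = module_hom_regularD[OF tr]
  have b1: "b x \<in> module_hom k A (regular_module k)" if "x \<in> carrier A" for x
    using that trD by (intro module_hom_regularI) (auto simp: b_def A.A.r_distr A.smult_mult_right)
  have b2: "(\<lambda>x. b x y) \<in> module_hom k A (regular_module k)" if "y \<in> carrier A" for y
    using that trD by (intro module_hom_regularI) (auto simp: b_def A.A.l_distr A.smult_mult_left)
  have bil: "bilinear_form k A b" unfolding bilinear_form_def using b1 b2 by auto
  note b1D = module_hom_regularD[OF b1] and b2D = module_hom_regularD[OF b2]
  have dual_carrier: "carrier (dual_module k A) =
      module_hom k A (regular_module k) \<inter> extensional (carrier A)"
    by (simp add: dual_module_def)
  have restr: "restrict f (carrier A) \<in> module_hom k A (regular_module k)"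
    if "f \<in> module_hom k A (regular_module k)" for f
    using module_hom_regularD[OF that] by (intro module_hom_regularI) auto
  have hom: "(\<lambda>x. restrict (b x) (carrier A)) \<in> module_hom k A (dual_module k A)"
    unfolding module_hom_def
  proof (safe)
    fix x assume "x \<in> carrier A"
    then show "restrict (b x) (carrier A) \<in> carrier (dual_module k A)"
      using b1 restr by (simp add: dual_carrier)
  qed (auto simp: dual_module_def A.func_space_def b2D fun_eq_iff)
  have inj0: "x = \<zero>\<^bsub>A\<^esub>" if "x \<in> carrier A" "\<And>y. y \<in> B \<Longrightarrow> b x y = \<zero>\<^bsub>k\<^esub>" for x
  proof (rule nondeg[OF that(1)])
    have z: "(\<lambda>y. \<zero>\<^bsub>k\<^esub>) \<in> module_hom k A (regular_module k)" by (rule module_hom_regularI) auto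
    fix y assume "y \<in> carrier A"
    then show "\<tau> (x \<otimes>\<^bsub>A\<^esub> y) = \<zero>\<^bsub>k\<^esub>"
      using A.linear_forms_agree_on_span[OF b1[OF that(1)] z BV] that(2) Bspan
      by (simp add: b_def)
  qed
  \<comment> \<open>\<open>T\<close> sends \<open>x\<close> to the vector whose coordinates are the
    values of the form \<open>b x\<close> on \<open>B\<close>. Identifying the dual with
    \<open>A\<close> in this way turns bijectivity onto the dual into a question about an
    endomorphism, for which injectivity is enough.\<close>
  define T where "T x = A.lincomb (restrict (b x) B) B" for x
  have coord: "restrict (b x) B \<in> carrier (A.func_space B)" if "x \<in> carrier A" for x
    using that b1D(1)[OF that] BV by (auto simp: A.func_space_def)
  have lc_inj: "f = g" if "f \<in> B \<rightarrow>\<^sub>E carrier k" "g \<in> B \<rightarrow>\<^sub>E carrier k" "A.lincomb f B = A.lincomb g B" for f g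
  proof -
    have "A.lincomb f B \<in> carrier A" using that BV by (intro A.lincomb_closed) auto
    then have "\<exists>!a. a \<in> B \<rightarrow>\<^sub>E carrier k \<and> A.lincomb a B = A.lincomb f B"
      using V.basis_criterion[OF B(1) BV] B(2) by blast
    with that show ?thesis by metis
  qed
  have "linear_map k A A T"
  proof (intro linear_map.intro mod_hom.intro mod_hom_axioms.intro V.vectorspace_axioms A.module_axioms)
    show "T \<in> module_hom k A A"
      unfolding module_hom_def
    proof safe
      fix x assume "x \<in> carrier A" then show "T x \<in> carrier A"
        unfolding T_def using coord by (intro L.f_im)
    next
      fix x y assume xy: "x \<in> carrier A" "y \<in> carrier A"
      have "restrict (b (x \<oplus>\<^bsub>A\<^esub> y)) B = restrict (b x) B \<oplus>\<^bsub>A.func_space B\<^esub> restrict (b y) B"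
        using xy BV by (auto simp: A.func_space_def b2D fun_eq_iff restrict_def)
      then show "T (x \<oplus>\<^bsub>A\<^esub> y) = T x \<oplus>\<^bsub>A\<^esub> T y" unfolding T_def using xy coord by simp
    next
      fix r x assume xy: "r \<in> carrier k" "x \<in> carrier A"
      have "restrict (b (r \<odot>\<^bsub>A\<^esub> x)) B = r \<odot>\<^bsub>A.func_space B\<^esub> restrict (b x) B"
        using xy BV by (auto simp: A.func_space_def b2D fun_eq_iff restrict_def)
      then show "T (r \<odot>\<^bsub>A\<^esub> x) = r \<odot>\<^bsub>A\<^esub> T x" unfolding T_def using xy coord by simp
    qed
  qed
  then interpret T: linear_map k A A T .
  have T_inj: "inj_on T (carrier A)"
  proof (rule T.Ke0_imp_inj, safe)
    fix x assume "x \<in> carrier (A\<lparr>carrier := T.ker\<rparr>)"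
    then have x: "x \<in> carrier A" and "T x = \<zero>\<^bsub>A\<^esub>" by (auto simp: T.ker_def)
    moreover have "\<zero>\<^bsub>A\<^esub> = A.lincomb \<zero>\<^bsub>A.func_space B\<^esub> B" by simp
    ultimately have "restrict (b x) B = \<zero>\<^bsub>A.func_space B\<^esub>"
      using coord[OF x] by (intro lc_inj) (auto simp: T_def A.func_space_def)
    then have "\<And>y. y \<in> B \<Longrightarrow> b x y = \<zero>\<^bsub>k\<^esub>" by (auto simp: A.func_space_def restrict_def fun_eq_iff) metis
    then show "x = \<zero>\<^bsub>A\<^esub>" by (rule inj0[OF x])
  qed (simp add: T.ker_def)
  have surj: "T ` carrier A = carrier A"
    by (rule V.injective_endomorphism_surjective[OF fd T.linear_map_axioms T_inj])
  have bij: "bij_betw (\<lambda>x. restrict (b x) (carrier A)) (carrier A) (carrier (dual_module k A))"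
    unfolding bij_betw_def
  proof (intro conjI equalityI inj_onI)
    fix x y assume xy: "x \<in> carrier A" "y \<in> carrier A"
      and eq: "restrict (b x) (carrier A) = restrict (b y) (carrier A)"
    have "b x z = b y z" if "z \<in> carrier A" for z using fun_cong[OF eq, of z] that by simp
    then have "restrict (b x) B = restrict (b y) B" using BV by (auto simp: restrict_def fun_eq_iff)
    then have "T x = T y" by (simp add: T_def)
    then show "x = y" using T_inj xy by (auto dest: inj_onD)
  next
    show "(\<lambda>x. restrict (b x) (carrier A)) ` carrier A \<subseteq> carrier (dual_module k A)"
      using module_hom_closed[OF hom] by auto
  next
    show "carrier (dual_module k A) \<subseteq> (\<lambda>x. restrict (b x) (carrier A)) ` carrier A"
    proof
      fix l assume "l \<in> carrier (dual_module k A)"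
      then have l: "l \<in> module_hom k A (regular_module k)" and ext: "l \<in> extensional (carrier A)"
        by (auto simp: dual_carrier)
      have lB: "restrict l B \<in> B \<rightarrow>\<^sub>E carrier k" using module_hom_regularD(1)[OF l] BV by auto
      then have "A.lincomb (restrict l B) B \<in> carrier A" using BV by (intro A.lincomb_closed) auto
      then obtain x where x: "x \<in> carrier A" "T x = A.lincomb (restrict l B) B"
        using surj by (metis imageE)
      have "restrict (b x) B = restrict l B"
        using lc_inj[OF _ lB, of "restrict (b x) B"] x coord by (auto simp: T_def A.func_space_def)
      then have "b x y = l y" if "y \<in> B" for y using that by (metis restrict_apply')
      then have "b x y = l y" if "y \<in> carrier A" for y
        using A.linear_forms_agree_on_span[OF b1[OF x(1)] l BV] Bspan that by blast
      then have "restrict (b x) (carrier A) = l" using ext by (auto simp: extensional_def fun_eq_iff)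
      with x show "l \<in> (\<lambda>x. restrict (b x) (carrier A)) ` carrier A" by blast
    qed
  qed
  have "finitely_generated_module k A"
    unfolding finitely_generated_module_def using S A.module_axioms by blast
  moreover have "\<forall>x\<in>carrier A. \<forall>y\<in>carrier A. \<forall>z\<in>carrier A. b (x \<otimes>\<^bsub>A\<^esub> y) z = b x (y \<otimes>\<^bsub>A\<^esub> z)"
    by (simp add: b_def A.A.m_assoc)
  moreover have "\<forall>x\<in>carrier A. \<forall>y\<in>carrier A. b x y = b y x"
    using comm by (simp add: b_def)
  moreover have "nondegenerate_form k A b" using hom bij by (simp add: nondegenerate_form_def)
  ultimately show ?thesis
    unfolding symmetric_algebra_def using A proj bil by blast
qed

section \<open>Free algebras and their quotients\<close>

lemma (in abelian_monoid) finsum_group: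
  assumes "finite A" "h \<in> A \<rightarrow> carrier G"
  shows "(\<Oplus>x\<in>A. h x) = (\<Oplus>y\<in>c ` A. \<Oplus>x\<in>{x \<in> A. c x = y}. h x)"
proof -
  have "A = (\<Union>y\<in>c ` A. {x \<in> A. c x = y})" by auto
  then have "(\<Oplus>x\<in>A. h x) = (\<Oplus>x\<in>(\<Union>y\<in>c ` A. {x \<in> A. c x = y}). h x)" by simp
  also have "\<dots> = (\<Oplus>y\<in>c ` A. \<Oplus>x\<in>{x \<in> A. c x = y}. h x)"
    using assms by (intro add.finprod_UN_disjoint) (auto simp: pairwise_def disjnt_def)
  finally show ?thesis .
qed

lemma (in abelian_monoid) finsum_Times:
  assumes "finite A" "finite B" "\<And>x y. x \<in> A \<Longrightarrow> y \<in> B \<Longrightarrow> h x y \<in> carrier G"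
  shows "(\<Oplus>p\<in>A \<times> B. h (fst p) (snd p)) = (\<Oplus>x\<in>A. \<Oplus>y\<in>B. h x y)"
  using assms(1,3)
proof (induction A rule: finite_induct)
  case empty then show ?case by simp
next
  case (insert a A)
  have "insert a A \<times> B = Pair a ` B \<union> A \<times> B" by auto
  then have "(\<Oplus>p\<in>insert a A \<times> B. h (fst p) (snd p))
      = (\<Oplus>p\<in>Pair a ` B. h (fst p) (snd p)) \<oplus> (\<Oplus>p\<in>A \<times> B. h (fst p) (snd p))"
    using insert assms(2) by (simp only:) (intro finsum_Un_disjoint; auto)
  also have "(\<Oplus>p\<in>Pair a ` B. h (fst p) (snd p)) = (\<Oplus>y\<in>B. h a y)"
    using insert.prems by (subst finsum_reindex) (auto simp: inj_on_def)
  finally show ?case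
    using insert by (subst finsum_insert) auto
qed

lemma (in abelian_monoid) finsum_eq_zeroI:
  "(\<And>i. i \<in> A \<Longrightarrow> h i = \<zero>) \<Longrightarrow> (\<Oplus>i\<in>A. h i) = \<zero>"
  by (rule add.finprod_one_eqI)

section \<open>Linear forms on free modules given by their values on the basis\<close>

definition monomial :: "('r, 'm) ring_scheme \<Rightarrow> 'x set \<Rightarrow> 'x \<Rightarrow> ('x \<Rightarrow> 'r)" where
  "monomial R X v = (\<lambda>w\<in>X. if w = v then \<one>\<^bsub>R\<^esub> else \<zero>\<^bsub>R\<^esub>)"

text \<open>The sum runs over the support of \<open>f\<close> because the basis, in the applications
  the set of all words, is infinite.\<close>

definition (in ring) lin_ext :: "'x set \<Rightarrow> ('x \<Rightarrow> 'a) \<Rightarrow> ('x \<Rightarrow> 'a) \<Rightarrow> 'a" where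
  "lin_ext X \<phi> f = (\<Oplus>w\<in>{w \<in> X. f w \<noteq> \<zero>}. f w \<otimes> \<phi> w)"

context cring
begin

context
  notes [rule del] = in_listsI in_listsD
begin

lemma free_module_carrier:
  "carrier (free_module R X) = {f \<in> X \<rightarrow>\<^sub>E carrier R. finite {x \<in> X. f x \<noteq> \<zero>}}"
  by (simp add: free_module_def)

lemma free_module_ops:
  "f \<oplus>\<^bsub>free_module R X\<^esub> g = (\<lambda>x\<in>X. f x \<oplus> g x)"
  "a \<odot>\<^bsub>free_module R X\<^esub> f = (\<lambda>x\<in>X. a \<otimes> f x)"
  "\<zero>\<^bsub>free_module R X\<^esub> = (\<lambda>x\<in>X. \<zero>)"
  by (simp_all add: free_module_def func_space_def)

lemma free_module_closed:
  assumes "f \<in> carrier (free_module R X)" "x \<in> X"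
  shows "f x \<in> carrier R"
  using assms by (auto simp: free_module_carrier)

lemma free_module_eqI:
  assumes "f \<in> carrier (free_module R X)" "g \<in> carrier (free_module R X)"
    and "\<And>x. x \<in> X \<Longrightarrow> f x = g x"
  shows "f = g"
  using assms by (intro extensionalityI[of f X g]) (auto simp: free_module_carrier PiE_def)

lemma free_module_finite_support:
  assumes "f \<in> carrier (free_module R X)"
  shows "finite {x \<in> X. f x \<noteq> \<zero>}"
  using assms by (auto simp: free_module_carrier)

lemma free_module_is_module: "module R (free_module R X)"
proof -
  interpret S: module R "func_space X" by (rule func_space_is_module)
  have car: "carrier (func_space X) = X \<rightarrow>\<^sub>E carrier R" by (simp add: func_space_def)
  have "LinearCombinations.submodule R {f \<in> X \<rightarrow>\<^sub>E carrier R. finite {x \<in> X. f x \<noteq> \<zero>}} (func_space X)"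
  proof (rule submodule.intro[OF S.module_axioms])
    fix f g
    assume "f \<in> {f \<in> X \<rightarrow>\<^sub>E carrier R. finite {x \<in> X. f x \<noteq> \<zero>}}"
      and "g \<in> {f \<in> X \<rightarrow>\<^sub>E carrier R. finite {x \<in> X. f x \<noteq> \<zero>}}"
    then have fg: "f \<in> X \<rightarrow>\<^sub>E carrier R" "g \<in> X \<rightarrow>\<^sub>E carrier R"
      and fin: "finite ({x \<in> X. f x \<noteq> \<zero>} \<union> {x \<in> X. g x \<noteq> \<zero>})" by auto
    have "{x \<in> X. (f \<oplus>\<^bsub>func_space X\<^esub> g) x \<noteq> \<zero>} \<subseteq> {x \<in> X. f x \<noteq> \<zero>} \<union> {x \<in> X. g x \<noteq> \<zero>}"
      by (auto simp: func_space_def)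
    from finite_subset[OF this fin]
    show "f \<oplus>\<^bsub>func_space X\<^esub> g \<in> {f \<in> X \<rightarrow>\<^sub>E carrier R. finite {x \<in> X. f x \<noteq> \<zero>}}"
      using fg by (auto simp: func_space_def PiE_iff)
  next
    fix c f assume c: "c \<in> carrier R" and "f \<in> {f \<in> X \<rightarrow>\<^sub>E carrier R. finite {x \<in> X. f x \<noteq> \<zero>}}"
    then have f: "f \<in> X \<rightarrow>\<^sub>E carrier R" and fin: "finite {x \<in> X. f x \<noteq> \<zero>}" by auto
    have "{x \<in> X. (c \<odot>\<^bsub>func_space X\<^esub> f) x \<noteq> \<zero>} \<subseteq> {x \<in> X. f x \<noteq> \<zero>}"
      using c by (auto simp: func_space_def)
    from finite_subset[OF this fin]
    show "c \<odot>\<^bsub>func_space X\<^esub> f \<in> {f \<in> X \<rightarrow>\<^sub>E carrier R. finite {x \<in> X. f x \<noteq> \<zero>}}"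
      using c f by (auto simp: func_space_def PiE_iff)
  qed (auto simp: func_space_def cong: conj_cong)
  from S.submodule_is_module[OF this] show ?thesis by (simp add: free_module_def)
qed

lemma monomial_closed [simp]: "monomial R X v \<in> carrier (free_module R X)"
proof -
  have "{x \<in> X. monomial R X v x \<noteq> \<zero>} \<subseteq> {v}" by (auto simp: monomial_def)
  then have "finite {x \<in> X. monomial R X v x \<noteq> \<zero>}" by (rule finite_subset) simp
  then show ?thesis by (auto simp: free_module_carrier monomial_def)
qed

text \<open>Additional points have coefficient zero. This allows several elements to be summed over
  one common finite set, as additivity requires.\<close>

lemma lin_ext_superset:
  assumes "f \<in> carrier (free_module R X)" "\<phi> \<in> X \<rightarrow> carrier R"
    and "finite T" "T \<subseteq> X" "{w \<in> X. f w \<noteq> \<zero>} \<subseteq> T"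
  shows "lin_ext X \<phi> f = (\<Oplus>w\<in>T. f w \<otimes> \<phi> w)"
  unfolding lin_ext_def
  using assms
  by (intro add.finprod_mono_neutral_cong_left) (auto simp: free_module_closed Pi_iff subset_iff)

lemma lin_ext_cong:
  assumes "\<And>w. w \<in> X \<Longrightarrow> \<phi> w = \<psi> w" "\<psi> \<in> X \<rightarrow> carrier R" "f \<in> carrier (free_module R X)"
  shows "lin_ext X \<phi> f = lin_ext X \<psi> f"
  unfolding lin_ext_def using assms by (intro finsum_cong') (auto simp: free_module_carrier)

lemma lin_ext_closed [simp]:
  assumes "f \<in> carrier (free_module R X)" "\<phi> \<in> X \<rightarrow> carrier R"
  shows "lin_ext X \<phi> f \<in> carrier R"
  unfolding lin_ext_def using assms by (intro finsum_closed) (auto simp: free_module_carrier)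

lemma lin_ext_add:
  assumes f: "f \<in> carrier (free_module R X)" and g: "g \<in> carrier (free_module R X)"
    and \<phi>: "\<phi> \<in> X \<rightarrow> carrier R"
  shows "lin_ext X \<phi> (f \<oplus>\<^bsub>free_module R X\<^esub> g) = lin_ext X \<phi> f \<oplus> lin_ext X \<phi> g"
proof -
  interpret M: module R "free_module R X" by (rule free_module_is_module)
  define T where "T = {w \<in> X. f w \<noteq> \<zero>} \<union> {w \<in> X. g w \<noteq> \<zero>}"
  have T: "finite T" "T \<subseteq> X" using f g by (auto simp: T_def free_module_carrier)
  have 1: "lin_ext X \<phi> (f \<oplus>\<^bsub>free_module R X\<^esub> g) = (\<Oplus>w\<in>T. (f \<oplus>\<^bsub>free_module R X\<^esub> g) w \<otimes> \<phi> w)"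
    using T \<phi> M.M.a_closed[OF f g] by (intro lin_ext_superset) (auto simp: T_def free_module_ops)
  have 2: "\<dots> = (\<Oplus>w\<in>T. f w \<otimes> \<phi> w \<oplus> g w \<otimes> \<phi> w)"
    using f g \<phi> T
    by (intro finsum_cong') (auto simp: free_module_ops free_module_closed l_distr Pi_iff subset_iff)
  have 3: "\<dots> = (\<Oplus>w\<in>T. f w \<otimes> \<phi> w) \<oplus> (\<Oplus>w\<in>T. g w \<otimes> \<phi> w)"
    using f g \<phi> T by (intro finsum_addf) (auto simp: free_module_closed Pi_iff subset_iff)
  have 4: "lin_ext X \<phi> f = (\<Oplus>w\<in>T. f w \<otimes> \<phi> w)" "lin_ext X \<phi> g = (\<Oplus>w\<in>T. g w \<otimes> \<phi> w)"
    using T by (intro lin_ext_superset f g \<phi>; auto simp: T_def)+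
  show ?thesis using 1 2 3 4 by simp
qed

lemma lin_ext_smult:
  assumes f: "f \<in> carrier (free_module R X)" and a: "a \<in> carrier R" and \<phi>: "\<phi> \<in> X \<rightarrow> carrier R"
  shows "lin_ext X \<phi> (a \<odot>\<^bsub>free_module R X\<^esub> f) = a \<otimes> lin_ext X \<phi> f"
proof -
  interpret M: module R "free_module R X" by (rule free_module_is_module)
  define T where "T = {w \<in> X. f w \<noteq> \<zero>}"
  have T: "finite T" "T \<subseteq> X" using f by (auto simp: T_def free_module_carrier)
  have 1: "lin_ext X \<phi> (a \<odot>\<^bsub>free_module R X\<^esub> f) = (\<Oplus>w\<in>T. (a \<odot>\<^bsub>free_module R X\<^esub> f) w \<otimes> \<phi> w)"
    using T \<phi> a M.smult_closed[OF a f] by (intro lin_ext_superset) (auto simp: T_def free_module_ops)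
  have 2: "\<dots> = (\<Oplus>w\<in>T. a \<otimes> (f w \<otimes> \<phi> w))"
    using f a \<phi> T by (intro finsum_cong') (auto simp: free_module_ops free_module_closed m_assoc subset_iff Pi_iff)
  have 3: "\<dots> = a \<otimes> (\<Oplus>w\<in>T. f w \<otimes> \<phi> w)"
    using f a \<phi> T by (intro finsum_rdistr[symmetric]) (auto simp: free_module_carrier)
  show ?thesis using 1 2 3 by (simp add: lin_ext_def T_def)
qed

lemma lin_ext_fun_add:
  assumes "f \<in> carrier (free_module R X)" "\<phi> \<in> X \<rightarrow> carrier R" "\<psi> \<in> X \<rightarrow> carrier R"
  shows "lin_ext X (\<lambda>w. \<phi> w \<oplus> \<psi> w) f = lin_ext X \<phi> f \<oplus> lin_ext X \<psi> f"
proof -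
  have "lin_ext X (\<lambda>w. \<phi> w \<oplus> \<psi> w) f
      = (\<Oplus>w\<in>{w \<in> X. f w \<noteq> \<zero>}. f w \<otimes> \<phi> w \<oplus> f w \<otimes> \<psi> w)"
    unfolding lin_ext_def using assms
    by (intro finsum_cong') (auto simp: free_module_carrier r_distr Pi_iff PiE_iff)
  also have "\<dots> = lin_ext X \<phi> f \<oplus> lin_ext X \<psi> f"
    unfolding lin_ext_def using assms by (intro finsum_addf) (auto simp: free_module_carrier)
  finally show ?thesis .
qed

lemma lin_ext_fun_smult:
  assumes "f \<in> carrier (free_module R X)" "\<phi> \<in> X \<rightarrow> carrier R" "a \<in> carrier R"
  shows "lin_ext X (\<lambda>w. a \<otimes> \<phi> w) f = a \<otimes> lin_ext X \<phi> f"
proof -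
  have "lin_ext X (\<lambda>w. a \<otimes> \<phi> w) f = (\<Oplus>w\<in>{w \<in> X. f w \<noteq> \<zero>}. a \<otimes> (f w \<otimes> \<phi> w))"
    unfolding lin_ext_def using assms
    by (intro finsum_cong') (auto simp: free_module_carrier m_lcomm Pi_iff PiE_iff)
  also have "\<dots> = a \<otimes> lin_ext X \<phi> f"
    unfolding lin_ext_def using assms
    by (intro finsum_rdistr[symmetric]) (auto simp: free_module_carrier)
  finally show ?thesis .
qed

lemma lin_ext_zero_fun:
  assumes "f \<in> carrier (free_module R X)"
  shows "lin_ext X (\<lambda>w. \<zero>) f = \<zero>"
  using assms unfolding lin_ext_def by (intro finsum_eq_zeroI) (auto simp: free_module_closed)

lemma lin_ext_fun_finsum:
  assumes "f \<in> carrier (free_module R X)" "finite I" "\<And>i w. i \<in> I \<Longrightarrow> w \<in> X \<Longrightarrow> \<phi> i w \<in> carrier R"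
  shows "lin_ext X (\<lambda>w. \<Oplus>i\<in>I. \<phi> i w) f = (\<Oplus>i\<in>I. lin_ext X (\<phi> i) f)"
  using assms(2,3)
proof (induction I rule: finite_induct)
  case empty then show ?case using lin_ext_zero_fun[OF assms(1)] by simp
next
  case (insert i I)
  have "lin_ext X (\<lambda>w. \<Oplus>i\<in>insert i I. \<phi> i w) f = lin_ext X (\<lambda>w. \<phi> i w \<oplus> (\<Oplus>i\<in>I. \<phi> i w)) f"
    using insert assms(1) by (intro lin_ext_cong) (auto intro!: finsum_insert finsum_closed)
  also have "\<dots> = lin_ext X (\<phi> i) f \<oplus> (\<Oplus>i\<in>I. lin_ext X (\<phi> i) f)"
    using insert assms(1) by (subst lin_ext_fun_add) (auto intro!: finsum_closed)
  also have "\<dots> = (\<Oplus>i\<in>insert i I. lin_ext X (\<phi> i) f)"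
    using insert assms(1) by (subst finsum_insert) (auto intro!: lin_ext_closed)
  finally show ?case .
qed

lemma lin_ext_swap:
  assumes f: "f \<in> carrier (free_module R X)" and g: "g \<in> carrier (free_module R Y)"
    and \<phi>: "\<And>u v. u \<in> X \<Longrightarrow> v \<in> Y \<Longrightarrow> \<phi> u v \<in> carrier R"
  shows "lin_ext X (\<lambda>u. lin_ext Y (\<phi> u) g) f = lin_ext Y (\<lambda>v. lin_ext X (\<lambda>u. \<phi> u v) f) g"
proof -
  let ?S = "{w \<in> X. f w \<noteq> \<zero>}"
  have S: "finite ?S" using f by (simp add: free_module_carrier)
  have fc: "f u \<in> carrier R" if "u \<in> X" for u using f that by (auto simp: free_module_carrier)
  have "lin_ext Y (\<lambda>v. lin_ext X (\<lambda>u. \<phi> u v) f) g = lin_ext Y (\<lambda>v. \<Oplus>u\<in>?S. f u \<otimes> \<phi> u v) g"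
    unfolding lin_ext_def[of X] ..
  also have "\<dots> = (\<Oplus>u\<in>?S. lin_ext Y (\<lambda>v. f u \<otimes> \<phi> u v) g)"
    using g \<phi> S fc by (intro lin_ext_fun_finsum) auto
  also have "\<dots> = (\<Oplus>u\<in>?S. f u \<otimes> lin_ext Y (\<phi> u) g)"
    using g \<phi> fc by (intro finsum_cong') (auto intro!: lin_ext_fun_smult lin_ext_closed)
  finally show ?thesis unfolding lin_ext_def[of X] by simp
qed

lemma lin_ext_delta:
  assumes f: "f \<in> carrier (free_module R X)" and w: "w \<in> X"
  shows "lin_ext X (\<lambda>u. if u = w then \<one> else \<zero>) f = f w"
proof -
  have "lin_ext X (\<lambda>u. if u = w then \<one> else \<zero>) f
      = (\<Oplus>u\<in>insert w {u \<in> X. f u \<noteq> \<zero>}. f u \<otimes> (if u = w then \<one> else \<zero>))"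
    using f w by (intro lin_ext_superset) (auto simp: free_module_carrier)
  also have "\<dots> = (\<Oplus>u\<in>insert w {u \<in> X. f u \<noteq> \<zero>}. if w = u then f u else \<zero>)"
    using f w by (intro finsum_cong') (auto simp: free_module_closed)
  also have "\<dots> = f w"
    using f w by (intro finsum_singleton) (auto simp: free_module_closed free_module_finite_support)
  finally show ?thesis .
qed

lemma lin_ext_monomial:
  assumes v: "v \<in> X" and \<phi>: "\<phi> \<in> X \<rightarrow> carrier R"
  shows "lin_ext X \<phi> (monomial R X v) = \<phi> v"
proof -
  have "lin_ext X \<phi> (monomial R X v) = (\<Oplus>w\<in>{v}. monomial R X v w \<otimes> \<phi> w)"
    using v \<phi> by (intro lin_ext_superset monomial_closed) (auto simp: monomial_def)
  also have "\<dots> = \<phi> v" using v \<phi> by (auto simp: monomial_def Pi_iff)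
  finally show ?thesis .
qed

section \<open>The free algebra as a unital algebra\<close>

lemma free_algebra_ops:
  "carrier (free_algebra R X) = carrier (free_module R (lists X))"
  "f \<oplus>\<^bsub>free_algebra R X\<^esub> g = f \<oplus>\<^bsub>free_module R (lists X)\<^esub> g"
  "a \<odot>\<^bsub>free_algebra R X\<^esub> f = a \<odot>\<^bsub>free_module R (lists X)\<^esub> f"
  "\<zero>\<^bsub>free_algebra R X\<^esub> = \<zero>\<^bsub>free_module R (lists X)\<^esub>"
  "\<one>\<^bsub>free_algebra R X\<^esub> = monomial R (lists X) []"
  by (simp_all add: free_algebra_def monomial_def)

lemma free_algebra_mult:
  "f \<otimes>\<^bsub>free_algebra R X\<^esub> g = (\<lambda>w\<in>lists X. \<Oplus>i\<in>{..length w}. f (take i w) \<otimes> g (drop i w))"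
  by (simp add: free_algebra_def)

lemma free_gen_eq_monomial: "free_gen R X x = monomial R (lists X) [x]"
  by (simp add: free_gen_def monomial_def)

lemma take_drop_in_lists:
  assumes "w \<in> lists X" shows "take i w \<in> lists X" "drop i w \<in> lists X"
  using assms by (auto simp: lists_eq_set dest: in_set_takeD in_set_dropD)

text \<open>A cut point is the length of the first factor, so the cuts with both factors in the
  supports correspond to the pairs of supporting words with concatenation \<open>w\<close>. In this
  form the coefficients for all \<open>w\<close> merge into a single sum over a finite
  rectangle.\<close>

lemma free_algebra_mult_coeff:
  assumes f: "f \<in> carrier (free_algebra R X)" and g: "g \<in> carrier (free_algebra R X)"
    and w: "w \<in> lists X"
  shows "(f \<otimes>\<^bsub>free_algebra R X\<^esub> g) w =
    (\<Oplus>p\<in>{p \<in> {u \<in> lists X. f u \<noteq> \<zero>} \<times> {v \<in> lists X. g v \<noteq> \<zero>}. fst p @ snd p = w}.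
      f (fst p) \<otimes> g (snd p))"
proof -
  let ?P = "{p \<in> {u \<in> lists X. f u \<noteq> \<zero>} \<times> {v \<in> lists X. g v \<noteq> \<zero>}. fst p @ snd p = w}"
  let ?I = "{i \<in> {..length w}. f (take i w) \<noteq> \<zero> \<and> g (drop i w) \<noteq> \<zero>}"
  have cl: "f u \<in> carrier R" "g u \<in> carrier R" if "u \<in> lists X" for u
    using f g that by (auto simp: free_algebra_ops free_module_carrier)
  have inj: "inj_on (\<lambda>i. (take i w, drop i w)) ?I"
    by (rule inj_onI) (metis (no_types, lifting) Pair_inject atMost_iff length_take mem_Collect_eq min.absorb2)
  have img: "?P = (\<lambda>i. (take i w, drop i w)) ` ?I"
  proof (intro equalityI subsetI)
    fix p assume "p \<in> ?P"
    then show "p \<in> (\<lambda>i. (take i w, drop i w)) ` ?I"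
      by (intro image_eqI[of _ _ "length (fst p)"]) auto
  qed (use take_drop_in_lists[OF w] in auto)
  have "(f \<otimes>\<^bsub>free_algebra R X\<^esub> g) w = (\<Oplus>i\<in>{..length w}. f (take i w) \<otimes> g (drop i w))"
    using w by (simp add: free_algebra_mult)
  also have "\<dots> = (\<Oplus>i\<in>?I. f (take i w) \<otimes> g (drop i w))"
    using cl take_drop_in_lists[OF w] by (intro add.finprod_mono_neutral_cong_right) auto
  also have "\<dots> = (\<Oplus>p\<in>(\<lambda>i. (take i w, drop i w)) ` ?I. f (fst p) \<otimes> g (snd p))"
    using inj cl take_drop_in_lists[OF w] by (subst finsum_reindex) auto
  finally show ?thesis unfolding img .
qed

lemma free_algebra_mult_support:
  assumes f: "f \<in> carrier (free_algebra R X)" and g: "g \<in> carrier (free_algebra R X)"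
  shows "{w \<in> lists X. (f \<otimes>\<^bsub>free_algebra R X\<^esub> g) w \<noteq> \<zero>}
    \<subseteq> (\<lambda>p. fst p @ snd p) ` ({u \<in> lists X. f u \<noteq> \<zero>} \<times> {v \<in> lists X. g v \<noteq> \<zero>})"
proof
  fix w assume w: "w \<in> {w \<in> lists X. (f \<otimes>\<^bsub>free_algebra R X\<^esub> g) w \<noteq> \<zero>}"
  have "{p \<in> {u \<in> lists X. f u \<noteq> \<zero>} \<times> {v \<in> lists X. g v \<noteq> \<zero>}. fst p @ snd p = w} \<noteq> {}" (is "?P \<noteq> {}")
  proof
    assume "?P = {}"
    moreover have wL: "w \<in> lists X" and nz: "(f \<otimes>\<^bsub>free_algebra R X\<^esub> g) w \<noteq> \<zero>" using w by auto
    ultimately show False using nz unfolding free_algebra_mult_coeff[OF f g wL] by (simp only: finsum_empty simp_thms)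
  qed
  then show "w \<in> (\<lambda>p. fst p @ snd p) ` ({u \<in> lists X. f u \<noteq> \<zero>} \<times> {v \<in> lists X. g v \<noteq> \<zero>})"
    by blast
qed

lemma free_algebra_mult_closed:
  assumes f: "f \<in> carrier (free_algebra R X)" and g: "g \<in> carrier (free_algebra R X)"
  shows "f \<otimes>\<^bsub>free_algebra R X\<^esub> g \<in> carrier (free_algebra R X)"
proof -
  have fin: "finite {u \<in> lists X. f u \<noteq> \<zero>}" "finite {u \<in> lists X. g u \<noteq> \<zero>}"
    and cl: "\<And>u. u \<in> lists X \<Longrightarrow> f u \<in> carrier R" "\<And>u. u \<in> lists X \<Longrightarrow> g u \<in> carrier R"
    using f g by (auto simp: free_algebra_ops free_module_carrier)
  have "finite {w \<in> lists X. (f \<otimes>\<^bsub>free_algebra R X\<^esub> g) w \<noteq> \<zero>}"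
    by (rule finite_subset[OF free_algebra_mult_support[OF f g]]) (use fin in auto)
  then show ?thesis
    using cl take_drop_in_lists[of _ X]
    by (auto simp: free_algebra_ops free_module_carrier free_algebra_mult intro!: finsum_closed m_closed)
qed

text \<open>Pairs of supporting words are grouped by their concatenation. This identity replaces the
  convolution product by concatenation inside a test function, and the ring axioms below are derived
  from it.\<close>

lemma lin_ext_mult:
  assumes f: "f \<in> carrier (free_algebra R X)" and g: "g \<in> carrier (free_algebra R X)"
    and \<phi>: "\<phi> \<in> lists X \<rightarrow> carrier R"
  shows "lin_ext (lists X) \<phi> (f \<otimes>\<^bsub>free_algebra R X\<^esub> g)
    = lin_ext (lists X) (\<lambda>u. lin_ext (lists X) (\<lambda>v. \<phi> (u @ v)) g) f"
proof -
  let ?L = "lists X" and ?S = "{u \<in> lists X. f u \<noteq> \<zero>}" and ?T = "{u \<in> lists X. g u \<noteq> \<zero>}"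
  let ?c = "\<lambda>p. fst p @ snd p"
  have fin: "finite ?S" "finite ?T"
    and cl: "\<And>u. u \<in> ?L \<Longrightarrow> f u \<in> carrier R" "\<And>u. u \<in> ?L \<Longrightarrow> g u \<in> carrier R"
      "\<And>u. u \<in> ?L \<Longrightarrow> \<phi> u \<in> carrier R"
    using f g \<phi> by (auto simp: free_algebra_ops free_module_carrier)
  have clm: "f (fst p) \<otimes> g (snd p) \<otimes> \<phi> (fst p @ snd p) \<in> carrier R" if "p \<in> ?S \<times> ?T" for p
    using that cl(1)[of "fst p"] cl(2)[of "snd p"] cl(3)[of "fst p @ snd p"]
    by (simp add: mem_Times_iff)
  have app: "u @ v \<in> ?L" if "u \<in> ?L" "v \<in> ?L" for u v using that by simp
  have "lin_ext ?L \<phi> (f \<otimes>\<^bsub>free_algebra R X\<^esub> g)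
      = (\<Oplus>w\<in>?c ` (?S \<times> ?T). (f \<otimes>\<^bsub>free_algebra R X\<^esub> g) w \<otimes> \<phi> w)"
    using free_algebra_mult_closed[OF f g] free_algebra_mult_support[OF f g] \<phi> fin
    by (intro lin_ext_superset) (auto simp: free_algebra_ops)
  also have "\<dots> = (\<Oplus>w\<in>?c ` (?S \<times> ?T). \<Oplus>p\<in>{p \<in> ?S \<times> ?T. ?c p = w}. f (fst p) \<otimes> g (snd p) \<otimes> \<phi> (?c p))"
  proof (rule finsum_cong')
    fix w assume "w \<in> ?c ` (?S \<times> ?T)"
    then have w: "w \<in> ?L" using app by auto
    have "(f \<otimes>\<^bsub>free_algebra R X\<^esub> g) w \<otimes> \<phi> w
        = (\<Oplus>p\<in>{p \<in> ?S \<times> ?T. ?c p = w}. f (fst p) \<otimes> g (snd p) \<otimes> \<phi> w)"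
      using free_algebra_mult_coeff[OF f g w] fin cl w by (subst finsum_ldistr[symmetric]) auto
    also have "\<dots> = (\<Oplus>p\<in>{p \<in> ?S \<times> ?T. ?c p = w}. f (fst p) \<otimes> g (snd p) \<otimes> \<phi> (?c p))"
      using clm by (intro finsum_cong') auto
    finally show "(f \<otimes>\<^bsub>free_algebra R X\<^esub> g) w \<otimes> \<phi> w
        = (\<Oplus>p\<in>{p \<in> ?S \<times> ?T. ?c p = w}. f (fst p) \<otimes> g (snd p) \<otimes> \<phi> (?c p))" .
  qed (use clm in \<open>auto intro!: finsum_closed\<close>)
  also have "\<dots> = (\<Oplus>p\<in>?S \<times> ?T. f (fst p) \<otimes> g (snd p) \<otimes> \<phi> (?c p))"
    using fin clm by (intro finsum_group[symmetric]) auto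
  also have "\<dots> = (\<Oplus>u\<in>?S. \<Oplus>v\<in>?T. f u \<otimes> g v \<otimes> \<phi> (u @ v))"
    using fin cl by (intro finsum_Times) auto
  also have "\<dots> = (\<Oplus>u\<in>?S. f u \<otimes> (\<Oplus>v\<in>?T. g v \<otimes> \<phi> (u @ v)))"
  proof (rule finsum_cong')
    fix u assume u: "u \<in> ?S"
    have "(\<Oplus>v\<in>?T. f u \<otimes> g v \<otimes> \<phi> (u @ v)) = (\<Oplus>v\<in>?T. f u \<otimes> (g v \<otimes> \<phi> (u @ v)))"
      using u cl by (intro finsum_cong') (auto simp: m_assoc)
    also have "\<dots> = f u \<otimes> (\<Oplus>v\<in>?T. g v \<otimes> \<phi> (u @ v))"
      using u cl fin by (intro finsum_rdistr[symmetric]) auto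
    finally show "(\<Oplus>v\<in>?T. f u \<otimes> g v \<otimes> \<phi> (u @ v)) = f u \<otimes> (\<Oplus>v\<in>?T. g v \<otimes> \<phi> (u @ v))" .
  qed (use cl in \<open>auto intro!: finsum_closed\<close>)
  finally show ?thesis unfolding lin_ext_def .
qed

text \<open>The coefficients of an element are themselves linear extensions, namely those of
  indicator functions. Identities can therefore be tested against arbitrary functions on the
  basis.\<close>

lemma free_module_eqI_lin_ext:
  assumes "f \<in> carrier (free_module R X)" "g \<in> carrier (free_module R X)"
    and "\<And>\<phi>. \<phi> \<in> X \<rightarrow> carrier R \<Longrightarrow> lin_ext X \<phi> f = lin_ext X \<phi> g"
  shows "f = g"
proof (rule free_module_eqI[OF assms(1,2)])
  fix x assume "x \<in> X"
  then show "f x = g x"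
    using lin_ext_delta[OF assms(1)] lin_ext_delta[OF assms(2)] assms(3)[of "\<lambda>u. if u = x then \<one> else \<zero>"]
    by auto
qed

text \<open>Each axiom is tested against an arbitrary function on words. Associativity then becomes
  associativity of concatenation, and the unit is the empty word.\<close>

lemma free_algebra_unital: "unital_algebra R (free_algebra R X)"
proof -
  let ?F = "free_algebra R X" and ?L = "lists X"
  interpret M: module R "free_module R ?L" by (rule free_module_is_module)
  note ops = free_algebra_ops
  have mod: "module R ?F"
    by (rule module_criteria)
      (auto simp: ops M.smult_l_distr M.smult_r_distr M.smult_assoc1 M.M.a_ac is_cring
        intro: M.M.a_inv_closed M.M.r_neg)
  then interpret F: module R ?F .
  note mc = free_algebra_mult_closed[of _ X]
  note le = lin_ext_mult lin_ext_add[of _ ?L, folded ops] lin_ext_smult[of _ ?L, folded ops]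
    lin_ext_monomial lin_ext_fun_add lin_ext_fun_smult
  note lc = lin_ext_closed[of _ ?L, folded ops]
  note eqI = free_module_eqI_lin_ext[of _ ?L, folded ops]
  have one: "\<one>\<^bsub>?F\<^esub> \<in> carrier ?F" by (simp add: ops)
  have ring: "ring ?F"
  proof (intro ringI F.abelian_group_axioms)
    show "monoid ?F"
    proof (rule monoidI)
      fix f g h assume fgh: "f \<in> carrier ?F" "g \<in> carrier ?F" "h \<in> carrier ?F"
      show "f \<otimes>\<^bsub>?F\<^esub> g \<otimes>\<^bsub>?F\<^esub> h = f \<otimes>\<^bsub>?F\<^esub> (g \<otimes>\<^bsub>?F\<^esub> h)"
      proof (rule eqI)
        fix \<phi> assume \<phi>: "\<phi> \<in> ?L \<rightarrow> carrier R"
        have cl: "(\<lambda>u. lin_ext ?L (\<lambda>v. \<psi> (u @ v)) k) \<in> ?L \<rightarrow> carrier R"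
          if "k \<in> carrier ?F" "\<psi> \<in> ?L \<rightarrow> carrier R" for k \<psi>
          using that lc by (auto simp: Pi_iff)
        have "lin_ext ?L \<phi> (f \<otimes>\<^bsub>?F\<^esub> g \<otimes>\<^bsub>?F\<^esub> h)
            = lin_ext ?L (\<lambda>u. lin_ext ?L (\<lambda>v. lin_ext ?L (\<lambda>w. \<phi> ((u @ v) @ w)) h) g) f"
          unfolding lin_ext_mult[OF mc[OF fgh(1,2)] fgh(3) \<phi>]
          by (rule lin_ext_mult[OF fgh(1,2) cl[OF fgh(3) \<phi>]])
        also have "\<dots> = lin_ext ?L (\<lambda>u. lin_ext ?L (\<lambda>v. \<phi> (u @ v)) (g \<otimes>\<^bsub>?F\<^esub> h)) f"
        proof (rule lin_ext_cong)
          fix u assume "u \<in> ?L"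
          then have "(\<lambda>v. \<phi> (u @ v)) \<in> ?L \<rightarrow> carrier R" using \<phi> by (auto simp: Pi_iff)
          then show "lin_ext ?L (\<lambda>v. lin_ext ?L (\<lambda>w. \<phi> ((u @ v) @ w)) h) g
              = lin_ext ?L (\<lambda>v. \<phi> (u @ v)) (g \<otimes>\<^bsub>?F\<^esub> h)"
            by (subst lin_ext_mult[OF fgh(2,3)]) simp_all
        qed (use fgh(1) cl[OF mc[OF fgh(2,3)] \<phi>] in \<open>auto simp: ops\<close>)
        also have "\<dots> = lin_ext ?L \<phi> (f \<otimes>\<^bsub>?F\<^esub> (g \<otimes>\<^bsub>?F\<^esub> h))"
          by (rule lin_ext_mult[OF fgh(1) mc[OF fgh(2,3)] \<phi>, symmetric])
        finally show "lin_ext ?L \<phi> (f \<otimes>\<^bsub>?F\<^esub> g \<otimes>\<^bsub>?F\<^esub> h) = lin_ext ?L \<phi> (f \<otimes>\<^bsub>?F\<^esub> (g \<otimes>\<^bsub>?F\<^esub> h))" .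
      qed (intro mc fgh)+
    next
      fix f assume f: "f \<in> carrier ?F"
      show "\<one>\<^bsub>?F\<^esub> \<otimes>\<^bsub>?F\<^esub> f = f"
      proof (rule eqI)
        fix \<phi> assume \<phi>: "\<phi> \<in> ?L \<rightarrow> carrier R"
        show "lin_ext ?L \<phi> (\<one>\<^bsub>?F\<^esub> \<otimes>\<^bsub>?F\<^esub> f) = lin_ext ?L \<phi> f"
          using f \<phi> lc unfolding lin_ext_mult[OF one f \<phi>] unfolding ops
          by (subst lin_ext_monomial) (auto simp: Pi_iff)
      qed (use f one mc in auto)
      show "f \<otimes>\<^bsub>?F\<^esub> \<one>\<^bsub>?F\<^esub> = f"
      proof (rule eqI)
        fix \<phi> assume \<phi>: "\<phi> \<in> ?L \<rightarrow> carrier R"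
        show "lin_ext ?L \<phi> (f \<otimes>\<^bsub>?F\<^esub> \<one>\<^bsub>?F\<^esub>) = lin_ext ?L \<phi> f"
          using f one \<phi> unfolding lin_ext_mult[OF f one \<phi>]
          by (intro lin_ext_cong) (auto simp: ops lin_ext_monomial Pi_iff)
      qed (use f one mc in auto)
    qed (use one mc in auto)
    fix f g h assume fgh: "f \<in> carrier ?F" "g \<in> carrier ?F" "h \<in> carrier ?F"
    show "(f \<oplus>\<^bsub>?F\<^esub> g) \<otimes>\<^bsub>?F\<^esub> h = f \<otimes>\<^bsub>?F\<^esub> h \<oplus>\<^bsub>?F\<^esub> g \<otimes>\<^bsub>?F\<^esub> h"
    proof (rule eqI)
      fix \<phi> assume \<phi>: "\<phi> \<in> ?L \<rightarrow> carrier R"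
      have *: "(\<lambda>u. lin_ext ?L (\<lambda>v. \<phi> (u @ v)) h) \<in> ?L \<rightarrow> carrier R"
        using fgh \<phi> lc by (auto simp: Pi_iff)
      show "lin_ext ?L \<phi> ((f \<oplus>\<^bsub>?F\<^esub> g) \<otimes>\<^bsub>?F\<^esub> h) = lin_ext ?L \<phi> (f \<otimes>\<^bsub>?F\<^esub> h \<oplus>\<^bsub>?F\<^esub> g \<otimes>\<^bsub>?F\<^esub> h)"
        using fgh \<phi> * mc F.a_closed by (simp add: le)
    qed (use fgh mc F.a_closed in auto)
    show "h \<otimes>\<^bsub>?F\<^esub> (f \<oplus>\<^bsub>?F\<^esub> g) = h \<otimes>\<^bsub>?F\<^esub> f \<oplus>\<^bsub>?F\<^esub> h \<otimes>\<^bsub>?F\<^esub> g"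
    proof (rule eqI)
      fix \<phi> assume \<phi>: "\<phi> \<in> ?L \<rightarrow> carrier R"
      then have \<phi>': "\<phi> w \<in> carrier R" if "w \<in> ?L" for w using that by auto
      have *: "(\<lambda>u. lin_ext ?L (\<lambda>v. \<phi> (u @ v)) k) \<in> ?L \<rightarrow> carrier R" if "k \<in> carrier ?F" for k
        using that \<phi> lc by (auto simp: Pi_iff)
      have "lin_ext ?L \<phi> (h \<otimes>\<^bsub>?F\<^esub> (f \<oplus>\<^bsub>?F\<^esub> g))
          = lin_ext ?L (\<lambda>u. lin_ext ?L (\<lambda>v. \<phi> (u @ v)) f \<oplus> lin_ext ?L (\<lambda>v. \<phi> (u @ v)) g) h"
        unfolding lin_ext_mult[OF fgh(3) F.a_closed[OF fgh(1,2)] \<phi>]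
        using fgh \<phi>' lc by (intro lin_ext_cong) (auto simp: ops Pi_iff lin_ext_add)
      also have "\<dots> = lin_ext ?L (\<lambda>u. lin_ext ?L (\<lambda>v. \<phi> (u @ v)) f) h \<oplus> lin_ext ?L (\<lambda>u. lin_ext ?L (\<lambda>v. \<phi> (u @ v)) g) h"
        by (rule lin_ext_fun_add[OF fgh(3)[unfolded ops] *[OF fgh(1)] *[OF fgh(2)]])
      also have "\<dots> = lin_ext ?L \<phi> (h \<otimes>\<^bsub>?F\<^esub> f \<oplus>\<^bsub>?F\<^esub> h \<otimes>\<^bsub>?F\<^esub> g)"
        using fgh \<phi> mc by (simp add: le)
      finally show "lin_ext ?L \<phi> (h \<otimes>\<^bsub>?F\<^esub> (f \<oplus>\<^bsub>?F\<^esub> g)) = lin_ext ?L \<phi> (h \<otimes>\<^bsub>?F\<^esub> f \<oplus>\<^bsub>?F\<^esub> h \<otimes>\<^bsub>?F\<^esub> g)" .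
    qed (use fgh mc F.a_closed in auto)
  qed
  show ?thesis
  proof (intro unital_algebra.intro unital_algebra_axioms.intro mod ring)
    fix a f g assume afg: "a \<in> carrier R" "f \<in> carrier ?F" "g \<in> carrier ?F"
    have *: "(\<lambda>u. lin_ext ?L (\<lambda>v. \<phi> (u @ v)) k) \<in> ?L \<rightarrow> carrier R"
      if "k \<in> carrier ?F" "\<phi> \<in> ?L \<rightarrow> carrier R" for k \<phi>
      using that lc by (auto simp: Pi_iff)
    show "(a \<odot>\<^bsub>?F\<^esub> f) \<otimes>\<^bsub>?F\<^esub> g = a \<odot>\<^bsub>?F\<^esub> (f \<otimes>\<^bsub>?F\<^esub> g)"
      using afg * mc F.smult_closed by (intro eqI) (auto simp: le)
    show "f \<otimes>\<^bsub>?F\<^esub> (a \<odot>\<^bsub>?F\<^esub> g) = a \<odot>\<^bsub>?F\<^esub> (f \<otimes>\<^bsub>?F\<^esub> g)"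
    proof (rule eqI)
      fix \<phi> assume \<phi>: "\<phi> \<in> ?L \<rightarrow> carrier R"
      have "lin_ext ?L \<phi> (f \<otimes>\<^bsub>?F\<^esub> (a \<odot>\<^bsub>?F\<^esub> g)) = lin_ext ?L (\<lambda>u. a \<otimes> lin_ext ?L (\<lambda>v. \<phi> (u @ v)) g) f"
        unfolding lin_ext_mult[OF afg(2) F.smult_closed[OF afg(1,3)] \<phi>]
        using afg \<phi> lc by (intro lin_ext_cong) (auto simp: ops Pi_iff lin_ext_smult)
      also have "\<dots> = a \<otimes> lin_ext ?L (\<lambda>u. lin_ext ?L (\<lambda>v. \<phi> (u @ v)) g) f"
        by (rule lin_ext_fun_smult[OF afg(2)[unfolded ops] *[OF afg(3) \<phi>] afg(1)])
      also have "\<dots> = lin_ext ?L \<phi> (a \<odot>\<^bsub>?F\<^esub> (f \<otimes>\<^bsub>?F\<^esub> g))"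
        using afg \<phi> mc by (simp add: le)
      finally show "lin_ext ?L \<phi> (f \<otimes>\<^bsub>?F\<^esub> (a \<odot>\<^bsub>?F\<^esub> g)) = lin_ext ?L \<phi> (a \<odot>\<^bsub>?F\<^esub> (f \<otimes>\<^bsub>?F\<^esub> g))" .
    qed (use afg mc F.smult_closed in auto)
  qed
qed

lemma monomial_mult:
  assumes "u \<in> lists X" "v \<in> lists X"
  shows "monomial R (lists X) u \<otimes>\<^bsub>free_algebra R X\<^esub> monomial R (lists X) v = monomial R (lists X) (u @ v)"
proof -
  have m: "monomial R (lists X) w \<in> carrier (free_algebra R X)" for w by (simp add: free_algebra_ops)
  show ?thesis
  proof (rule free_module_eqI_lin_ext[of _ "lists X"])
    fix \<phi> assume \<phi>: "\<phi> \<in> lists X \<rightarrow> carrier R"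
    then have \<phi>': "\<phi> w \<in> carrier R" if "w \<in> lists X" for w using that by auto
    show "lin_ext (lists X) \<phi> (monomial R (lists X) u \<otimes>\<^bsub>free_algebra R X\<^esub> monomial R (lists X) v)
        = lin_ext (lists X) \<phi> (monomial R (lists X) (u @ v))"
      unfolding lin_ext_mult[OF m m \<phi>]
      using assms \<phi>' by (subst lin_ext_monomial; simp add: Pi_iff lin_ext_monomial)
  qed (use free_algebra_mult_closed[OF m m] in \<open>auto simp: free_algebra_ops\<close>)
qed

end

end

section \<open>Quotients by two-sided ideals\<close>

context unital_algebra
begin

text \<open>Multiplication by the scalar \<open>a\<close> is multiplication by the ring element
  obtained from \<open>a\<close> and the identity, so a two-sided ring ideal is automatically a
  subspace.\<close>

lemma ideal_smult_closed:
  assumes "ideal I A" "a \<in> carrier R" "x \<in> I"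
  shows "a \<odot>\<^bsub>A\<^esub> x \<in> I"
proof -
  interpret I: ideal I A by fact
  have x: "x \<in> carrier A" using assms(3) by (rule I.a_Hcarr)
  have "a \<odot>\<^bsub>A\<^esub> x = (a \<odot>\<^bsub>A\<^esub> \<one>\<^bsub>A\<^esub>) \<otimes>\<^bsub>A\<^esub> x" using assms(2) x by (simp add: smult_mult_left)
  also have "\<dots> \<in> I" using assms by (intro I.I_l_closed) auto
  finally show ?thesis .
qed

lemma quotient_algebra_ops:
  "carrier (quotient_algebra A I) = a_rcosets\<^bsub>A\<^esub> I"
  "x \<otimes>\<^bsub>quotient_algebra A I\<^esub> y = x \<otimes>\<^bsub>A Quot I\<^esub> y"
  "x \<oplus>\<^bsub>quotient_algebra A I\<^esub> y = x \<oplus>\<^bsub>A Quot I\<^esub> y"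
  "\<one>\<^bsub>quotient_algebra A I\<^esub> = \<one>\<^bsub>A Quot I\<^esub>"
  "\<zero>\<^bsub>quotient_algebra A I\<^esub> = \<zero>\<^bsub>A Quot I\<^esub>"
  by (simp_all add: quotient_algebra_def ring.defs module.defs FactRing_def)

lemma quotient_carrier:
  "carrier (quotient_algebra A I) = (\<lambda>x. I +>\<^bsub>A\<^esub> x) ` carrier A"
  by (auto simp: quotient_algebra_ops A_RCOSETS_def')

text \<open>The union that defines the scalar multiplication is taken over a nonempty family of
  equal cosets: two representatives differ by an element of \<open>I\<close>, and \<open>I\<close>
  is closed under scalars.\<close>

lemma quotient_smult:
  assumes I: "ideal I A" and a: "a \<in> carrier R" and x: "x \<in> carrier A"
  shows "a \<odot>\<^bsub>quotient_algebra A I\<^esub> (I +>\<^bsub>A\<^esub> x) = I +>\<^bsub>A\<^esub> (a \<odot>\<^bsub>A\<^esub> x)"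
proof -
  interpret I: ideal I A by (fact I)
  have "I +>\<^bsub>A\<^esub> (a \<odot>\<^bsub>A\<^esub> y) = I +>\<^bsub>A\<^esub> (a \<odot>\<^bsub>A\<^esub> x)" if "y \<in> I +>\<^bsub>A\<^esub> x" for y
  proof -
    from that obtain h where h: "h \<in> I" "y = h \<oplus>\<^bsub>A\<^esub> x" by (auto simp: a_r_coset_def')
    then have "a \<odot>\<^bsub>A\<^esub> y = a \<odot>\<^bsub>A\<^esub> h \<oplus>\<^bsub>A\<^esub> a \<odot>\<^bsub>A\<^esub> x"
      using a x I.a_Hcarr by (simp add: smult_r_distr)
    then have "a \<odot>\<^bsub>A\<^esub> y \<in> I +>\<^bsub>A\<^esub> (a \<odot>\<^bsub>A\<^esub> x)"
      using ideal_smult_closed[OF I a h(1)] by (auto simp: a_r_coset_def')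
    then show ?thesis using a_repr_independence[OF _ _ I.a_subgroup] a x by simp
  qed
  moreover have "x \<in> I +>\<^bsub>A\<^esub> x" using I.a_rcos_self[OF x] .
  moreover have "a \<odot>\<^bsub>quotient_algebra A I\<^esub> (I +>\<^bsub>A\<^esub> x) = (\<Union>y\<in>I +>\<^bsub>A\<^esub> x. I +>\<^bsub>A\<^esub> (a \<odot>\<^bsub>A\<^esub> y))"
    by (simp add: quotient_algebra_def ring.defs module.defs)
  ultimately show ?thesis by (metis (no_types, lifting) SUP_eq_const empty_iff)
qed

lemma quotient_hom:
  assumes "ideal I A"
  shows "(\<lambda>x. I +>\<^bsub>A\<^esub> x) \<in> ring_hom A (quotient_algebra A I)"
proof -
  interpret I: ideal I A by fact
  show ?thesis using I.rcos_ring_hom by (simp add: ring_hom_def quotient_algebra_ops FactRing_def)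
qed

lemma quotient_unital:
  assumes I: "ideal I A"
  shows "unital_algebra R (quotient_algebra A I)"
proof -
  let ?Q = "quotient_algebra A I"
  interpret I: ideal I A by (fact I)
  interpret Q: ring "A Quot I" by (rule I.quotient_is_ring)
  have car: "carrier (A Quot I) = carrier ?Q" by (simp add: quotient_algebra_ops FactRing_def)
  note ops = quotient_algebra_ops(2-) car[symmetric]
  have ring: "ring ?Q"
    by (intro ringI abelian_groupI monoidI)
      (auto simp: ops Q.m_assoc Q.l_distr Q.r_distr Q.a_ac intro: Q.a_inv_closed Q.l_neg)
  interpret Q': ring ?Q by (fact ring)
  note hom = quotient_hom[OF I]
  note hom_add = ring_hom_add[OF hom, symmetric] and hom_mult = ring_hom_mult[OF hom, symmetric]
  have mod: "module R ?Q"
  proof (rule moduleI)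
    show "cring R" by (rule R.is_cring)
    show "abelian_group ?Q" by (rule Q'.is_abelian_group)
  qed (auto simp: quotient_carrier quotient_smult[OF I] hom_add smult_l_distr smult_r_distr smult_assoc1)
  show ?thesis
  proof (intro unital_algebra.intro unital_algebra_axioms.intro mod ring)
    fix a x y assume a: "a \<in> carrier R" and "x \<in> carrier ?Q" "y \<in> carrier ?Q"
    then obtain u v where [simp]: "u \<in> carrier A" "v \<in> carrier A"
      and xy: "x = I +>\<^bsub>A\<^esub> u" "y = I +>\<^bsub>A\<^esub> v" by (auto simp: quotient_carrier)
    show "(a \<odot>\<^bsub>?Q\<^esub> x) \<otimes>\<^bsub>?Q\<^esub> y = a \<odot>\<^bsub>?Q\<^esub> (x \<otimes>\<^bsub>?Q\<^esub> y)"
      and "x \<otimes>\<^bsub>?Q\<^esub> (a \<odot>\<^bsub>?Q\<^esub> y) = a \<odot>\<^bsub>?Q\<^esub> (x \<otimes>\<^bsub>?Q\<^esub> y)"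
      using a by (simp_all add: xy quotient_smult[OF I] hom_mult smult_mult_left smult_mult_right)
  qed
qed

lemma quotient_eqI:
  assumes I: "ideal I A" and "x \<in> carrier A" "y \<in> carrier A" "x \<ominus>\<^bsub>A\<^esub> y \<in> I"
  shows "I +>\<^bsub>A\<^esub> x = I +>\<^bsub>A\<^esub> y"
proof -
  interpret I: ideal I A by (fact I)
  have "x = (x \<ominus>\<^bsub>A\<^esub> y) \<oplus>\<^bsub>A\<^esub> y" using assms by algebra
  then have "x \<in> I +>\<^bsub>A\<^esub> y" using assms(4) by (auto simp: a_r_coset_def')
  then show ?thesis using a_repr_independence[OF _ _ I.a_subgroup] assms by simp
qed

lemma quotient_linear_form:
  assumes I: "ideal I A" and t: "t \<in> module_hom R A (regular_module R)"
    and 0: "\<And>x. x \<in> I \<Longrightarrow> t x = \<zero>"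
  obtains s where "s \<in> module_hom R (quotient_algebra A I) (regular_module R)"
    and "\<And>x. x \<in> carrier A \<Longrightarrow> s (I +>\<^bsub>A\<^esub> x) = t x"
proof
  interpret I: ideal I A by (fact I)
  have tD: "\<And>x. x \<in> carrier A \<Longrightarrow> t x \<in> carrier R"
    "\<And>x y. x \<in> carrier A \<Longrightarrow> y \<in> carrier A \<Longrightarrow> t (x \<oplus>\<^bsub>A\<^esub> y) = t x \<oplus> t y"
    "\<And>a x. a \<in> carrier R \<Longrightarrow> x \<in> carrier A \<Longrightarrow> t (a \<odot>\<^bsub>A\<^esub> x) = a \<otimes> t x"
    using t by (auto simp: module_hom_def regular_module_def)
  define s where "s C = t (SOME x. x \<in> C)" for C
  show s: "s (I +>\<^bsub>A\<^esub> x) = t x" if x: "x \<in> carrier A" for x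
  proof -
    have "(SOME y. y \<in> I +>\<^bsub>A\<^esub> x) \<in> I +>\<^bsub>A\<^esub> x" using I.a_rcos_self[OF x] by (rule someI)
    then obtain h where "h \<in> I" "(SOME y. y \<in> I +>\<^bsub>A\<^esub> x) = h \<oplus>\<^bsub>A\<^esub> x" by (auto simp: a_r_coset_def')
    then show ?thesis using tD x 0 I.a_Hcarr by (simp add: s_def)
  qed
  note hom_add = ring_hom_add[OF quotient_hom[OF I], symmetric]
  show "s \<in> module_hom R (quotient_algebra A I) (regular_module R)"
    unfolding module_hom_def
    by (auto simp: quotient_carrier s hom_add quotient_smult[OF I] tD regular_module_def)
qed

end

section \<open>Cosets and conjugate subgroups\<close>

context group
begin

lemma inv_cancel_left:
  assumes "a \<in> carrier G" "b \<in> carrier G"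
  shows "inv a \<otimes> (a \<otimes> b) = b" and "a \<otimes> (inv a \<otimes> b) = b"
  using assms by (simp_all flip: m_assoc)

lemmas group_normalize = m_assoc inv_mult_group inv_cancel_left

lemma mem_l_coset:
  assumes "H \<subseteq> carrier G" "a \<in> carrier G"
  shows "y \<in> a <# H \<longleftrightarrow> y \<in> carrier G \<and> inv a \<otimes> y \<in> H"
proof
  assume "y \<in> a <# H"
  then obtain h where "h \<in> H" "y = a \<otimes> h" by (auto simp: l_coset_def)
  then show "y \<in> carrier G \<and> inv a \<otimes> y \<in> H"
    using assms by (auto simp: inv_cancel_left dest: subsetD)
next
  assume "y \<in> carrier G \<and> inv a \<otimes> y \<in> H"
  then show "y \<in> a <# H" unfolding l_coset_def using assms
    by (auto intro!: bexI[of _ "inv a \<otimes> y"] simp: inv_cancel_left)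
qed

lemma mem_r_coset:
  assumes "H \<subseteq> carrier G" "a \<in> carrier G"
  shows "y \<in> H #> a \<longleftrightarrow> y \<in> carrier G \<and> y \<otimes> inv a \<in> H"
proof
  assume "y \<in> H #> a"
  then obtain h where "h \<in> H" "y = h \<otimes> a" by (auto simp: r_coset_def)
  then show "y \<in> carrier G \<and> y \<otimes> inv a \<in> H" using assms by (auto simp: subset_iff m_assoc)
next
  assume "y \<in> carrier G \<and> y \<otimes> inv a \<in> H"
  then show "y \<in> H #> a" unfolding r_coset_def using assms
    by (auto intro!: bexI[of _ "y \<otimes> inv a"] simp: m_assoc)
qed

lemma mem_conj_subgroup:
  assumes "H \<subseteq> carrier G" "g \<in> carrier G"
  shows "y \<in> conj_subgroup G g H \<longleftrightarrow> y \<in> carrier G \<and> inv g \<otimes> y \<otimes> g \<in> H"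
  using assms l_coset_subset_G[of H g]
  by (auto simp: conj_subgroup_def mem_r_coset mem_l_coset m_assoc)

lemma conj_subgroup_closed:
  assumes "H \<subseteq> carrier G" "g \<in> carrier G"
  shows "conj_subgroup G g H \<subseteq> carrier G"
  using assms by (auto simp: mem_conj_subgroup)

lemma conj_subgroup_is_subgroup:
  assumes H: "subgroup H G" and g: "g \<in> carrier G"
  shows "subgroup (conj_subgroup G g H) G"
proof -
  interpret subgroup H G by fact
  note m = mem_conj_subgroup[OF subset g]
  show ?thesis
  proof (rule subgroupI)
    show "conj_subgroup G g H \<subseteq> carrier G" using m by auto
    have "\<one> \<in> conj_subgroup G g H" using g by (simp add: m)
    then show "conj_subgroup G g H \<noteq> {}" by auto
  next
    fix a assume a: "a \<in> conj_subgroup G g H"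
    then have ac: "a \<in> carrier G" by (simp add: m)
    then have "inv g \<otimes> inv a \<otimes> g = inv (inv g \<otimes> a \<otimes> g)" using g by (simp add: inv_mult_group m_assoc)
    then show "inv a \<in> conj_subgroup G g H" using a g by (simp add: m)
  next
    fix a b assume ab: "a \<in> conj_subgroup G g H" "b \<in> conj_subgroup G g H"
    then have ac: "a \<in> carrier G" "b \<in> carrier G" by (simp_all add: m)
    have "(inv g \<otimes> a \<otimes> g) \<otimes> (inv g \<otimes> b \<otimes> g) = inv g \<otimes> (a \<otimes> b) \<otimes> g"
      using ac g by (simp add: group_normalize)
    then show "a \<otimes> b \<in> conj_subgroup G g H" using ab g m_closed[of "inv g \<otimes> a \<otimes> g" "inv g \<otimes> b \<otimes> g"]
      by (simp add: m)
  qed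
qed

lemma conj_subgroup_conj:
  assumes "H \<subseteq> carrier G" "g \<in> carrier G" "h \<in> carrier G"
  shows "conj_subgroup G g (conj_subgroup G h H) = conj_subgroup G (g \<otimes> h) H"
  using assms conj_subgroup_closed[OF assms(1,3)]
  by (auto simp: set_eq_iff mem_conj_subgroup group_normalize)

lemma conj_subgroup_one: "H \<subseteq> carrier G \<Longrightarrow> conj_subgroup G \<one> H = H"
  by (auto simp: set_eq_iff mem_conj_subgroup dest: subsetD)

lemma conj_subgroup_cancel:
  assumes "H \<subseteq> carrier G" "g \<in> carrier G"
  shows "conj_subgroup G g (conj_subgroup G (inv g) H) = H"
    and "conj_subgroup G (inv g) (conj_subgroup G g H) = H"
  using assms by (simp_all add: conj_subgroup_conj conj_subgroup_one)

lemma conj_subgroup_mono: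
  assumes "H \<subseteq> K" "K \<subseteq> carrier G" "g \<in> carrier G"
  shows "conj_subgroup G g H \<subseteq> conj_subgroup G g K"
  using assms by (auto simp: mem_conj_subgroup subset_iff)

lemma conj_subgroup_Int:
  assumes "H \<subseteq> carrier G" "K \<subseteq> carrier G" "g \<in> carrier G"
  shows "conj_subgroup G g (H \<inter> K) = conj_subgroup G g H \<inter> conj_subgroup G g K"
proof -
  have "H \<inter> K \<subseteq> carrier G" using assms by auto
  then show ?thesis using assms by (auto simp: mem_conj_subgroup)
qed

lemma conj_subgroup_self:
  assumes "subgroup H G" "h \<in> H"
  shows "conj_subgroup G h H = H"
proof -
  interpret H: subgroup H G by fact
  have h: "h \<in> carrier G" using assms(2) H.subset by blast
  have "y \<in> H" if y: "y \<in> carrier G" "inv h \<otimes> y \<otimes> h \<in> H" for y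
  proof -
    have "h \<otimes> (inv h \<otimes> y \<otimes> h) \<otimes> inv h \<in> H" using y(2) assms(2) H.m_closed H.m_inv_closed by blast
    moreover have "h \<otimes> (inv h \<otimes> y \<otimes> h) \<otimes> inv h = y" using y h by (simp add: group_normalize)
    ultimately show ?thesis by simp
  qed
  moreover have "y \<in> carrier G \<and> inv h \<otimes> y \<otimes> h \<in> H" if "y \<in> H" for y
    using that assms(2) H.subset by auto
  ultimately show ?thesis unfolding set_eq_iff mem_conj_subgroup[OF H.subset h] by blast
qed

lemma card_conj_subgroup:
  assumes "H \<subseteq> carrier G" "g \<in> carrier G"
  shows "card (conj_subgroup G g H) = card H"
proof -
  have "bij_betw (\<lambda>y. inv g \<otimes> y \<otimes> g) (conj_subgroup G g H) H"
  proof (rule bij_betwI[where g = "\<lambda>h. g \<otimes> h \<otimes> inv g"])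
    show "(\<lambda>h. g \<otimes> h \<otimes> inv g) \<in> H \<rightarrow> conj_subgroup G g H"
    proof
      fix h assume h: "h \<in> H"
      then have "h \<in> carrier G" using assms by auto
      then show "g \<otimes> h \<otimes> inv g \<in> conj_subgroup G g H"
        using h assms by (simp add: mem_conj_subgroup group_normalize)
    qed
  qed (use assms in \<open>auto simp: mem_conj_subgroup group_normalize dest: subsetD\<close>)
  then show ?thesis by (rule bij_betw_same_card)
qed

section \<open>Left cosets as sets that determine their subgroup\<close>

definition lcos :: "'a set \<Rightarrow> 'a set set" where
  "lcos H = (\<lambda>a. a <# H) ` carrier G"

lemma l_coset_eq_iff:
  assumes "subgroup H G" "a \<in> carrier G" "b \<in> carrier G"
  shows "a <# H = b <# H \<longleftrightarrow> inv a \<otimes> b \<in> H"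
proof -
  interpret subgroup H G by fact
  have "b \<in> b <# H" using assms by (simp add: mem_l_coset subset)
  moreover have "inv b \<otimes> y \<in> H \<longleftrightarrow> inv a \<otimes> y \<in> H" if ab: "inv a \<otimes> b \<in> H" and y: "y \<in> carrier G" for y
  proof -
    have 1: "inv a \<otimes> y = (inv a \<otimes> b) \<otimes> (inv b \<otimes> y)"
      and 2: "inv b \<otimes> y = inv (inv a \<otimes> b) \<otimes> (inv a \<otimes> y)"
      using assms y by (simp_all add: group_normalize)
    show ?thesis using 1 2 ab m_closed m_inv_closed by metis
  qed
  ultimately show ?thesis using assms by (auto simp: mem_l_coset subset)
qed

lemma lcos_repr:
  assumes "subgroup H G" "x \<in> lcos H" "a \<in> x"
  shows "a \<in> carrier G" "x = a <# H"
proof -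
  interpret subgroup H G by fact
  obtain b where b: "b \<in> carrier G" "x = b <# H" using assms by (auto simp: lcos_def)
  with assms(3) have "a \<in> carrier G" "inv b \<otimes> a \<in> H" by (auto simp: mem_l_coset subset)
  then show "a \<in> carrier G" "x = a <# H" using b l_coset_eq_iff[OF assms(1) b(1)] by auto
qed

lemma lcos_ex:
  assumes "subgroup H G" "x \<in> lcos H"
  obtains a where "a \<in> x"
proof -
  interpret subgroup H G by fact
  obtain b where b: "b \<in> carrier G" "x = b <# H" using assms by (auto simp: lcos_def)
  then have "b \<in> x" by (simp add: mem_l_coset subset)
  then show thesis by (rule that)
qed

lemma lcosE:
  assumes "subgroup H G" "x \<in> lcos H"
  obtains a where "a \<in> x" "a \<in> carrier G" "x = a <# H"
  using lcos_ex[OF assms] lcos_repr[OF assms] by metis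

lemma l_coset_self: "subgroup H G \<Longrightarrow> a \<in> carrier G \<Longrightarrow> a \<in> a <# H"
  by (simp add: mem_l_coset subgroup.subset subgroup.one_closed)

lemma l_coset_in_lcos: "a \<in> carrier G \<Longrightarrow> a <# H \<in> lcos H"
  by (simp add: lcos_def)

lemma lcos_subset_carrier: "subgroup H G \<Longrightarrow> x \<in> lcos H \<Longrightarrow> x \<subseteq> carrier G"
  using lcos_repr(1) by blast

text \<open>For any element \<open>a\<close> of the coset, the subgroup consists of those
  \<open>h\<close> for which \<open>a \<otimes> h\<close> is in the coset, so the bare set remembers
  it.\<close>

lemma lcos_unique:
  assumes "subgroup H G" "subgroup K G" "x \<in> lcos H" "x \<in> lcos K"
  shows "H = K"
proof -
  obtain a where a: "a \<in> x" "a \<in> carrier G" "x = a <# H" by (rule lcosE[OF assms(1,3)])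
  with lcos_repr[OF assms(2,4)] have eq: "a <# H = a <# K" by auto
  have *: "h \<in> H \<longleftrightarrow> a \<otimes> h \<in> a <# H" "h \<in> K \<longleftrightarrow> a \<otimes> h \<in> a <# K" if "h \<in> carrier G" for h
    using that a(2) assms(1,2) by (simp_all add: mem_l_coset subgroup.subset inv_cancel_left)
  show ?thesis using * eq assms(1,2) subgroup.subset by blast
qed

lemma subgroup_in_lcos: "subgroup H G \<Longrightarrow> H \<in> lcos H"
  using l_coset_in_lcos[OF one_closed, of H] coset_join3[of \<one> H] by (simp add: subgroup.one_closed)

lemma lcos_supset_unique:
  assumes "subgroup K G" "x \<in> lcos K" "x' \<in> lcos K" "y \<subseteq> x" "y \<subseteq> x'" "y \<noteq> {}"
  shows "x = x'"
proof -
  obtain a where "a \<in> x" "a \<in> x'" using assms by auto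
  then show ?thesis using lcos_repr(2)[OF assms(1)] assms(2,3) by metis
qed

lemma lcos_nonempty: "subgroup H G \<Longrightarrow> x \<in> lcos H \<Longrightarrow> x \<noteq> {}"
  using lcos_ex by blast

lemma l_coset_subset_iff:
  assumes "subgroup H G" "subgroup K G" "H \<subseteq> K" "a \<in> carrier G" "b \<in> carrier G"
  shows "b <# H \<subseteq> a <# K \<longleftrightarrow> inv a \<otimes> b \<in> K"
proof
  assume "b <# H \<subseteq> a <# K"
  then have "b \<in> a <# K" using l_coset_self[OF assms(1,5)] by blast
  then show "inv a \<otimes> b \<in> K" using assms by (simp add: mem_l_coset subgroup.subset)
next
  assume "inv a \<otimes> b \<in> K"
  then have "a <# K = b <# K" using assms by (simp add: l_coset_eq_iff)
  then show "b <# H \<subseteq> a <# K" using assms(3) by (auto simp: l_coset_def)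
qed

text \<open>This is aHg = (ag)(g^{-1}Hg). Right translation by the inverse of \<open>g\<close>
  therefore takes cosets of \<open>H\<close> to cosets of its conjugate by \<open>g\<close>, as the
  action of the generator \<open>Conj g H\<close> must do.\<close>

lemma l_coset_r_coset:
  assumes "H \<subseteq> carrier G" "a \<in> carrier G" "g \<in> carrier G"
  shows "(a <# H) #> g = (a \<otimes> g) <# conj_subgroup G (inv g) H"
  using assms l_coset_subset_G[of H a] conj_subgroup_closed[of H "inv g"]
  by (auto simp: set_eq_iff mem_l_coset mem_r_coset mem_conj_subgroup group_normalize)

lemma lcos_r_coset:
  assumes "subgroup H G" "x \<in> lcos H" "g \<in> carrier G"
  shows "x #> g \<in> lcos (conj_subgroup G (inv g) H)"
proof -
  obtain a where "a \<in> carrier G" "x = a <# H" using assms(2) by (auto simp: lcos_def)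
  then show ?thesis using assms by (simp add: l_coset_r_coset subgroup.subset l_coset_in_lcos)
qed

lemma r_coset_cancel:
  assumes "x \<subseteq> carrier G" "g \<in> carrier G"
  shows "(x #> g) #> inv g = x" "(x #> inv g) #> g = x"
  using assms by (simp_all add: coset_mult_assoc)

lemma r_coset_mono: "x \<subseteq> y \<Longrightarrow> x #> g \<subseteq> y #> g"
  by (auto simp: r_coset_def)

section \<open>Cosets fixed by a subgroup, and the action of the generators on them\<close>

definition fixes_set :: "'a set \<Rightarrow> 'a set \<Rightarrow> bool" where
  "fixes_set P x \<longleftrightarrow> (\<forall>p\<in>P. \<forall>z\<in>x. p \<otimes> z \<in> x)"

text \<open>An element \<open>p\<close> maps aH into itself exactly if a^{-1}pa lies in
  \<open>H\<close>. The condition on the right is the usual description of the fixed points of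
  \<open>P\<close> on G/H, whose number is a mark.\<close>

lemma fixes_l_coset_iff:
  assumes "P \<subseteq> carrier G" "subgroup H G" "a \<in> carrier G"
  shows "fixes_set P (a <# H) \<longleftrightarrow> P \<subseteq> conj_subgroup G a H"
proof -
  interpret subgroup H G by fact
  note m = mem_l_coset[OF subset assms(3)] mem_conj_subgroup[OF subset assms(3)]
  show ?thesis
  proof
    assume *: "fixes_set P (a <# H)"
    have "p \<otimes> a \<in> a <# H" if "p \<in> P" for p
      using * that l_coset_self[OF assms(2,3)] by (auto simp: fixes_set_def)
    then show "P \<subseteq> conj_subgroup G a H" using assms by (auto simp: m m_assoc)
  next
    assume *: "P \<subseteq> conj_subgroup G a H"
    have "p \<otimes> z \<in> a <# H" if p: "p \<in> P" and z: "z \<in> a <# H" for p z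
    proof -
      have pc: "p \<in> carrier G" "inv a \<otimes> p \<otimes> a \<in> H" and zc: "z \<in> carrier G" "inv a \<otimes> z \<in> H"
        using * p z by (auto simp: m)
      have "inv a \<otimes> (p \<otimes> z) = (inv a \<otimes> p \<otimes> a) \<otimes> (inv a \<otimes> z)"
        using pc(1) zc(1) assms(3) by (simp add: group_normalize)
      then show ?thesis using pc zc by (simp add: m)
    qed
    then show "fixes_set P (a <# H)" by (auto simp: fixes_set_def)
  qed
qed

definition fixed_cosets :: "'a set \<Rightarrow> 'a set set" where
  "fixed_cosets P = {x. \<exists>H. subgroup H G \<and> x \<in> lcos H \<and> fixes_set P x}"

lemma fixed_cosets_subset: "x \<in> fixed_cosets P \<Longrightarrow> x \<subseteq> carrier G"
  using lcos_subset_carrier by (auto simp: fixed_cosets_def)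

lemma finite_fixed_cosets: "finite (carrier G) \<Longrightarrow> finite (fixed_cosets P)"
  by (rule finite_subset[of _ "Pow (carrier G)"]) (auto dest: fixed_cosets_subset)

lemma l_coset_fixed:
  assumes "P \<subseteq> carrier G" "subgroup H G" "a \<in> carrier G"
  shows "a <# H \<in> fixed_cosets P \<longleftrightarrow> P \<subseteq> conj_subgroup G a H"
  using assms fixes_l_coset_iff l_coset_in_lcos by (auto simp: fixed_cosets_def)

text \<open>If bH is fixed by \<open>P\<close>, so is the larger coset bK, because conjugation is
  monotone. This supplies the middle coset when a transfer or restriction is factored through an
  intermediate subgroup.\<close>

lemma ex_lcos_above:
  assumes "P \<subseteq> carrier G" "subgroup H G" "subgroup K G" "H \<subseteq> K" "y \<in> lcos H" "y \<in> fixed_cosets P"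
  shows "\<exists>z\<in>fixed_cosets P. z \<in> lcos K \<and> y \<subseteq> z"
proof -
  obtain b where b: "b \<in> carrier G" "y = b <# H" using assms(5) by (auto simp: lcos_def)
  have "P \<subseteq> conj_subgroup G b K"
    using assms b conj_subgroup_mono[OF assms(4) subgroup.subset[OF assms(3)] b(1)] by (auto simp: l_coset_fixed)
  then have "b <# K \<in> fixed_cosets P" using assms b by (simp add: l_coset_fixed)
  moreover have "y \<subseteq> b <# K" using assms(4) b by (auto simp: l_coset_def)
  ultimately show ?thesis using l_coset_in_lcos[OF b(1)] by blast
qed

lemma fixed_r_coset:
  assumes "x \<in> fixed_cosets P" "g \<in> carrier G" "P \<subseteq> carrier G"
  shows "x #> g \<in> fixed_cosets P"
proof -
  obtain H where H: "subgroup H G" "x \<in> lcos H" "fixes_set P x" using assms by (auto simp: fixed_cosets_def)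
  have "fixes_set P (x #> g)"
    unfolding fixes_set_def r_coset_def
  proof clarsimp
    fix p z assume "p \<in> P" "z \<in> x"
    then have "p \<otimes> (z \<otimes> g) = p \<otimes> z \<otimes> g" "p \<otimes> z \<in> x"
      using H assms lcos_subset_carrier[OF H(1,2)] by (auto simp: m_assoc fixes_set_def dest!: subsetD)
    then show "\<exists>h\<in>x. p \<otimes> (z \<otimes> g) = h \<otimes> g" by blast
  qed
  then show ?thesis
    using lcos_r_coset[OF H(1,2) assms(2)] conj_subgroup_is_subgroup[OF H(1) inv_closed[OF assms(2)]]
    unfolding fixed_cosets_def by blast
qed

text \<open>\<open>wcount P w\<close> is the matrix of the word \<open>w\<close> acting on the \<open>P\<close>-fixed left cosets, and \<open>grel a\<close> that
  of a single generator: transfer and restriction relate a coset to the cosets it contains, resp. to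
  those containing it, and conjugation is right translation. Cosets of different subgroups are
  different sets, so a coset determines the subgroup at which it lives.\<close>

primrec grel :: "'a mackey_gen \<Rightarrow> 'a set \<Rightarrow> 'a set \<Rightarrow> bool" where
  "grel (Tr K H) x y \<longleftrightarrow> x \<in> lcos K \<and> y \<in> lcos H \<and> y \<subseteq> x"
| "grel (Res K H) x y \<longleftrightarrow> x \<in> lcos H \<and> y \<in> lcos K \<and> x \<subseteq> y"
| "grel (Conj g H) x y \<longleftrightarrow> y \<in> lcos H \<and> x = y #> inv g"

fun wcount :: "'a set \<Rightarrow> 'a mackey_gen list \<Rightarrow> 'a set \<Rightarrow> 'a set \<Rightarrow> nat" where
  "wcount P [] x y = of_bool (x = y)"
| "wcount P (a # w) x y = (\<Sum>z\<in>fixed_cosets P. of_bool (grel a x z) * wcount P w z y)"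

section \<open>Counting paths between fixed cosets\<close>

lemma wcount_one:
  assumes "finite (carrier G)" "y \<in> fixed_cosets P"
  shows "wcount P [a] x y = of_bool (grel a x y)"
proof -
  have "wcount P [a] x y = (\<Sum>z\<in>fixed_cosets P. if z = y then of_bool (grel a x y) else 0)"
    unfolding wcount.simps by (rule sum.cong) auto
  then show ?thesis using assms finite_fixed_cosets by simp
qed

lemma wcount_append:
  assumes fin: "finite (carrier G)" and "x \<in> fixed_cosets P"
  shows "wcount P (u @ v) x y = (\<Sum>z\<in>fixed_cosets P. wcount P u x z * wcount P v z y)"
  using assms(2)
proof (induction u arbitrary: x)
  case Nil
  have "(\<Sum>z\<in>fixed_cosets P. wcount P [] x z * wcount P v z y)
      = (\<Sum>z\<in>fixed_cosets P. if x = z then wcount P v z y else 0)"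
    by (intro sum.cong) auto
  then show ?case using Nil finite_fixed_cosets[OF fin] by simp
next
  case (Cons a u)
  have "wcount P ((a # u) @ v) x y = (\<Sum>z\<in>fixed_cosets P. \<Sum>z'\<in>fixed_cosets P.
      of_bool (grel a x z) * (wcount P u z z' * wcount P v z' y))"
    using Cons.IH by (simp add: sum_distrib_left)
  also have "\<dots> = (\<Sum>z'\<in>fixed_cosets P. \<Sum>z\<in>fixed_cosets P.
      of_bool (grel a x z) * (wcount P u z z' * wcount P v z' y))"
    by (rule sum.swap)
  finally show ?case by (simp add: sum_distrib_right mult.assoc)
qed

lemma wcount_two:
  assumes "finite (carrier G)" "y \<in> fixed_cosets P"
  shows "wcount P [a, b] x y = (\<Sum>z\<in>fixed_cosets P. of_bool (grel a x z \<and> grel b z y))"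
proof -
  have "wcount P [a, b] x y = (\<Sum>z\<in>fixed_cosets P. of_bool (grel a x z) * wcount P [b] z y)" by simp
  also have "\<dots> = (\<Sum>z\<in>fixed_cosets P. of_bool (grel a x z \<and> grel b z y))"
    using wcount_one[OF assms] by (intro sum.cong) (auto simp del: wcount.simps)
  finally show ?thesis .
qed

lemma sum_of_bool_unique:
  assumes "finite A" "\<And>z z'. z \<in> A \<Longrightarrow> z' \<in> A \<Longrightarrow> Q z \<Longrightarrow> Q z' \<Longrightarrow> z = z'"
  shows "(\<Sum>z\<in>A. of_bool (Q z) :: nat) = of_bool (\<exists>z\<in>A. Q z)"
proof (cases "\<exists>z\<in>A. Q z")
  case True
  then obtain c where c: "c \<in> A" "Q c" by blast
  then have "(\<Sum>z\<in>A. of_bool (Q z) :: nat) = (\<Sum>z\<in>A. if z = c then 1 else 0)"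
    using assms(2) by (intro sum.cong) auto
  with c assms(1) show ?thesis by auto
qed auto

lemma wcount_two_unique:
  assumes "finite (carrier G)" "y \<in> fixed_cosets P"
    and "\<And>z z'. z \<in> fixed_cosets P \<Longrightarrow> z' \<in> fixed_cosets P \<Longrightarrow>
      grel a x z \<Longrightarrow> grel b z y \<Longrightarrow> grel a x z' \<Longrightarrow> grel b z' y \<Longrightarrow> z = z'"
  shows "wcount P [a, b] x y = of_bool (\<exists>z\<in>fixed_cosets P. grel a x z \<and> grel b z y)"
  unfolding wcount_two[OF assms(1,2)]
  using assms finite_fixed_cosets by (intro sum_of_bool_unique) auto

lemma wcount_tr_res_id:
  assumes "finite (carrier G)" "subgroup H G" "y \<in> fixed_cosets P"
  shows "wcount P [Tr H H] x y = wcount P [Res H H] x y"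
proof -
  have "x = y" if "x \<in> lcos H" "y \<in> lcos H" "y \<subseteq> x" for x y
    using lcos_supset_unique[OF assms(2) that(1,2,3) subset_refl lcos_nonempty[OF assms(2) that(2)]] .
  then have "grel (Tr H H) x y \<longleftrightarrow> grel (Res H H) x y" by fastforce
  then show ?thesis by (simp add: wcount_one[OF assms(1,3)] del: wcount.simps grel.simps)
qed

lemma grel_Tr_id:
  assumes "subgroup H G" shows "grel (Tr H H) x y \<longleftrightarrow> x = y \<and> x \<in> lcos H"
  using lcos_supset_unique[OF assms _ _ _ subset_refl lcos_nonempty[OF assms]] by auto

lemma grel_Res_id:
  assumes "subgroup H G" shows "grel (Res H H) x y \<longleftrightarrow> x = y \<and> x \<in> lcos H"
  using lcos_supset_unique[OF assms _ _ _ subset_refl lcos_nonempty[OF assms]] by auto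

lemma wcount_res_conj_id:
  assumes "finite (carrier G)" "subgroup H G" "h \<in> H" "y \<in> fixed_cosets P"
  shows "wcount P [Res H H] x y = wcount P [Conj h H] x y"
proof -
  have h: "h \<in> carrier G" using assms subgroup.subset by blast
  have "y #> inv h = y" if y: "y \<in> lcos H" for y
  proof -
    obtain a where a: "a \<in> carrier G" "y = a <# H" using y by (auto simp: lcos_def)
    then show ?thesis using h assms
      by (simp add: l_coset_r_coset subgroup.subset conj_subgroup_self l_coset_eq_iff group_normalize
        subgroup.m_inv_closed)
  qed
  then have "grel (Res H H) x y \<longleftrightarrow> grel (Conj h H) x y" unfolding grel_Res_id[OF assms(2)] by auto
  then show ?thesis by (simp add: wcount_one[OF assms(1,4)] del: wcount.simps grel.simps)
qed

text \<open>A coset lies in only one coset of a given larger subgroup, and a right translate is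
  unique, so a row of the matrix of \<open>Res\<close> or \<open>Conj\<close> has at most one
  nonzero entry. A row of \<open>Tr\<close> has one for every fixed smaller coset inside
  \<open>x\<close>, hence its exclusion; for columns the roles of \<open>Tr\<close> and
  \<open>Res\<close> are exchanged.\<close>

lemma grel_unique_left:
  assumes "grel a x z" "grel a x z'" "a \<in> mackey_gens G" "\<And>K H. a \<noteq> Tr K H"
  shows "z = z'"
proof (cases a)
  case (Res K H)
  then have "subgroup K G" and H: "subgroup H G" using assms(3) by (auto simp: mackey_gens_def)
  moreover have "z \<in> lcos K" "z' \<in> lcos K" "x \<subseteq> z" "x \<subseteq> z'" "x \<in> lcos H" using Res assms(1,2) by auto
  ultimately show ?thesis using lcos_nonempty[OF H] by (intro lcos_supset_unique[of K z z' x]) auto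
next
  case (Conj g H)
  then have H: "subgroup H G" "g \<in> carrier G" using assms(3) by (auto simp: mackey_gens_def)
  have "z = x #> g" if "grel a x z" for z
    using that Conj r_coset_cancel(2)[OF lcos_subset_carrier[OF H(1)] H(2)] by auto
  from this[OF assms(1)] this[OF assms(2)] show ?thesis by simp
next
  case (Tr K H)
  then show ?thesis using assms(4) by blast
qed

lemma grel_unique_right:
  assumes "grel b z y" "grel b z' y" "b \<in> mackey_gens G" "\<And>K H. b \<noteq> Res K H"
  shows "z = z'"
proof (cases b)
  case (Tr K H)
  then have "subgroup K G" and H: "subgroup H G" using assms(3) by (auto simp: mackey_gens_def)
  moreover have "z \<in> lcos K" "z' \<in> lcos K" "y \<subseteq> z" "y \<subseteq> z'" "y \<in> lcos H" using Tr assms(1,2) by auto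
  ultimately show ?thesis using lcos_nonempty[OF H] by (intro lcos_supset_unique[of K z z' y]) auto
next
  case (Conj g H)
  then show ?thesis using assms(1,2) by simp
next
  case (Res K H)
  then show ?thesis using assms(4) by blast
qed

text \<open>Except when a transfer stands to the left of a restriction, the middle coset of a path
  is unique. The entries are then 0 or 1, and an identity between two such words is an equivalence
  of two existence statements.\<close>

lemma wcount_two_eq:
  assumes fin: "finite (carrier G)" and y: "y \<in> fixed_cosets P"
    and ab: "a \<in> mackey_gens G" "b \<in> mackey_gens G"
    and uniq: "(\<forall>K H. a \<noteq> Tr K H) \<or> (\<forall>K H. b \<noteq> Res K H)"
  shows "wcount P [a, b] x y = of_bool (\<exists>z\<in>fixed_cosets P. grel a x z \<and> grel b z y)"
proof (rule wcount_two_unique[OF fin y])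
  fix z z'
  assume *: "grel a x z" "grel b z y" "grel a x z'" "grel b z' y"
  from uniq show "z = z'"
  proof
    assume "\<forall>K H. a \<noteq> Tr K H"
    then show ?thesis using grel_unique_left[OF *(1,3) ab(1)] by simp
  next
    assume "\<forall>K H. b \<noteq> Res K H"
    then show ?thesis using grel_unique_right[OF *(2,4) ab(2)] by simp
  qed
qed

lemma mackey_gens_simps [simp]:
  "Tr K H \<in> mackey_gens G \<longleftrightarrow> subgroup K G \<and> subgroup H G \<and> H \<subseteq> K"
  "Res K H \<in> mackey_gens G \<longleftrightarrow> subgroup K G \<and> subgroup H G \<and> H \<subseteq> K"
  "Conj g H \<in> mackey_gens G \<longleftrightarrow> g \<in> carrier G \<and> subgroup H G"
  by (auto simp: mackey_gens_def)

context
  fixes P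
  assumes fin: "finite (carrier G)" and P: "subgroup P G"
begin

lemma Pc: "P \<subseteq> carrier G" by (rule subgroup.subset[OF P])

text \<open>The middle coset is bK for any \<open>b\<close> in \<open>y\<close>: it contains
  \<open>y\<close>, and it lies in \<open>x\<close> because \<open>x\<close> is bL.\<close>

lemma wcount_tr_tr:
  assumes "subgroup H G" "subgroup K G" "subgroup L G" "H \<subseteq> K" "K \<subseteq> L" "y \<in> fixed_cosets P"
  shows "wcount P [Tr L K, Tr K H] x y = wcount P [Tr L H] x y"
proof -
  have "(\<exists>z\<in>fixed_cosets P. grel (Tr L K) x z \<and> grel (Tr K H) z y) \<longleftrightarrow> grel (Tr L H) x y"
  proof
    assume "grel (Tr L H) x y"
    then have xy: "x \<in> lcos L" "y \<in> lcos H" "y \<subseteq> x" by auto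
    obtain z where z: "z \<in> fixed_cosets P" "z \<in> lcos K" "y \<subseteq> z"
      using ex_lcos_above[OF Pc assms(1,2,4) xy(2) assms(6)] by blast
    obtain b where b: "b \<in> y" using xy lcos_ex assms(1) by blast
    then have "x = b <# L" "z = b <# K" using xy z lcos_repr(2) assms by auto
    then have "z \<subseteq> x" using assms(5) by (auto simp: l_coset_def)
    then show "\<exists>z\<in>fixed_cosets P. grel (Tr L K) x z \<and> grel (Tr K H) z y" using z xy by auto
  qed auto
  then show ?thesis
    using assms by (simp add: wcount_two_eq[OF fin] wcount_one[OF fin] del: wcount.simps grel.simps)
qed

lemma wcount_res_res:
  assumes "subgroup H G" "subgroup K G" "subgroup L G" "H \<subseteq> K" "K \<subseteq> L"
    and "x \<in> fixed_cosets P" "y \<in> fixed_cosets P"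
  shows "wcount P [Res K H, Res L K] x y = wcount P [Res L H] x y"
proof -
  have "(\<exists>z\<in>fixed_cosets P. grel (Res K H) x z \<and> grel (Res L K) z y) \<longleftrightarrow> grel (Res L H) x y"
  proof
    assume "grel (Res L H) x y"
    then have xy: "y \<in> lcos L" "x \<in> lcos H" "x \<subseteq> y" by auto
    obtain z where z: "z \<in> fixed_cosets P" "z \<in> lcos K" "x \<subseteq> z"
      using ex_lcos_above[OF Pc assms(1,2,4) xy(2) assms(6)] by blast
    obtain b where b: "b \<in> x" using xy lcos_ex assms(1) by blast
    then have "y = b <# L" "z = b <# K" using xy z lcos_repr(2) assms by auto
    then have "z \<subseteq> y" using assms(5) by (auto simp: l_coset_def)
    then show "\<exists>z\<in>fixed_cosets P. grel (Res K H) x z \<and> grel (Res L K) z y" using z xy by auto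
  qed auto
  then show ?thesis
    using assms by (simp add: wcount_two_eq[OF fin] wcount_one[OF fin] del: wcount.simps grel.simps)
qed

lemma wcount_conj_conj:
  assumes "subgroup H G" "g \<in> carrier G" "g' \<in> carrier G" "y \<in> fixed_cosets P"
  shows "wcount P [Conj g' (conj_subgroup G g H), Conj g H] x y = wcount P [Conj (g' \<otimes> g) H] x y"
proof -
  have "(y #> inv g) #> inv g' = y #> inv (g' \<otimes> g)" if "y \<in> lcos H"
    using assms lcos_subset_carrier[OF assms(1) that] by (simp add: coset_mult_assoc inv_mult_group)
  then have "(\<exists>z\<in>fixed_cosets P. grel (Conj g' (conj_subgroup G g H)) x z \<and> grel (Conj g H) z y)
      \<longleftrightarrow> grel (Conj (g' \<otimes> g) H) x y"
    using fixed_r_coset[OF assms(4) inv_closed[OF assms(2)] Pc] lcos_r_coset[OF assms(1) _ inv_closed[OF assms(2)]] assms(2)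
    by auto
  then show ?thesis using assms conj_subgroup_is_subgroup
    by (simp add: wcount_two_eq[OF fin] wcount_one[OF fin] del: wcount.simps grel.simps)
qed

text \<open>Right translation preserves inclusions, so a path through \<open>y #> inv g\<close> for
  the first word corresponds to a path through \<open>x #> g\<close> for the second.\<close>

lemma wcount_tr_conj:
  assumes "subgroup H G" "subgroup K G" "H \<subseteq> K" "g \<in> carrier G" "x \<in> fixed_cosets P" "y \<in> fixed_cosets P"
  shows "wcount P [Tr (conj_subgroup G g K) (conj_subgroup G g H), Conj g H] x y
    = wcount P [Conj g K, Tr K H] x y"
proof -
  note sg = conj_subgroup_is_subgroup[OF assms(1,4)] conj_subgroup_is_subgroup[OF assms(2,4)]
  have "(\<exists>z\<in>fixed_cosets P. grel (Tr (conj_subgroup G g K) (conj_subgroup G g H)) x z \<and> grel (Conj g H) z y)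
    \<longleftrightarrow> (\<exists>z\<in>fixed_cosets P. grel (Conj g K) x z \<and> grel (Tr K H) z y)" (is "?l \<longleftrightarrow> ?r")
  proof
    assume ?l
    then have *: "x \<in> lcos (conj_subgroup G g K)" "y \<in> lcos H" "y #> inv g \<subseteq> x" by auto
    have "x #> g \<in> lcos K"
      using lcos_r_coset[OF sg(2) *(1) assms(4)] assms by (simp add: conj_subgroup_cancel subgroup.subset)
    moreover have "y \<subseteq> x #> g"
      using r_coset_mono[OF *(3), of g] r_coset_cancel(2)[OF lcos_subset_carrier[OF assms(1) *(2)] assms(4)] by simp
    moreover have "x = (x #> g) #> inv g"
      using r_coset_cancel(1)[OF lcos_subset_carrier[OF sg(2) *(1)] assms(4)] by simp
    ultimately show ?r using * fixed_r_coset[OF assms(5,4) Pc] by (intro bexI[of _ "x #> g"]) auto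
  next
    assume ?r
    then obtain z where z: "z \<in> lcos K" "x = z #> inv g" "y \<in> lcos H" "y \<subseteq> z" by auto
    then show ?l
      using assms fixed_r_coset[OF assms(6) inv_closed[OF assms(4)] Pc]
        lcos_r_coset[OF assms(2) z(1) inv_closed[OF assms(4)]]
        lcos_r_coset[OF assms(1) z(3) inv_closed[OF assms(4)]] r_coset_mono[OF z(4)]
      by (intro bexI[of _ "y #> inv g"]) auto
  qed
  then show ?thesis using assms sg conj_subgroup_mono[OF assms(3) subgroup.subset[OF assms(2)] assms(4)]
    by (simp add: wcount_two_eq[OF fin] del: wcount.simps grel.simps)
qed

lemma wcount_res_conj:
  assumes "subgroup H G" "subgroup K G" "H \<subseteq> K" "g \<in> carrier G" "x \<in> fixed_cosets P" "y \<in> fixed_cosets P"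
  shows "wcount P [Res (conj_subgroup G g K) (conj_subgroup G g H), Conj g K] x y
    = wcount P [Conj g H, Res K H] x y"
proof -
  note sg = conj_subgroup_is_subgroup[OF assms(1,4)] conj_subgroup_is_subgroup[OF assms(2,4)]
  have "(\<exists>z\<in>fixed_cosets P. grel (Res (conj_subgroup G g K) (conj_subgroup G g H)) x z \<and> grel (Conj g K) z y)
    \<longleftrightarrow> (\<exists>z\<in>fixed_cosets P. grel (Conj g H) x z \<and> grel (Res K H) z y)" (is "?l \<longleftrightarrow> ?r")
  proof
    assume ?l
    then have *: "x \<in> lcos (conj_subgroup G g H)" "y \<in> lcos K" "x \<subseteq> y #> inv g" by auto
    have "x #> g \<in> lcos H"
      using lcos_r_coset[OF sg(1) *(1) assms(4)] assms by (simp add: conj_subgroup_cancel subgroup.subset)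
    moreover have "x #> g \<subseteq> y"
      using r_coset_mono[OF *(3), of g] r_coset_cancel(2)[OF lcos_subset_carrier[OF assms(2) *(2)] assms(4)] by simp
    moreover have "x = (x #> g) #> inv g"
      using r_coset_cancel(1)[OF lcos_subset_carrier[OF sg(1) *(1)] assms(4)] by simp
    ultimately show ?r using * fixed_r_coset[OF assms(5,4) Pc] by (intro bexI[of _ "x #> g"]) auto
  next
    assume ?r
    then obtain z where z: "z \<in> lcos H" "x = z #> inv g" "y \<in> lcos K" "z \<subseteq> y" by auto
    then show ?l
      using assms fixed_r_coset[OF assms(6) inv_closed[OF assms(4)] Pc]
        lcos_r_coset[OF assms(1) z(1) inv_closed[OF assms(4)]]
        lcos_r_coset[OF assms(2) z(3) inv_closed[OF assms(4)]] r_coset_mono[OF z(4)]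
      by (intro bexI[of _ "y #> inv g"]) auto
  qed
  then show ?thesis using assms sg conj_subgroup_mono[OF assms(3) subgroup.subset[OF assms(2)] assms(4)]
    by (simp add: wcount_two_eq[OF fin] del: wcount.simps grel.simps)
qed

lemma grel_source_target:
  assumes "a \<in> mackey_gens G" "grel a x y"
  shows "x \<in> lcos (gen_target G a)" "y \<in> lcos (gen_source a)"
proof -
  have "y #> inv g \<in> lcos (conj_subgroup G g H)" if "subgroup H G" "y \<in> lcos H" "g \<in> carrier G" for g H
    using lcos_r_coset[OF that(1,2) inv_closed[OF that(3)]] that(3) by simp
  then show "x \<in> lcos (gen_target G a)" "y \<in> lcos (gen_source a)"
    using assms by (cases a; simp)+
qed

lemma gen_subgroups:
  assumes "a \<in> mackey_gens G"
  shows "subgroup (gen_source a) G" "subgroup (gen_target G a) G"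
  using assms conj_subgroup_is_subgroup by (cases a; simp)+

text \<open>The middle coset of a path would be a coset of two different subgroups.\<close>

lemma wcount_zero:
  assumes "a \<in> mackey_gens G" "b \<in> mackey_gens G" "gen_source a \<noteq> gen_target G b" "y \<in> fixed_cosets P"
  shows "wcount P [a, b] x y = 0"
proof -
  have "\<not> (grel a x z \<and> grel b z y)" for z
  proof
    assume z: "grel a x z \<and> grel b z y"
    then have "z \<in> lcos (gen_source a)" "z \<in> lcos (gen_target G b)"
      using grel_source_target(2)[OF assms(1)] grel_source_target(1)[OF assms(2)] by blast+
    then show False
      using lcos_unique[OF gen_subgroups(1)[OF assms(1)] gen_subgroups(2)[OF assms(2)]] assms(3) by blast
  qed
  then show ?thesis unfolding wcount_two[OF fin assms(4)] by (intro sum.neutral) simp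
qed

text \<open>The words for the \<open>H\<close> are diagonal projections onto the cosets of
  \<open>H\<close>. They sum to the identity because every fixed coset belongs to exactly one
  subgroup.\<close>

lemma wcount_unit:
  assumes "x \<in> fixed_cosets P" "y \<in> fixed_cosets P"
  shows "(\<Sum>H\<in>{H. subgroup H G}. wcount P [Tr H H] x y) = wcount P [] x y"
proof -
  have fs: "finite {H. subgroup H G}"
    by (rule finite_subset[of _ "Pow (carrier G)"]) (use fin subgroup.subset in auto)
  have "(\<Sum>H\<in>{H. subgroup H G}. wcount P [Tr H H] x y)
      = (\<Sum>H\<in>{H. subgroup H G}. of_bool (x = y \<and> x \<in> lcos H))"
    by (intro sum.cong) (simp_all add: wcount_one[OF fin assms(2)] grel_Tr_id del: wcount.simps grel.simps)
  also have "\<dots> = of_bool (\<exists>H\<in>{H. subgroup H G}. x = y \<and> x \<in> lcos H)"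
    using lcos_unique by (intro sum_of_bool_unique fs) auto
  also have "(\<exists>H\<in>{H. subgroup H G}. x = y \<and> x \<in> lcos H) \<longleftrightarrow> x = y"
    using assms by (auto simp: fixed_cosets_def)
  finally show ?thesis by simp
qed

end

section \<open>Standard words and the evaluation of their matrix entries\<close>

definition std_word :: "'a set \<Rightarrow> 'a set \<Rightarrow> 'a \<Rightarrow> 'a set \<Rightarrow> 'a mackey_gen list" where
  "std_word K L g H =
    [Tr K L, Conj g (conj_subgroup G (inv g) L), Res H (conj_subgroup G (inv g) L)]"

definition std_index :: "('a set \<times> 'a set \<times> 'a \<times> 'a set) set" where
  "std_index = {(K, L, g, H). subgroup K G \<and> subgroup L G \<and> subgroup H G \<and> g \<in> carrier G
    \<and> L \<subseteq> K \<and> conj_subgroup G (inv g) L \<subseteq> H}"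

lemma std_indexD:
  assumes "(K, L, g, H) \<in> std_index"
  shows "subgroup K G" "subgroup L G" "subgroup H G" "g \<in> carrier G" "L \<subseteq> K"
    "conj_subgroup G (inv g) L \<subseteq> H" "subgroup (conj_subgroup G (inv g) L) G"
  using assms conj_subgroup_is_subgroup by (auto simp: std_index_def)

lemma card_l_coset:
  assumes "H \<subseteq> carrier G" "a \<in> carrier G"
  shows "card (a <# H) = card H"
proof -
  have "a <# H = (\<lambda>h. a \<otimes> h) ` H" by (auto simp: l_coset_def)
  moreover have "inj_on (\<lambda>h. a \<otimes> h) H"
  proof (rule inj_onI)
    fix x y assume "x \<in> H" "y \<in> H" "a \<otimes> x = a \<otimes> y"
    then show "x = y" using inv_cancel_left(1)[OF assms(2), of x] inv_cancel_left(1)[OF assms(2), of y] assms(1)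
      by auto
  qed
  ultimately show ?thesis by (simp add: card_image)
qed

context
  assumes fin: "finite (carrier G)"
begin

text \<open>A path is determined by its coset \<open>u\<close> of \<open>L\<close>, since the
  conjugation forces the next coset to be \<open>u #> g\<close>. Such a \<open>u\<close> is a fixed
  point of the middle set of the span over the pair (x, y).\<close>

lemma wcount_std:
  assumes "(K, L, g, H) \<in> std_index" "subgroup P G" "y \<in> fixed_cosets P"
  shows "wcount P (std_word K L g H) x y =
    card {u \<in> fixed_cosets P. x \<in> lcos K \<and> y \<in> lcos H \<and> u \<in> lcos L \<and> u \<subseteq> x \<and> u #> g \<subseteq> y}"
proof -
  let ?L' = "conj_subgroup G (inv g) L"
  note I = std_indexD[OF assms(1)]
  note Pc = subgroup.subset[OF assms(2)]
  have "of_bool (grel (Tr K L) x u) * wcount P [Conj g ?L', Res H ?L'] u y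
      = (of_bool (x \<in> lcos K \<and> y \<in> lcos H \<and> u \<in> lcos L \<and> u \<subseteq> x \<and> u #> g \<subseteq> y) :: nat)"
    if u: "u \<in> fixed_cosets P" for u
  proof -
    have "(\<exists>v\<in>fixed_cosets P. grel (Conj g ?L') u v \<and> grel (Res H ?L') v y)
      \<longleftrightarrow> y \<in> lcos H \<and> u #> g \<subseteq> y" if uL: "u \<in> lcos L"
    proof
      assume "\<exists>v\<in>fixed_cosets P. grel (Conj g ?L') u v \<and> grel (Res H ?L') v y"
      then obtain v where v: "v \<in> lcos ?L'" "u = v #> inv g" "y \<in> lcos H" "v \<subseteq> y" by auto
      then have "u #> g = v" using r_coset_cancel(2)[OF lcos_subset_carrier[OF I(7) v(1)] I(4)] by simp
      with v show "y \<in> lcos H \<and> u #> g \<subseteq> y" by simp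
    next
      assume y: "y \<in> lcos H \<and> u #> g \<subseteq> y"
      have "u #> g \<in> lcos ?L'" using lcos_r_coset[OF I(2) uL I(4)] .
      moreover have "u = (u #> g) #> inv g"
        using r_coset_cancel(1)[OF lcos_subset_carrier[OF I(2) uL] I(4)] by simp
      ultimately show "\<exists>v\<in>fixed_cosets P. grel (Conj g ?L') u v \<and> grel (Res H ?L') v y"
        using fixed_r_coset[OF u I(4) Pc] y by (intro bexI[of _ "u #> g"]) auto
    qed
    moreover have "wcount P [Conj g ?L', Res H ?L'] u y
        = of_bool (\<exists>v\<in>fixed_cosets P. grel (Conj g ?L') u v \<and> grel (Res H ?L') v y)"
      using I by (intro wcount_two_eq[OF fin assms(3)]) auto
    ultimately show ?thesis by auto
  qed
  then have "wcount P (std_word K L g H) x y = (\<Sum>u\<in>fixed_cosets P.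
      of_bool (x \<in> lcos K \<and> y \<in> lcos H \<and> u \<in> lcos L \<and> u \<subseteq> x \<and> u #> g \<subseteq> y))"
    unfolding std_word_def wcount.simps(2)[of P "Tr K L"] by (rule sum.cong[OF refl])
  then show ?thesis using finite_fixed_cosets[OF fin] by (simp add: sum_of_bool_eq Int_def)
qed

text \<open>The counted cosets of \<open>L\<close> are disjoint and have \<open>card L\<close>
  elements each, so multiplying by \<open>card L\<close> counts the group elements \<open>a\<close>
  in them. Being fixed by \<open>P\<close> becomes a containment in the conjugate of
  \<open>L\<close> by \<open>a\<close>, and elements are easier to biject than cosets.\<close>

lemma card_wcount_std:
  assumes "(K, L, g, H) \<in> std_index" "subgroup P G" "y \<in> fixed_cosets P"
  shows "card L * wcount P (std_word K L g H) x y =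
    card {a \<in> carrier G. x \<in> lcos K \<and> y \<in> lcos H \<and> a \<in> x \<and> a \<otimes> g \<in> y \<and> P \<subseteq> conj_subgroup G a L}"
    (is "_ = card ?A")
proof -
  note I = std_indexD[OF assms(1)]
  note Pc = subgroup.subset[OF assms(2)]
  let ?U = "{u \<in> fixed_cosets P. x \<in> lcos K \<and> y \<in> lcos H \<and> u \<in> lcos L \<and> u \<subseteq> x \<and> u #> g \<subseteq> y}"
  have key: "a <# L \<in> ?U \<longleftrightarrow> x \<in> lcos K \<and> y \<in> lcos H \<and> a \<in> x \<and> a \<otimes> g \<in> y \<and> P \<subseteq> conj_subgroup G a L"
    if a: "a \<in> carrier G" for a
  proof -
    have 1: "a <# L \<subseteq> x \<longleftrightarrow> a \<in> x" if "x \<in> lcos K"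
    proof -
      have "a \<in> x \<Longrightarrow> a <# L \<subseteq> x"
        using lcos_repr(2)[OF I(1) that, of a] I(5) by (auto simp: l_coset_def)
      then show ?thesis using l_coset_self[OF I(2) a] by blast
    qed
    have 2: "(a <# L) #> g \<subseteq> y \<longleftrightarrow> a \<otimes> g \<in> y" if "y \<in> lcos H"
    proof -
      have eq: "(a <# L) #> g = (a \<otimes> g) <# conj_subgroup G (inv g) L"
        using a I by (simp add: l_coset_r_coset subgroup.subset)
      have "a \<otimes> g \<in> y \<Longrightarrow> (a <# L) #> g \<subseteq> y"
        using lcos_repr(2)[OF I(3) that, of "a \<otimes> g"] I(6) unfolding eq by (auto simp: l_coset_def)
      moreover have "a \<otimes> g \<in> (a <# L) #> g" unfolding eq using a I by (intro l_coset_self) auto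
      ultimately show ?thesis by blast
    qed
    show ?thesis using 1 2 a l_coset_fixed[OF Pc I(2) a] l_coset_in_lcos[OF a, of L] by auto
  qed
  have "?A = \<Union>?U"
  proof (intro equalityI subsetI)
    fix a assume "a \<in> ?A"
    then have "a <# L \<in> ?U" "a \<in> a <# L" using key l_coset_self[OF I(2)] by blast+
    then show "a \<in> \<Union>?U" by blast
  next
    fix a assume "a \<in> \<Union>?U"
    then obtain u where u: "u \<in> ?U" "a \<in> u" by blast
    then have "a \<in> carrier G" "u = a <# L" using lcos_repr[OF I(2)] by blast+
    then have "a \<in> carrier G" "a <# L \<in> ?U" using u(1) by simp_all
    then show "a \<in> ?A" using key by blast
  qed
  moreover have "card (\<Union>?U) = (\<Sum>u\<in>?U. card u)"
  proof (rule card_Union_disjoint)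
    show "disjoint ?U"
      unfolding pairwise_def disjnt_def using lcos_repr(2)[OF I(2)] by blast
    show "finite u" if "u \<in> ?U" for u
      using that finite_subset[OF _ fin] fixed_cosets_subset by blast
  qed
  moreover have "(\<Sum>u\<in>?U. card u) = (\<Sum>u\<in>?U. card L)"
    using I by (intro sum.cong) (auto simp: lcos_def card_l_coset subgroup.subset)
  ultimately show ?thesis using wcount_std[OF assms] by simp
qed

lemma finite_subgroup: "subgroup H G \<Longrightarrow> finite H"
  using finite_subset[OF subgroup.subset fin] .

lemma finite_subgroups: "finite {H. subgroup H G}"
  by (rule finite_subset[of _ "Pow (carrier G)"]) (use fin subgroup.subset in auto)

lemma card_subgroup_pos: "subgroup H G \<Longrightarrow> card H > 0"
  using finite_subgroup subgroup.one_closed by (metis card_gt_0_iff empty_iff)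

text \<open>A nonzero entry means that \<open>card_wcount_std\<close> counts some \<open>a\<close>.
  Then \<open>P\<close> lies in the conjugate of \<open>L\<close> by \<open>a\<close>, which has the
  order of \<open>L\<close> and so must equal \<open>P\<close> once the orders agree.\<close>

lemma wcount_std_nonzeroD:
  assumes "(K, L, g, H) \<in> std_index" "subgroup P G" "y \<in> fixed_cosets P"
    and nz: "wcount P (std_word K L g H) x y \<noteq> 0"
  obtains a where "a \<in> carrier G" "x = a <# K" "y = (a \<otimes> g) <# H" "a \<in> x" "a \<otimes> g \<in> y"
    "P \<subseteq> conj_subgroup G a L" "card P \<le> card L" "card P = card L \<longrightarrow> P = conj_subgroup G a L"
proof -
  note I = std_indexD[OF assms(1)]
  have "card {a \<in> carrier G. x \<in> lcos K \<and> y \<in> lcos H \<and> a \<in> x \<and> a \<otimes> g \<in> y \<and> P \<subseteq> conj_subgroup G a L} \<noteq> 0"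
    unfolding card_wcount_std[OF assms(1-3), of x, symmetric] using nz card_subgroup_pos[OF I(2)] by simp
  then have "{a \<in> carrier G. x \<in> lcos K \<and> y \<in> lcos H \<and> a \<in> x \<and> a \<otimes> g \<in> y \<and> P \<subseteq> conj_subgroup G a L} \<noteq> {}"
    by (intro notI) simp
  then obtain a where a: "a \<in> carrier G" "x \<in> lcos K" "y \<in> lcos H" "a \<in> x" "a \<otimes> g \<in> y" "P \<subseteq> conj_subgroup G a L"
    by blast
  have f: "finite (conj_subgroup G a L)" using finite_subgroup conj_subgroup_is_subgroup[OF I(2) a(1)] .
  have c: "card (conj_subgroup G a L) = card L" using card_conj_subgroup[OF subgroup.subset[OF I(2)] a(1)] .
  show thesis
    using a lcos_repr(2)[OF I(1) a(2,4)] lcos_repr(2)[OF I(3) a(3,5)] card_mono[OF f a(6)]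
      card_subset_eq[OF f a(6)] c by (intro that[of a]) auto
qed

lemma mackey_Int:
  assumes "K \<subseteq> carrier G" "L \<subseteq> carrier G" "h \<in> carrier G"
  shows "conj_subgroup G (inv h) (L \<inter> conj_subgroup G h K) = conj_subgroup G (inv h) L \<inter> K"
  using assms by (simp add: conj_subgroup_Int conj_subgroup_closed conj_subgroup_cancel)

text \<open>Together with \<open>mackey_std_word\<close> this puts the summands of the Mackey
  relation into standard form, so that \<open>wcount_std\<close> evaluates their entries.\<close>

lemma mackey_index:
  assumes "subgroup K G" "subgroup L G" "h \<in> carrier G"
  shows "(L, L \<inter> conj_subgroup G h K, h, K) \<in> std_index"
  using assms conj_subgroup_is_subgroup mackey_Int[of K L h]
  by (auto simp: std_index_def subgroup.subset intro: subgroups_Inter_pair)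

lemma mackey_std_word:
  assumes "subgroup K G" "subgroup L G" "h \<in> carrier G"
  shows "[Tr L (L \<inter> conj_subgroup G h K), Conj h (conj_subgroup G (inv h) L \<inter> K),
      Res K (conj_subgroup G (inv h) L \<inter> K)] = std_word L (L \<inter> conj_subgroup G h K) h K"
  using assms by (simp add: std_word_def mackey_Int subgroup.subset)

lemma mem_double_coset:
  assumes "subgroup L G" "subgroup K G" "h \<in> carrier G"
  shows "z \<in> (L #> h) <#> K \<longleftrightarrow> (\<exists>l\<in>L. \<exists>k\<in>K. z = l \<otimes> h \<otimes> k)"
  by (auto simp: set_mult_def r_coset_def)

text \<open>Write x = aL and y = bK and put c = a^{-1}b. The left hand side is 1 exactly if
  \<open>c\<close> lies in \<open>H\<close>; the summand of \<open>h\<close> on the right is 1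
  exactly if \<open>c\<close> lies in the double coset LhK. The claim is that these double cosets
  partition \<open>H\<close>.\<close>

lemma wcount_mackey:
  assumes "subgroup H G" "subgroup K G" "subgroup L G" "K \<subseteq> H" "L \<subseteq> H"
    and D: "double_coset_reps G L H K D" and P: "subgroup P G"
    and x: "x \<in> fixed_cosets P" and y: "y \<in> fixed_cosets P"
  shows "wcount P [Res H L, Tr H K] x y = (\<Sum>h\<in>D. wcount P [Tr L (L \<inter> conj_subgroup G h K),
      Conj h (conj_subgroup G (inv h) L \<inter> K), Res K (conj_subgroup G (inv h) L \<inter> K)] x y)"
proof -
  interpret H: subgroup H G by fact
  interpret K: subgroup K G by fact
  interpret L: subgroup L G by fact
  note Pc = subgroup.subset[OF P]
  have DH: "D \<subseteq> H" and Dex: "\<And>z. z \<in> H \<Longrightarrow> \<exists>!h. h \<in> D \<and> z \<in> (L #> h) <#> K"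
    using D by (auto simp: double_coset_reps_def)
  have Dc: "h \<in> carrier G" if "h \<in> D" for h using that DH H.subset by blast
  have finD: "finite D" using finite_subset[OF DH finite_subgroup[OF assms(1)]] .
  let ?M = "\<lambda>h. L \<inter> conj_subgroup G h K"
  have rhs: "(\<Sum>h\<in>D. wcount P [Tr L (L \<inter> conj_subgroup G h K),
      Conj h (conj_subgroup G (inv h) L \<inter> K), Res K (conj_subgroup G (inv h) L \<inter> K)] x y)
    = (\<Sum>h\<in>D. wcount P (std_word L (?M h) h K) x y)"
    using mackey_std_word[OF assms(2,3) Dc] by (intro sum.cong) auto
  have lhs: "wcount P [Res H L, Tr H K] x y
      = of_bool (x \<in> lcos L \<and> y \<in> lcos K \<and> (\<exists>z\<in>fixed_cosets P. z \<in> lcos H \<and> x \<subseteq> z \<and> y \<subseteq> z))"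
    using assms by (subst wcount_two_eq[OF fin y]) auto
  show ?thesis
  proof (cases "x \<in> lcos L \<and> y \<in> lcos K")
    case False
    have "wcount P (std_word L (?M h) h K) x y = 0" if "h \<in> D" for h
    proof -
      have "{u \<in> fixed_cosets P. x \<in> lcos L \<and> y \<in> lcos K \<and> u \<in> lcos (?M h) \<and> u \<subseteq> x \<and> u #> h \<subseteq> y} = {}"
        using False by blast
      then show ?thesis
        unfolding wcount_std[OF mackey_index[OF assms(2,3) Dc[OF that]] P y] by (simp only: card.empty)
    qed
    moreover have "wcount P [Res H L, Tr H K] x y = 0" unfolding lhs using False by auto
    ultimately show ?thesis unfolding rhs by simp
  next
    case True
    then obtain a b where a: "a \<in> x" "a \<in> carrier G" "x = a <# L" and b: "b \<in> y" "b \<in> carrier G" "y = b <# K"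
      using lcosE[OF assms(3)] lcosE[OF assms(2)] by metis
    have Pa: "P \<subseteq> conj_subgroup G a L" using x l_coset_fixed[OF Pc assms(3) a(2)] a(3) by simp
    have Pb: "P \<subseteq> conj_subgroup G b K" using y l_coset_fixed[OF Pc assms(2) b(2)] b(3) by simp
    let ?c = "inv a \<otimes> b"
    have c: "?c \<in> carrier G" using a b by simp
    have count: "wcount P (std_word L (?M h) h K) x y = of_bool (?c \<in> (L #> h) <#> K)" if h: "h \<in> D" for h
    proof -
      note idx = mackey_index[OF assms(2,3) Dc[OF h]]
      let ?U = "{u \<in> fixed_cosets P. x \<in> lcos L \<and> y \<in> lcos K \<and> u \<in> lcos (?M h) \<and> u \<subseteq> x \<and> u #> h \<subseteq> y}"
      have hc: "h \<in> carrier G" using Dc[OF h] .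
      have M: "subgroup (?M h) G" using std_indexD(2)[OF idx] .
      have props: "inv a \<otimes> \<alpha> \<in> L \<and> inv (\<alpha> \<otimes> h) \<otimes> b \<in> K" if u: "u \<in> ?U" "\<alpha> \<in> u" for u \<alpha>
      proof -
        have ux: "u \<subseteq> x" "u #> h \<subseteq> y" "u \<in> lcos (?M h)" using u by simp_all
        have \<alpha>: "\<alpha> \<in> carrier G" using ux(3) u(2) lcos_repr(1)[OF M] by blast
        have 1: "\<alpha> \<in> x" using ux u(2) by blast
        have "\<alpha> \<otimes> h \<in> u #> h" using u(2) by (auto simp: r_coset_def)
        then have "y = (\<alpha> \<otimes> h) <# K" using ux(2) lcos_repr(2)[OF assms(2)] True by blast
        then have "inv (\<alpha> \<otimes> h) \<otimes> b \<in> K" using l_coset_eq_iff[OF assms(2), of "\<alpha> \<otimes> h" b] b \<alpha> hc by simp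
        moreover have "inv a \<otimes> \<alpha> \<in> L" using 1 mem_l_coset[OF L.subset a(2)] a(3) by simp
        ultimately show ?thesis by simp
      qed
      \<comment> \<open>Elements of two admissible cosets differ by an element of \<open>L\<close>,
        because both lie in \<open>x\<close>, and by one of the conjugate of \<open>K\<close> by
        \<open>h\<close>, because their translates by \<open>h\<close> lie in \<open>y\<close>. So
        they differ by an element of the intersection.\<close>
      have uniq: "u = u'" if u: "u \<in> ?U" "u' \<in> ?U" for u u'
      proof -
        obtain \<alpha> where \<alpha>: "\<alpha> \<in> u" "\<alpha> \<in> carrier G" "u = \<alpha> <# ?M h" using lcosE[OF M, of u] u by blast
        obtain \<beta> where \<beta>: "\<beta> \<in> u'" "\<beta> \<in> carrier G" "u' = \<beta> <# ?M h" using lcosE[OF M, of u'] u by blast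
        note p = props[OF u(1) \<alpha>(1)] props[OF u(2) \<beta>(1)]
        have "inv (inv a \<otimes> \<alpha>) \<otimes> (inv a \<otimes> \<beta>) \<in> L" using p by blast
        then have 1: "inv \<alpha> \<otimes> \<beta> \<in> L" using \<alpha>(2) \<beta>(2) a by (simp add: group_normalize)
        have "(inv (\<alpha> \<otimes> h) \<otimes> b) \<otimes> inv (inv (\<beta> \<otimes> h) \<otimes> b) \<in> K" using p by blast
        then have "inv h \<otimes> (inv \<alpha> \<otimes> \<beta>) \<otimes> h \<in> K" using \<alpha>(2) \<beta>(2) b hc by (simp add: group_normalize)
        then have "inv \<alpha> \<otimes> \<beta> \<in> conj_subgroup G h K" using \<alpha>(2) \<beta>(2) hc by (simp add: mem_conj_subgroup K.subset)
        with 1 show ?thesis using \<alpha> \<beta> l_coset_eq_iff[OF M] by simp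
      qed
      have ex: "?U \<noteq> {} \<longleftrightarrow> ?c \<in> (L #> h) <#> K"
      proof
        assume "?U \<noteq> {}"
        then obtain u where u: "u \<in> ?U" by blast
        then obtain \<alpha> where \<alpha>: "\<alpha> \<in> u" "\<alpha> \<in> carrier G" using lcosE[OF M, of u] by blast
        have "?c = (inv a \<otimes> \<alpha>) \<otimes> h \<otimes> (inv (\<alpha> \<otimes> h) \<otimes> b)"
          using \<alpha>(2) a b hc by (simp add: group_normalize)
        then show "?c \<in> (L #> h) <#> K"
          using props[OF u \<alpha>(1)] unfolding mem_double_coset[OF assms(3,2) hc] by blast
      next
        assume "?c \<in> (L #> h) <#> K"
        then obtain l k where lk: "l \<in> L" "k \<in> K" and ceq: "?c = l \<otimes> h \<otimes> k"
          using mem_double_coset[OF assms(3,2) hc] by blast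
        have lkc: "l \<in> carrier G" "k \<in> carrier G" using lk L.subset K.subset by auto
        \<comment> \<open>With c = lhk one has b = (al)hk. Hence \<alpha> = al satisfies x =
          \<alpha> L and y = (\<alpha> h)K, and its coset modulo the intersection lies over
          both.\<close>
        define \<alpha> where "\<alpha> = a \<otimes> l"
        have \<alpha>: "\<alpha> \<in> carrier G" using a lkc by (simp add: \<alpha>_def)
        have "b = a \<otimes> ?c" using a b by (simp add: group_normalize)
        then have beq: "b = \<alpha> \<otimes> h \<otimes> k" unfolding ceq \<alpha>_def using a lkc hc by (simp add: m_assoc)
        have xa: "x = \<alpha> <# L" using a lkc lk \<alpha> by (simp add: l_coset_eq_iff[OF assms(3)] \<alpha>_def group_normalize)
        have yb: "y = (\<alpha> \<otimes> h) <# K"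
          unfolding b(3) using b(2) lkc lk \<alpha> hc l_coset_eq_iff[OF assms(2), of "\<alpha> \<otimes> h" b]
          by (simp add: beq group_normalize)
        have Pa: "P \<subseteq> conj_subgroup G \<alpha> L" using x l_coset_fixed[OF Pc assms(3) \<alpha>] xa by simp
        have "P \<subseteq> conj_subgroup G (\<alpha> \<otimes> h) K"
          using y l_coset_fixed[OF Pc assms(2), of "\<alpha> \<otimes> h"] yb \<alpha> hc by simp
        then have "P \<subseteq> conj_subgroup G \<alpha> (?M h)"
          using Pa \<alpha> hc by (simp add: conj_subgroup_Int conj_subgroup_conj conj_subgroup_closed L.subset K.subset)
        then have "\<alpha> <# ?M h \<in> fixed_cosets P" using l_coset_fixed[OF Pc M \<alpha>] by simp
        moreover have "\<alpha> <# ?M h \<subseteq> x" unfolding xa by (auto simp: l_coset_def)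
        moreover have "(\<alpha> <# ?M h) #> h \<subseteq> y"
        proof -
          have "(\<alpha> <# ?M h) #> h = (\<alpha> \<otimes> h) <# (conj_subgroup G (inv h) L \<inter> K)"
            using \<alpha> hc M by (simp add: l_coset_r_coset subgroup.subset mackey_Int K.subset L.subset)
          then show ?thesis unfolding yb by (auto simp: l_coset_def)
        qed
        ultimately show "?U \<noteq> {}" using True l_coset_in_lcos[OF \<alpha>, of "?M h"] by blast
      qed
      have "card ?U = of_bool (?c \<in> (L #> h) <#> K)"
      proof (cases "?U = {}")
        case True
        then have "?c \<notin> (L #> h) <#> K" using ex by blast
        then show ?thesis unfolding True by (simp only: card.empty of_bool_eq)
      next
        case False
        then obtain u where "u \<in> ?U" by blast
        then have "?U = {u}" using uniq by blast
        then have "card ?U = card {u}" by (rule arg_cong)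
        then have "card ?U = 1" by simp
        moreover have "?c \<in> (L #> h) <#> K" using ex False by blast
        ultimately show ?thesis by (simp only: of_bool_eq)
      qed
      then show ?thesis using wcount_std[OF idx P y] by simp
    qed
    have "(\<Sum>h\<in>D. wcount P (std_word L (?M h) h K) x y) = (\<Sum>h\<in>D. of_bool (?c \<in> (L #> h) <#> K))"
      using count by (intro sum.cong) auto
    also have "\<dots> = of_bool (\<exists>h\<in>D. ?c \<in> (L #> h) <#> K)"
    proof (rule sum_of_bool_unique[OF finD])
      fix h h' assume h: "h \<in> D" "h' \<in> D" "?c \<in> (L #> h) <#> K" "?c \<in> (L #> h') <#> K"
      then obtain l k where "l \<in> L" "k \<in> K" "?c = l \<otimes> h \<otimes> k"
        using iffD1[OF mem_double_coset[OF assms(3,2) Dc[OF h(1)]] h(3)] by blast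
      moreover from calculation have "l \<in> H" "h \<in> H" "k \<in> H" using assms(4,5) h(1) DH by auto
      ultimately have "?c \<in> H" by (simp only: H.m_closed)
      then show "h = h'" using Dex h by blast
    qed
    also have "(\<exists>h\<in>D. ?c \<in> (L #> h) <#> K) \<longleftrightarrow> ?c \<in> H"
    proof
      assume "\<exists>h\<in>D. ?c \<in> (L #> h) <#> K"
      then obtain h where h: "h \<in> D" "?c \<in> (L #> h) <#> K" by blast
      then obtain l k where "l \<in> L" "k \<in> K" "?c = l \<otimes> h \<otimes> k"
        using iffD1[OF mem_double_coset[OF assms(3,2) Dc[OF h(1)]] h(2)] by blast
      moreover from calculation have "l \<in> H" "h \<in> H" "k \<in> H" using assms(4,5) h(1) DH by auto
      ultimately show "?c \<in> H" by (simp only: H.m_closed)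
    qed (use Dex in blast)
    also have "?c \<in> H \<longleftrightarrow> (\<exists>z\<in>fixed_cosets P. z \<in> lcos H \<and> x \<subseteq> z \<and> y \<subseteq> z)"
    proof
      assume "?c \<in> H"
      then have "y \<subseteq> a <# H" unfolding b(3) using a b by (simp add: l_coset_subset_iff[OF assms(2,1,4)])
      moreover have "x \<subseteq> a <# H" unfolding a(3) using assms(5) by (auto simp: l_coset_def)
      moreover have "a <# H \<in> fixed_cosets P"
        using l_coset_fixed[OF Pc assms(1) a(2)] Pa conj_subgroup_mono[OF assms(5) H.subset a(2)] by blast
      ultimately show "\<exists>z\<in>fixed_cosets P. z \<in> lcos H \<and> x \<subseteq> z \<and> y \<subseteq> z"
        using l_coset_in_lcos[OF a(2)] by blast
    next
      assume "\<exists>z\<in>fixed_cosets P. z \<in> lcos H \<and> x \<subseteq> z \<and> y \<subseteq> z"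
      then obtain z where z: "z \<in> lcos H" "a \<in> z" "b \<in> z" using a(1) b(1) by blast
      then have "a <# H = b <# H" using lcos_repr(2)[OF assms(1)] by blast
      then show "?c \<in> H" using l_coset_eq_iff[OF assms(1)] a b by simp
    qed
    finally show ?thesis unfolding lhs rhs using True by simp
  qed
qed

end

section \<open>Invariance of the matrix entries under left translation\<close>

lemma l_coset_image_cancel:
  assumes "x \<subseteq> carrier G" "g \<in> carrier G"
  shows "inv g <# (g <# x) = x" "g <# (inv g <# x) = x"
  using assms by (simp_all add: lcos_m_assoc lcos_mult_one)

lemma l_coset_mono: "x \<subseteq> y \<Longrightarrow> g <# x \<subseteq> g <# y"
  by (auto simp: l_coset_def)

lemma l_coset_subset_cancel:
  assumes "x \<subseteq> carrier G" "y \<subseteq> carrier G" "g \<in> carrier G"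
  shows "g <# x \<subseteq> g <# y \<longleftrightarrow> x \<subseteq> y"
proof
  assume "g <# x \<subseteq> g <# y"
  then have "inv g <# (g <# x) \<subseteq> inv g <# (g <# y)" by (rule l_coset_mono)
  then show "x \<subseteq> y" using assms by (simp add: l_coset_image_cancel)
qed (rule l_coset_mono)

lemma l_coset_inj:
  assumes "x \<subseteq> carrier G" "y \<subseteq> carrier G" "g \<in> carrier G"
  shows "g <# x = g <# y \<longleftrightarrow> x = y"
proof
  assume "g <# x = g <# y"
  then have "inv g <# (g <# x) = inv g <# (g <# y)" by (rule arg_cong)
  then show "x = y" unfolding l_coset_image_cancel(1)[OF assms(1,3)] l_coset_image_cancel(1)[OF assms(2,3)] .
qed (rule arg_cong)

lemma l_coset_lcos_iff:
  assumes "subgroup H G" "x \<subseteq> carrier G" "g \<in> carrier G"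
  shows "g <# x \<in> lcos H \<longleftrightarrow> x \<in> lcos H"
proof -
  have *: "g <# x \<in> lcos H" if x: "x \<in> lcos H" and g: "g \<in> carrier G" for x g
  proof -
    obtain a where "a \<in> carrier G" "x = a <# H" using x by (auto simp: lcos_def)
    then show ?thesis using g assms(1) by (simp add: lcos_m_assoc subgroup.subset l_coset_in_lcos)
  qed
  show ?thesis using *[of x g] *[of "g <# x" "inv g"] assms by (auto simp: l_coset_image_cancel)
qed

lemma fixed_l_coset:
  assumes "P \<subseteq> carrier G" "x \<in> fixed_cosets P" "g \<in> carrier G"
  shows "g <# x \<in> fixed_cosets (conj_subgroup G g P)"
proof -
  obtain H where H: "subgroup H G" "x \<in> lcos H" "fixes_set P x" using assms by (auto simp: fixed_cosets_def)
  obtain a where a: "a \<in> carrier G" "x = a <# H" using H(2) by (auto simp: lcos_def)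
  have "P \<subseteq> conj_subgroup G a H" using H(3) fixes_l_coset_iff[OF assms(1) H(1) a(1)] a(2) by simp
  then have "conj_subgroup G g P \<subseteq> conj_subgroup G (g \<otimes> a) H"
    using conj_subgroup_mono[of P "conj_subgroup G a H" g] conj_subgroup_closed[of H a] a(1) assms H(1)
    by (simp add: conj_subgroup_conj subgroup.subset)
  moreover have "g <# x = (g \<otimes> a) <# H" using a assms H(1) by (simp add: lcos_m_assoc subgroup.subset)
  ultimately show ?thesis
    using l_coset_fixed[OF conj_subgroup_closed[OF assms(1,3)] H(1), of "g \<otimes> a"] a(1) assms(3) by simp
qed

lemma bij_betw_fixed_cosets:
  assumes "P \<subseteq> carrier G" "g \<in> carrier G"
  shows "bij_betw (\<lambda>x. g <# x) (fixed_cosets P) (fixed_cosets (conj_subgroup G g P))"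
proof (rule bij_betwI[where g = "\<lambda>x. inv g <# x"])
  show "(\<lambda>x. g <# x) \<in> fixed_cosets P \<rightarrow> fixed_cosets (conj_subgroup G g P)"
    using fixed_l_coset[OF assms(1) _ assms(2)] by auto
  show "(\<lambda>x. inv g <# x) \<in> fixed_cosets (conj_subgroup G g P) \<rightarrow> fixed_cosets P"
    using fixed_l_coset[OF conj_subgroup_closed[OF assms] _ inv_closed[OF assms(2)]] assms
    by (auto simp: conj_subgroup_cancel)
qed (use assms fixed_cosets_subset in \<open>auto simp: l_coset_image_cancel\<close>)

lemma grel_l_coset:
  assumes "a \<in> mackey_gens G" "x \<subseteq> carrier G" "y \<subseteq> carrier G" "g \<in> carrier G"
  shows "grel a (g <# x) (g <# y) \<longleftrightarrow> grel a x y"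
proof (cases a)
  case (Conj h H)
  then have h: "h \<in> carrier G" "subgroup H G" using assms(1) by simp_all
  have "(g <# y) #> inv h = g <# (y #> inv h)" using h assms by (simp add: coset_assoc)
  then show ?thesis using Conj h assms r_coset_subset_G[OF assms(3) inv_closed[OF h(1)]]
    by (simp add: l_coset_lcos_iff l_coset_inj)
qed (use assms in \<open>simp_all add: l_coset_lcos_iff l_coset_subset_cancel\<close>)

text \<open>Left translation by \<open>g\<close> maps the cosets fixed by \<open>P\<close>
  bijectively to those fixed by the conjugate of \<open>P\<close>, and it commutes with inclusion
  and with right translation. Paths are therefore carried to paths.\<close>

lemma wcount_l_coset:
  assumes "w \<in> lists (mackey_gens G)" "P \<subseteq> carrier G" "g \<in> carrier G" "x \<subseteq> carrier G" "y \<subseteq> carrier G"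
  shows "wcount (conj_subgroup G g P) w (g <# x) (g <# y) = wcount P w x y"
  using assms(1,4)
proof (induction w arbitrary: x)
  case Nil
  then show ?case using assms by (simp add: l_coset_inj)
next
  case (Cons a w)
  have "wcount (conj_subgroup G g P) (a # w) (g <# x) (g <# y)
      = (\<Sum>z\<in>fixed_cosets P. of_bool (grel a (g <# x) (g <# z)) * wcount (conj_subgroup G g P) w (g <# z) (g <# y))"
    unfolding wcount.simps by (rule sum.reindex_bij_betw[OF bij_betw_fixed_cosets[OF assms(2,3)], symmetric])
  also have "\<dots> = (\<Sum>z\<in>fixed_cosets P. of_bool (grel a x z) * wcount P w z y)"
    using Cons fixed_cosets_subset assms(3) by (intro sum.cong) (auto simp: grel_l_coset)
  finally show ?case by simp
qed

section \<open>Traces of words and their pairing with dual standard words\<close>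

definition wtrace :: "'a mackey_gen list \<Rightarrow> nat" where
  "wtrace w = (\<Sum>P\<in>{P. subgroup P G}. \<Sum>x\<in>fixed_cosets P. wcount P w x x)"

context
  assumes fin: "finite (carrier G)"
begin

lemma wtrace_append:
  "wtrace (u @ v) = (\<Sum>P\<in>{P. subgroup P G}. \<Sum>x\<in>fixed_cosets P. \<Sum>y\<in>fixed_cosets P.
     wcount P u x y * wcount P v y x)"
  unfolding wtrace_def by (intro sum.cong refl) (simp add: wcount_append[OF fin])

lemma wtrace_commute: "wtrace (u @ v) = wtrace (v @ u)"
proof -
  have "(\<Sum>x\<in>fixed_cosets P. \<Sum>y\<in>fixed_cosets P. wcount P u x y * wcount P v y x)
      = (\<Sum>x\<in>fixed_cosets P. \<Sum>y\<in>fixed_cosets P. wcount P v x y * wcount P u y x)" for P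
    by (subst sum.swap) (simp add: mult.commute)
  then show ?thesis by (simp add: wtrace_append)
qed

text \<open>For an equivariant matrix \<open>m\<close>, the trace of \<open>m\<close> times the matrix of the standard word with this
  index is the entry of \<open>m\<close> at \<open>(P, K, b H)\<close> times the index of \<open>P\<close> in \<open>G\<close>, up to entries at
  subgroups smaller than \<open>P\<close>.\<close>

lemma dual_index:
  assumes "subgroup K G" "subgroup H G" "subgroup P G" "b \<in> carrier G" "P \<subseteq> K" "P \<subseteq> conj_subgroup G b H"
  shows "(H, conj_subgroup G (inv b) P, inv b, K) \<in> std_index"
proof -
  have "conj_subgroup G (inv b) P \<subseteq> conj_subgroup G (inv b) (conj_subgroup G b H)"
    using assms by (intro conj_subgroup_mono conj_subgroup_closed subgroup.subset) auto
  then have "conj_subgroup G (inv b) P \<subseteq> H" using assms by (simp add: conj_subgroup_cancel subgroup.subset)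
  moreover have "conj_subgroup G (inv (inv b)) (conj_subgroup G (inv b) P) = P"
    using assms by (simp add: conj_subgroup_cancel subgroup.subset)
  ultimately show ?thesis using assms conj_subgroup_is_subgroup by (simp add: std_index_def)
qed

text \<open>Among subgroups of the order of \<open>P\<close>, only left translates of (P, K, bH)
  contribute; the translating element is ab^{-1} for an \<open>a\<close> obtained from
  triangularity. At such a translate an equivariant matrix has the same entry as at (P, K, bH)
  itself.\<close>

lemma wcount_dual_nonzeroD:
  assumes "subgroup K G" "subgroup H G" "subgroup P G" "b \<in> carrier G" "P \<subseteq> K" "P \<subseteq> conj_subgroup G b H"
    and "subgroup P' G" "x \<in> fixed_cosets P'"
    and "wcount P' (std_word H (conj_subgroup G (inv b) P) (inv b) K) y x \<noteq> 0"
  shows "card P' \<le> card P"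
    and "card P' = card P \<Longrightarrow>
      \<exists>c\<in>carrier G. P' = conj_subgroup G c P \<and> x = c <# K \<and> y = c <# (b <# H)"
proof -
  obtain a where a: "a \<in> carrier G" "y = a <# H" "x = (a \<otimes> inv b) <# K" "a \<in> y" "a \<otimes> inv b \<in> x"
      "P' \<subseteq> conj_subgroup G a (conj_subgroup G (inv b) P)"
    and le: "card P' \<le> card (conj_subgroup G (inv b) P)"
    and eq: "card P' = card (conj_subgroup G (inv b) P) \<longrightarrow> P' = conj_subgroup G a (conj_subgroup G (inv b) P)"
    by (rule wcount_std_nonzeroD[OF fin dual_index[OF assms(1-6)] assms(7,8,9)])
  have c: "card (conj_subgroup G (inv b) P) = card P"
    using assms by (simp add: card_conj_subgroup subgroup.subset)
  show "card P' \<le> card P" using le c by simp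
  assume "card P' = card P"
  then have "P' = conj_subgroup G (a \<otimes> inv b) P"
    using eq c a(1) assms by (simp add: conj_subgroup_conj subgroup.subset)
  moreover have "y = (a \<otimes> inv b) <# (b <# H)"
    using a assms by (simp add: lcos_m_assoc subgroup.subset m_assoc)
  ultimately show "\<exists>c\<in>carrier G. P' = conj_subgroup G c P \<and> x = c <# K \<and> y = c <# (b <# H)"
    using a(1,3) assms(4) by blast
qed

text \<open>After multiplication by \<open>card P\<close> the sum counts quadruples (P', x, y, a),
  and \<open>a\<close> determines the rest: P' = ab^{-1}P(ab^{-1})^{-1}, x = ab^{-1}K, y = aH. Every
  element of G occurs as \<open>a\<close>. Because the trace runs over all subgroups and not over
  classes of conjugate ones, the result is exactly the index of \<open>P\<close>.\<close>

lemma sum_wcount_dual: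
  assumes "subgroup K G" "subgroup H G" "subgroup P G" "b \<in> carrier G" "P \<subseteq> K" "P \<subseteq> conj_subgroup G b H"
  shows "card P * (\<Sum>P'\<in>{P'. subgroup P' G \<and> card P' = card P}. \<Sum>x\<in>fixed_cosets P'. \<Sum>y\<in>fixed_cosets P'.
      wcount P' (std_word H (conj_subgroup G (inv b) P) (inv b) K) y x) = order G"
proof -
  let ?M = "conj_subgroup G (inv b) P"
  let ?S = "{P'. subgroup P' G \<and> card P' = card P}"
  let ?A = "\<lambda>P' x y. {a \<in> carrier G. y \<in> lcos H \<and> x \<in> lcos K \<and> a \<in> y \<and> a \<otimes> inv b \<in> x \<and> P' \<subseteq> conj_subgroup G a ?M}"
  note idx = dual_index[OF assms]
  note I = std_indexD[OF idx]
  have cM: "card ?M = card P" using assms by (simp add: card_conj_subgroup subgroup.subset)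
  have "card P * (\<Sum>P'\<in>?S. \<Sum>x\<in>fixed_cosets P'. \<Sum>y\<in>fixed_cosets P'. wcount P' (std_word H ?M (inv b) K) y x)
      = (\<Sum>P'\<in>?S. \<Sum>x\<in>fixed_cosets P'. \<Sum>y\<in>fixed_cosets P'. card (?A P' x y))"
    unfolding sum_distrib_left
    using card_wcount_std[OF fin idx] cM by (intro sum.cong refl) auto
  also have "\<dots> = card (SIGMA P':?S. SIGMA x:fixed_cosets P'. SIGMA y:fixed_cosets P'. ?A P' x y)"
    using finite_fixed_cosets[OF fin] finite_subgroups[OF fin] fin by simp
  also have "\<dots> = card (carrier G)"
  proof (rule bij_betw_same_card)
    let ?f = "\<lambda>a. (conj_subgroup G a ?M, (a \<otimes> inv b) <# K, a <# H, a)"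
    show "bij_betw (\<lambda>(P', x, y, a). a) (SIGMA P':?S. SIGMA x:fixed_cosets P'. SIGMA y:fixed_cosets P'. ?A P' x y) (carrier G)"
    proof (rule bij_betwI[where g = ?f])
      show "?f \<in> carrier G \<rightarrow> (SIGMA P':?S. SIGMA x:fixed_cosets P'. SIGMA y:fixed_cosets P'. ?A P' x y)"
      proof
        fix a assume a: "a \<in> carrier G"
        have sg: "subgroup (conj_subgroup G a ?M) G" using conj_subgroup_is_subgroup[OF I(2) a] .
        have 1: "card (conj_subgroup G a ?M) = card P"
          using a cM I(2) by (simp add: card_conj_subgroup subgroup.subset)
        have 2: "a <# H \<in> fixed_cosets (conj_subgroup G a ?M)"
          using l_coset_fixed[OF subgroup.subset[OF sg] I(1) a] conj_subgroup_mono[OF I(5) subgroup.subset[OF I(1)] a] by simp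
        have 3: "(a \<otimes> inv b) <# K \<in> fixed_cosets (conj_subgroup G a ?M)"
        proof -
          have "conj_subgroup G a ?M = conj_subgroup G (a \<otimes> inv b) P"
            using a assms by (simp add: conj_subgroup_conj subgroup.subset)
          then show ?thesis
            using l_coset_fixed[OF subgroup.subset[OF sg] assms(1), of "a \<otimes> inv b"]
              conj_subgroup_mono[OF assms(5) subgroup.subset[OF assms(1)], of "a \<otimes> inv b"] a assms(4) by simp
        qed
        show "?f a \<in> (SIGMA P':?S. SIGMA x:fixed_cosets P'. SIGMA y:fixed_cosets P'. ?A P' x y)"
          using a assms sg 1 2 3 l_coset_self[OF assms(2) a] l_coset_self[OF assms(1), of "a \<otimes> inv b"]
          by (auto intro: l_coset_in_lcos)
      qed
    next
      fix q assume "q \<in> (SIGMA P':?S. SIGMA x:fixed_cosets P'. SIGMA y:fixed_cosets P'. ?A P' x y)"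
      then obtain P' x y a where q: "q = (P', x, y, a)" and P': "subgroup P' G" "card P' = card P"
        and a: "a \<in> carrier G" "y \<in> lcos H" "x \<in> lcos K" "a \<in> y" "a \<otimes> inv b \<in> x" "P' \<subseteq> conj_subgroup G a ?M"
        by blast
      have "finite (conj_subgroup G a ?M)" using finite_subgroup[OF fin conj_subgroup_is_subgroup[OF I(2) a(1)]] .
      moreover have "card (conj_subgroup G a ?M) = card P'"
        using a cM I(2) P'(2) by (simp add: card_conj_subgroup subgroup.subset)
      ultimately have "P' = conj_subgroup G a ?M" using a(6) by (intro card_subset_eq) auto
      then show "?f (case q of (P', x, y, a) \<Rightarrow> a) = q"
        using q lcos_repr(2)[OF assms(2) a(2,4)] lcos_repr(2)[OF assms(1) a(3,5)] by simp
    qed auto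
  qed
  finally show ?thesis by (simp add: order_def)
qed

section \<open>Triangularity among standard words\<close>

lemma std_fixed:
  assumes "(K, L, g, H) \<in> std_index"
  shows "K \<in> fixed_cosets L" "g <# H \<in> fixed_cosets L"
proof -
  note I = std_indexD[OF assms]
  have "\<one> <# K \<in> fixed_cosets L"
    using l_coset_fixed[OF subgroup.subset[OF I(2)] I(1) one_closed] I(1,5)
    by (simp add: conj_subgroup_one subgroup.subset)
  then show "K \<in> fixed_cosets L" using I(1) by (simp add: coset_join3 subgroup.one_closed)
  have "L \<subseteq> conj_subgroup G g H"
    using conj_subgroup_mono[OF I(6) subgroup.subset[OF I(3)] I(4)] I
    by (simp add: conj_subgroup_cancel subgroup.subset)
  then show "g <# H \<in> fixed_cosets L" using l_coset_fixed[OF subgroup.subset[OF I(2)] I(3,4)] by simp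
qed

text \<open>The position (L, K, gH) is the image of the base point of G/L under the two legs of the
  span of the index (K, L, g, H). A nonzero entry there yields \<open>a\<close> in
  \<open>K0\<close>, and b = (a g0)^{-1}g lies in \<open>H0\<close>; equality of orders makes
  \<open>L\<close> the conjugate of \<open>L0\<close> by \<open>a\<close>. The two indices then
  describe the same standard element.\<close>

lemma wcount_std_std_nonzeroD:
  assumes q0: "(K0, L0, g0, H0) \<in> std_index" and q: "(K, L, g, H) \<in> std_index"
    and "wcount L (std_word K0 L0 g0 H0) K (g <# H) \<noteq> 0"
  shows "card L \<le> card L0"
    and "card L = card L0 \<Longrightarrow>
      K = K0 \<and> H = H0 \<and> (\<exists>a\<in>K0. \<exists>b\<in>H0. L = conj_subgroup G a L0 \<and> g = a \<otimes> g0 \<otimes> b)"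
proof -
  note I0 = std_indexD[OF q0] and I = std_indexD[OF q]
  obtain a where a: "a \<in> carrier G" "K = a <# K0" "g <# H = (a \<otimes> g0) <# H0" "a \<in> K" "a \<otimes> g0 \<in> g <# H"
      "L \<subseteq> conj_subgroup G a L0"
    and le: "card L \<le> card L0" and eq: "card L = card L0 \<longrightarrow> L = conj_subgroup G a L0"
    by (rule wcount_std_nonzeroD[OF fin q0 I(2) std_fixed(2)[OF q] assms(3)])
  show "card L \<le> card L0" by (rule le)
  have K: "K = K0"
    using lcos_unique[OF I(1) I0(1) subgroup_in_lcos[OF I(1)]] a(1,2) l_coset_in_lcos by simp
  have H: "H = H0"
    using lcos_unique[OF I(3) I0(3) l_coset_in_lcos[OF I(4)]] a(1,3) l_coset_in_lcos[of "a \<otimes> g0" H0] I0(4) by simp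
  have b: "inv (a \<otimes> g0) \<otimes> g \<in> H0"
    using a(1,3) I(4) I0 l_coset_eq_iff[OF I0(3), of "a \<otimes> g0" g] H by simp
  have "g = a \<otimes> g0 \<otimes> (inv (a \<otimes> g0) \<otimes> g)" using a(1) I(4) I0(4) by (simp add: group_normalize)
  moreover assume "card L = card L0"
  ultimately show "K = K0 \<and> H = H0 \<and> (\<exists>a\<in>K0. \<exists>b\<in>H0. L = conj_subgroup G a L0 \<and> g = a \<otimes> g0 \<otimes> b)"
    using K H a(4) b eq by (metis (no_types, lifting))
qed

lemma finite_std_index: "finite std_index"
proof (rule finite_subset)
  show "std_index \<subseteq> {H. subgroup H G} \<times> {H. subgroup H G} \<times> carrier G \<times> {H. subgroup H G}"
    by (auto simp: std_index_def)
qed (use finite_subgroups[OF fin] fin in simp)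

text \<open>After multiplication by \<open>card L0\<close> the sum counts pairs of an index and an
  element \<open>a\<close>. These correspond to pairs (a, b) in \<open>K0 \<times> H0\<close>, the
  index being (K0, a L0 a^{-1}, a g0 b, H0). This count is the origin of the constant in
  \<open>top_coeff\<close>.\<close>

lemma sum_wcount_std_std:
  assumes q0: "(K0, L0, g0, H0) \<in> std_index"
  shows "card L0 * (\<Sum>(K, L, g, H)\<in>{q \<in> std_index. card (fst (snd q)) = card L0}.
      wcount L (std_word K0 L0 g0 H0) K (g <# H)) = card K0 * card H0"
proof -
  note I0 = std_indexD[OF q0]
  let ?Q = "{q \<in> std_index. card (fst (snd q)) = card L0}"
  let ?A = "\<lambda>(K, L, g, H). {a \<in> carrier G. K \<in> lcos K0 \<and> g <# H \<in> lcos H0 \<and> a \<in> K \<and> a \<otimes> g0 \<in> g <# H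
    \<and> L \<subseteq> conj_subgroup G a L0}"
  have "card L0 * (\<Sum>(K, L, g, H)\<in>?Q. wcount L (std_word K0 L0 g0 H0) K (g <# H)) = (\<Sum>q\<in>?Q. card (?A q))"
    unfolding sum_distrib_left
  proof (intro sum.cong refl)
    fix q assume "q \<in> ?Q"
    then obtain K L g H where q: "q = (K, L, g, H)" "(K, L, g, H) \<in> std_index" by (cases q) auto
    then show "card L0 * (case q of (K, L, g, H) \<Rightarrow> wcount L (std_word K0 L0 g0 H0) K (g <# H)) = card (?A q)"
      using card_wcount_std[OF fin q0 std_indexD(2)[OF q(2)] std_fixed(2)[OF q(2)]] by simp
  qed
  also have "\<dots> = card (SIGMA q:?Q. ?A q)"
    using finite_std_index fin by (subst card_SigmaI) auto
  also have "\<dots> = card (K0 \<times> H0)"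
  proof -
    define f :: "('a set \<times> 'a set \<times> 'a \<times> 'a set) \<times> 'a \<Rightarrow> 'a \<times> 'a"
      where "f = (\<lambda>((K, L, g, H), a). (a, inv (a \<otimes> g0) \<otimes> g))"
    define f' where "f' = (\<lambda>(a, b). ((K0, conj_subgroup G a L0, a \<otimes> g0 \<otimes> b, H0), a))"
    have dec: "\<exists>a b. a \<in> K0 \<and> b \<in> H0 \<and> p = ((K0, conj_subgroup G a L0, a \<otimes> g0 \<otimes> b, H0), a) \<and> b = inv (a \<otimes> g0) \<otimes> (a \<otimes> g0 \<otimes> b)"
      if "p \<in> (SIGMA q:?Q. ?A q)" for p
    proof -
      from that obtain K L g H a where p: "p = ((K, L, g, H), a)" and q: "(K, L, g, H) \<in> std_index" "card L = card L0"
        and a: "a \<in> carrier G" "K \<in> lcos K0" "g <# H \<in> lcos H0" "a \<in> K" "a \<otimes> g0 \<in> g <# H" "L \<subseteq> conj_subgroup G a L0"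
        by auto
      note I = std_indexD[OF q(1)]
      have K: "K = K0" using lcos_unique[OF I(1) I0(1) subgroup_in_lcos[OF I(1)] a(2)] .
      have H: "H = H0" using lcos_unique[OF I(3) I0(3) l_coset_in_lcos[OF I(4)] a(3)] .
      have ag: "a \<otimes> g0 \<in> carrier G" using a(1) I0(4) by simp
      have "finite (conj_subgroup G a L0)" using finite_subgroup[OF fin conj_subgroup_is_subgroup[OF I0(2) a(1)]] .
      then have L: "L = conj_subgroup G a L0"
        using a(1,6) q(2) I0(2) by (intro card_subset_eq) (auto simp: card_conj_subgroup subgroup.subset)
      have "g <# H0 = (a \<otimes> g0) <# H0" using lcos_repr(2)[OF I0(3) a(3,5)] H by simp
      then have b: "inv (a \<otimes> g0) \<otimes> g \<in> H0" using l_coset_eq_iff[OF I0(3) ag I(4)] by simp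
      have g: "g = a \<otimes> g0 \<otimes> (inv (a \<otimes> g0) \<otimes> g)" using ag I(4) by (simp add: inv_cancel_left)
      show ?thesis using p K H L a(4) b g by metis
    qed
    have enc: "((K0, conj_subgroup G a L0, a \<otimes> g0 \<otimes> b, H0), a) \<in> (SIGMA q:?Q. ?A q)"
      if ab: "a \<in> K0" "b \<in> H0" for a b
    proof -
      interpret K: subgroup K0 G by (rule I0(1))
      interpret H: subgroup H0 G by (rule I0(3))
      have c: "a \<in> carrier G" "b \<in> carrier G" using ab by auto
      have L: "subgroup (conj_subgroup G a L0) G" using conj_subgroup_is_subgroup[OF I0(2) c(1)] .
      have 1: "conj_subgroup G a L0 \<subseteq> K0"
        using conj_subgroup_mono[OF I0(5) K.subset c(1)] conj_subgroup_self[OF I0(1) ab(1)] by simp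
      have "conj_subgroup G (inv (a \<otimes> g0 \<otimes> b)) (conj_subgroup G a L0) = conj_subgroup G (inv b) (conj_subgroup G (inv g0) L0)"
        using c I0(2,4) by (simp add: conj_subgroup_conj subgroup.subset group_normalize)
      also have "\<dots> \<subseteq> conj_subgroup G (inv b) H0" using conj_subgroup_mono[OF I0(6) H.subset] c by simp
      also have "\<dots> = H0" using conj_subgroup_self[OF I0(3)] ab by simp
      finally have 2: "conj_subgroup G (inv (a \<otimes> g0 \<otimes> b)) (conj_subgroup G a L0) \<subseteq> H0" .
      have idx: "(K0, conj_subgroup G a L0, a \<otimes> g0 \<otimes> b, H0) \<in> std_index"
        using 1 2 L I0 c by (simp add: std_index_def)
      have eq: "(a \<otimes> g0 \<otimes> b) <# H0 = (a \<otimes> g0) <# H0"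
        using c I0(4) ab l_coset_eq_iff[OF I0(3), of "a \<otimes> g0" "a \<otimes> g0 \<otimes> b"] by (simp add: group_normalize)
      show ?thesis
        using idx c ab I0(4) card_conj_subgroup[OF subgroup.subset[OF I0(2)] c(1)] subgroup_in_lcos[OF I0(1)]
          l_coset_in_lcos[of "a \<otimes> g0" H0] l_coset_self[OF I0(3), of "a \<otimes> g0"] by (simp add: eq)
    qed
    have red: "inv (a \<otimes> g0) \<otimes> (a \<otimes> g0 \<otimes> b) = b" if "a \<in> K0" "b \<in> H0" for a b
      using that I0 subgroup.mem_carrier[OF I0(1)] subgroup.mem_carrier[OF I0(3)] by (simp add: inv_cancel_left)
    have "bij_betw f (SIGMA q:?Q. ?A q) (K0 \<times> H0)"
    proof (rule bij_betw_byWitness[of _ f' f])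
      show "\<forall>p\<in>(SIGMA q:?Q. ?A q). f' (f p) = p"
        by (rule ballI, drule dec) (auto simp: red f_def f'_def)
      show "\<forall>p\<in>K0 \<times> H0. f (f' p) = p" using red by (auto simp: f_def f'_def)
      show "image f (SIGMA q:?Q. ?A q) \<subseteq> K0 \<times> H0"
        by (rule image_subsetI, drule dec) (auto simp: red f_def)
      show "image f' (K0 \<times> H0) \<subseteq> (SIGMA q:?Q. ?A q)" using enc by (auto simp del: mem_Sigma_iff simp: f'_def)
    qed
    from bij_betw_same_card[OF this] show ?thesis .
  qed
  finally show ?thesis by (simp add: card_cartesian_product)
qed

end

end

section \<open>Linear extension of matrices on words\<close>

definition nat_emb :: "('r, 'm) ring_scheme \<Rightarrow> nat \<Rightarrow> 'r" where
  "nat_emb R n = [n] \<cdot>\<^bsub>R\<^esub> \<one>\<^bsub>R\<^esub>"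

context ring
begin

lemma nat_emb_closed [simp]: "nat_emb R n \<in> carrier R"
  by (simp add: nat_emb_def)

lemma nat_emb_0 [simp]: "nat_emb R 0 = \<zero>"
  by (simp add: nat_emb_def)

lemma nat_emb_add: "nat_emb R (m + n) = nat_emb R m \<oplus> nat_emb R n"
  by (simp add: nat_emb_def add.nat_pow_mult)

lemma nat_emb_mult: "nat_emb R (m * n) = nat_emb R m \<otimes> nat_emb R n"
  by (simp add: nat_emb_def add_pow_ldistr add.nat_pow_pow mult.commute)

lemma nat_emb_sum: "finite I \<Longrightarrow> nat_emb R (\<Sum>i\<in>I. h i) = (\<Oplus>i\<in>I. nat_emb R (h i))"
  by (induction I rule: finite_induct) (simp_all add: nat_emb_add)

text \<open>The image of \<open>n\<close> vanishes exactly if the additive order of the identity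
  divides \<open>n\<close>. Characteristic zero is included, as 0 divides only 0.\<close>

lemma nat_emb_eq_zero_iff: "nat_emb R n = \<zero> \<longleftrightarrow> ring_characteristic R dvd n"
  using add.pow_eq_id[of \<one> n] by (simp add: nat_emb_def ring_characteristic_def add_pow_def)

end

context cring
begin

lemma lin_ext_finsum:
  assumes "finite I" "\<And>i. i \<in> I \<Longrightarrow> h i \<in> carrier (free_module R X)" "\<phi> \<in> X \<rightarrow> carrier R"
  shows "lin_ext X \<phi> (\<Oplus>\<^bsub>free_module R X\<^esub>i\<in>I. h i) = (\<Oplus>i\<in>I. lin_ext X \<phi> (h i))"
  using assms(1,2)
proof (induction I rule: finite_induct)
  case empty
  interpret M: module R "free_module R X" by (rule free_module_is_module)
  have "lin_ext X \<phi> \<zero>\<^bsub>free_module R X\<^esub> = \<zero>"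
    using lin_ext_smult[OF M.M.zero_closed zero_closed assms(3)] M.M.zero_closed assms(3) by simp
  then show ?case by simp
next
  case (insert i I)
  interpret M: module R "free_module R X" by (rule free_module_is_module)
  show ?case using insert assms(3)
    by (simp add: lin_ext_add M.M.finsum_insert finsum_insert M.M.finsum_closed Pi_iff)
qed

lemma free_module_decomp:
  assumes f: "f \<in> carrier (free_module R X)"
  shows "f = (\<Oplus>\<^bsub>free_module R X\<^esub>w\<in>{w \<in> X. f w \<noteq> \<zero>}. f w \<odot>\<^bsub>free_module R X\<^esub> monomial R X w)"
proof -
  interpret M: module R "free_module R X" by (rule free_module_is_module)
  have fin: "finite {w \<in> X. f w \<noteq> \<zero>}" using f by (rule free_module_finite_support)
  have cl: "f w \<odot>\<^bsub>free_module R X\<^esub> monomial R X w \<in> carrier (free_module R X)" if "w \<in> X" for w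
    using free_module_closed[OF f that] by simp
  show ?thesis
  proof (rule free_module_eqI_lin_ext[OF f])
    show "(\<Oplus>\<^bsub>free_module R X\<^esub>w\<in>{w \<in> X. f w \<noteq> \<zero>}. f w \<odot>\<^bsub>free_module R X\<^esub> monomial R X w) \<in> carrier (free_module R X)"
      using cl by (intro M.M.finsum_closed) auto
    fix \<phi> assume \<phi>: "\<phi> \<in> X \<rightarrow> carrier R"
    have "lin_ext X \<phi> (\<Oplus>\<^bsub>free_module R X\<^esub>w\<in>{w \<in> X. f w \<noteq> \<zero>}. f w \<odot>\<^bsub>free_module R X\<^esub> monomial R X w)
        = (\<Oplus>w\<in>{w \<in> X. f w \<noteq> \<zero>}. lin_ext X \<phi> (f w \<odot>\<^bsub>free_module R X\<^esub> monomial R X w))"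
      using fin cl \<phi> by (intro lin_ext_finsum) auto
    also have "\<dots> = lin_ext X \<phi> f"
      unfolding lin_ext_def[of X \<phi> f] using free_module_closed[OF f] \<phi>
      by (intro finsum_cong') (auto simp: lin_ext_smult lin_ext_monomial Pi_iff)
    finally show "lin_ext X \<phi> f = lin_ext X \<phi> (\<Oplus>\<^bsub>free_module R X\<^esub>w\<in>{w \<in> X. f w \<noteq> \<zero>}. f w \<odot>\<^bsub>free_module R X\<^esub> monomial R X w)" ..
  qed
qed

section \<open>Matrix representations of the free algebra\<close>

context
  fixes X :: "'x set" and I :: "'i set" and m :: "'x list \<Rightarrow> 'i \<Rightarrow> 'i \<Rightarrow> 'a"
  assumes fin: "finite I"
    and m_carrier: "\<And>w x y. w \<in> lists X \<Longrightarrow> x \<in> I \<Longrightarrow> y \<in> I \<Longrightarrow> m w x y \<in> carrier R"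
    and m_append: "\<And>u v x y. u \<in> lists X \<Longrightarrow> v \<in> lists X \<Longrightarrow> x \<in> I \<Longrightarrow> y \<in> I \<Longrightarrow>
      m (u @ v) x y = (\<Oplus>z\<in>I. m u x z \<otimes> m v z y)"
begin

text \<open>Multiplicativity on words passes to linear combinations: \<open>lin_ext_mult\<close>
  makes the left hand side a double extension of the entries of concatenated words, and these expand
  as matrix products.\<close>

lemma lin_ext_matrix_mult:
  assumes f: "f \<in> carrier (free_algebra R X)" and g: "g \<in> carrier (free_algebra R X)"
    and x: "x \<in> I" and y: "y \<in> I"
  shows "lin_ext (lists X) (\<lambda>w. m w x y) (f \<otimes>\<^bsub>free_algebra R X\<^esub> g)
    = (\<Oplus>z\<in>I. lin_ext (lists X) (\<lambda>w. m w x z) f \<otimes> lin_ext (lists X) (\<lambda>w. m w z y) g)"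
proof -
  let ?L = "lists X"
  note f' = f[unfolded free_algebra_ops] and g' = g[unfolded free_algebra_ops]
  have mL: "(\<lambda>w. m w x y) \<in> ?L \<rightarrow> carrier R" if "x \<in> I" "y \<in> I" for x y
    using m_carrier that by blast
  note le = lin_ext_closed[OF g' mL] lin_ext_closed[OF f' mL]
  have inner: "lin_ext ?L (\<lambda>v. m (u @ v) x y) g = (\<Oplus>z\<in>I. m u x z \<otimes> lin_ext ?L (\<lambda>w. m w z y) g)"
    if u: "u \<in> ?L" for u
  proof -
    have "lin_ext ?L (\<lambda>v. m (u @ v) x y) g = lin_ext ?L (\<lambda>v. \<Oplus>z\<in>I. m u x z \<otimes> m v z y) g"
      using g' x y u m_append m_carrier by (intro lin_ext_cong) (blast intro!: funcsetI finsum_closed m_closed)+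
    also have "\<dots> = (\<Oplus>z\<in>I. lin_ext ?L (\<lambda>v. m u x z \<otimes> m v z y) g)"
      using x y u m_carrier by (intro lin_ext_fun_finsum[OF g' fin]) blast
    also have "\<dots> = (\<Oplus>z\<in>I. m u x z \<otimes> lin_ext ?L (\<lambda>w. m w z y) g)"
    proof (rule finsum_cong')
      show "(\<lambda>z. m u x z \<otimes> lin_ext ?L (\<lambda>w. m w z y) g) \<in> I \<rightarrow> carrier R"
        using m_carrier[OF u x] le(1)[OF _ y] by blast
      fix z assume z: "z \<in> I"
      show "lin_ext ?L (\<lambda>v. m u x z \<otimes> m v z y) g = m u x z \<otimes> lin_ext ?L (\<lambda>w. m w z y) g"
        by (rule lin_ext_fun_smult[OF g' mL[OF z y] m_carrier[OF u x z]])
    qed simp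
    finally show ?thesis .
  qed
  have "lin_ext ?L (\<lambda>w. m w x y) (f \<otimes>\<^bsub>free_algebra R X\<^esub> g)
      = lin_ext ?L (\<lambda>u. lin_ext ?L (\<lambda>v. m (u @ v) x y) g) f"
    by (rule lin_ext_mult[OF f g mL[OF x y]])
  also have "\<dots> = lin_ext ?L (\<lambda>u. \<Oplus>z\<in>I. lin_ext ?L (\<lambda>w. m w z y) g \<otimes> m u x z) f"
  proof (rule lin_ext_cong[OF _ _ f'])
    have cl: "lin_ext ?L (\<lambda>w. m w z y) g \<otimes> m u x z \<in> carrier R" if "z \<in> I" "u \<in> ?L" for z u
      using that m_carrier[OF that(2) x that(1)] le(1)[OF that(1) y] by blast
    then show "(\<lambda>u. \<Oplus>z\<in>I. lin_ext ?L (\<lambda>w. m w z y) g \<otimes> m u x z) \<in> ?L \<rightarrow> carrier R"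
      by (intro funcsetI finsum_closed) blast
    fix u assume u: "u \<in> ?L"
    show "lin_ext ?L (\<lambda>v. m (u @ v) x y) g = (\<Oplus>z\<in>I. lin_ext ?L (\<lambda>w. m w z y) g \<otimes> m u x z)"
      unfolding inner[OF u] using cl[OF _ u] m_carrier[OF u x] le(1)[OF _ y]
      by (intro finsum_cong') (auto simp: m_comm)
  qed
  also have "\<dots> = (\<Oplus>z\<in>I. lin_ext ?L (\<lambda>u. lin_ext ?L (\<lambda>w. m w z y) g \<otimes> m u x z) f)"
    using x y m_carrier le(1) by (intro lin_ext_fun_finsum[OF f' fin]) blast
  also have "\<dots> = (\<Oplus>z\<in>I. lin_ext ?L (\<lambda>w. m w x z) f \<otimes> lin_ext ?L (\<lambda>w. m w z y) g)"
  proof (rule finsum_cong')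
    show "(\<lambda>z. lin_ext ?L (\<lambda>w. m w x z) f \<otimes> lin_ext ?L (\<lambda>w. m w z y) g) \<in> I \<rightarrow> carrier R"
      using le x y by blast
    fix z assume z: "z \<in> I"
    have "lin_ext ?L (\<lambda>u. lin_ext ?L (\<lambda>w. m w z y) g \<otimes> m u x z) f
        = lin_ext ?L (\<lambda>w. m w z y) g \<otimes> lin_ext ?L (\<lambda>w. m w x z) f"
      by (rule lin_ext_fun_smult[OF f' mL[OF x z] le(1)[OF z y]])
    then show "lin_ext ?L (\<lambda>u. lin_ext ?L (\<lambda>w. m w z y) g \<otimes> m u x z) f
        = lin_ext ?L (\<lambda>w. m w x z) f \<otimes> lin_ext ?L (\<lambda>w. m w z y) g"
      using le(1)[OF z y] le(2)[OF x z] m_comm by simp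
  qed simp
  finally show ?thesis .
qed

text \<open>A product of matrices vanishes if one factor does. It follows that the entries vanish on
  a whole ideal of relations as soon as they vanish on its generators.\<close>

lemma matrix_kernel_ideal:
  "ideal {f \<in> carrier (free_algebra R X). \<forall>x\<in>I. \<forall>y\<in>I. lin_ext (lists X) (\<lambda>w. m w x y) f = \<zero>} (free_algebra R X)"
    (is "ideal ?N ?F")
proof -
  let ?L = "lists X"
  interpret F: unital_algebra R ?F by (rule free_algebra_unital)
  have mL: "(\<lambda>w. m w x y) \<in> ?L \<rightarrow> carrier R" if "x \<in> I" "y \<in> I" for x y
    using m_carrier that by blast
  note add = lin_ext_add[OF _ _ mL, folded free_algebra_ops] and smult = lin_ext_smult[OF _ _ mL, folded free_algebra_ops]
    and cl = lin_ext_closed[OF _ mL, folded free_algebra_ops]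
  show ?thesis
  proof (rule idealI)
    show "ring ?F" by (rule F.A.ring_axioms)
    show "subgroup ?N (add_monoid ?F)"
    proof (rule group.subgroupI[OF abelian_group.a_group[OF ring.is_abelian_group[OF F.A.ring_axioms]]])
      have "lin_ext ?L (\<lambda>w. m w x y) \<zero>\<^bsub>?F\<^esub> = \<zero>" if "x \<in> I" "y \<in> I" for x y
      proof -
        have "lin_ext ?L (\<lambda>w. m w x y) (\<zero> \<odot>\<^bsub>?F\<^esub> \<zero>\<^bsub>?F\<^esub>) = \<zero> \<otimes> lin_ext ?L (\<lambda>w. m w x y) \<zero>\<^bsub>?F\<^esub>"
          by (rule smult[OF F.M.zero_closed zero_closed that])
        then show ?thesis using cl[OF F.M.zero_closed that] by simp
      qed
      then have "\<zero>\<^bsub>?F\<^esub> \<in> ?N" by simp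
      then show "?N \<noteq> {}" by blast
    next
      fix f assume f: "f \<in> ?N"
      have "\<ominus>\<^bsub>?F\<^esub> f = (\<ominus> \<one>) \<odot>\<^bsub>?F\<^esub> f" using f by (simp add: F.smult_l_minus)
      moreover have "(\<ominus> \<one>) \<odot>\<^bsub>?F\<^esub> f \<in> ?N" using f smult[of f "\<ominus> \<one>"] by simp
      ultimately show "inv\<^bsub>add_monoid ?F\<^esub> f \<in> ?N" unfolding a_inv_def by simp
    qed (use add in auto)
    fix f g assume f: "f \<in> ?N" and g: "g \<in> carrier ?F"
    show "g \<otimes>\<^bsub>?F\<^esub> f \<in> ?N"
      using f g cl by (auto simp: lin_ext_matrix_mult intro!: finsum_eq_zeroI)
    show "f \<otimes>\<^bsub>?F\<^esub> g \<in> ?N"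
      using f g cl by (auto simp: lin_ext_matrix_mult intro!: finsum_eq_zeroI)
  qed
qed

end

end

section \<open>Standard elements span\<close>

context group
begin

text \<open>Double cosets that meet coincide, so choosing one element from each gives a system of
  representatives. The Mackey relation is available only relative to such a system, so one has to
  exist before a restriction of a transfer can be expanded.\<close>

lemma double_coset_reps_exists:
  assumes "subgroup H G" "subgroup K G" "subgroup L G" "K \<subseteq> H" "L \<subseteq> H"
  obtains D where "double_coset_reps G L H K D"
proof -
  interpret H: subgroup H G by fact
  interpret K: subgroup K G by fact
  interpret L: subgroup L G by fact
  let ?dc = "\<lambda>h. (L #> h) <#> K"
  have dc: "z \<in> ?dc h \<longleftrightarrow> (\<exists>l\<in>L. \<exists>k\<in>K. z = l \<otimes> h \<otimes> k)" for h z
    by (auto simp: set_mult_def r_coset_def)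
  have self: "h \<in> ?dc h" if "h \<in> carrier G" for h
    unfolding dc using that by (intro bexI[of _ \<one>]) auto
  have sub: "?dc h \<subseteq> H" if "h \<in> H" for h
  proof
    fix z assume "z \<in> ?dc h"
    then obtain l k where "l \<in> L" "k \<in> K" and z: "z = l \<otimes> h \<otimes> k" using dc by blast
    then have "l \<in> H" "k \<in> H" using assms by auto
    then show "z \<in> H" using z that by (simp only: H.m_closed)
  qed
  have eq: "?dc z = ?dc h" if h: "h \<in> carrier G" and z: "z \<in> ?dc h" for h z
  proof -
    obtain l k where lk: "l \<in> L" "k \<in> K" and zeq: "z = l \<otimes> h \<otimes> k" using z dc by blast
    have c: "l \<in> carrier G" "k \<in> carrier G" using lk by auto
    have heq: "h = inv l \<otimes> z \<otimes> inv k" using c h by (simp add: zeq group_normalize)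
    have zc: "z \<in> carrier G" using zeq c h by simp
    show ?thesis
    proof (intro equalityI subsetI)
      fix y assume "y \<in> ?dc z"
      then obtain l' k' where l': "l' \<in> L" "k' \<in> K" "y = l' \<otimes> z \<otimes> k'" using dc by blast
      then have "y = (l' \<otimes> l) \<otimes> h \<otimes> (k \<otimes> k')" using c h by (simp add: zeq m_assoc)
      moreover have "l' \<otimes> l \<in> L" "k \<otimes> k' \<in> K" using l' lk by auto
      ultimately show "y \<in> ?dc h" using dc by blast
    next
      fix y assume "y \<in> ?dc h"
      then obtain l' k' where l': "l' \<in> L" "k' \<in> K" "y = l' \<otimes> h \<otimes> k'" using dc by blast
      then have "y = (l' \<otimes> inv l) \<otimes> z \<otimes> (inv k \<otimes> k')" using c zc by (subst (asm) heq) (simp add: m_assoc)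
      moreover have "l' \<otimes> inv l \<in> L" "inv k \<otimes> k' \<in> K" using l' lk by auto
      ultimately show "y \<in> ?dc z" using dc by blast
    qed
  qed
  \<comment> \<open>The choice depends on the double coset as a set, so equal double cosets receive
    the same representative.\<close>
  define r where "r C = (SOME h. h \<in> C)" for C :: "'a set"
  have r: "r (?dc h) \<in> ?dc h" if "h \<in> carrier G" for h
    unfolding r_def using self[OF that] by (rule someI)
  have "double_coset_reps G L H K ((\<lambda>h. r (?dc h)) ` H)"
    unfolding double_coset_reps_def
  proof (intro conjI ballI)
    show "(\<lambda>h. r (?dc h)) ` H \<subseteq> H"
    proof (rule image_subsetI)
      fix h assume h: "h \<in> H"
      show "r (?dc h) \<in> H" by (rule subsetD[OF sub[OF h] r[OF H.mem_carrier[OF h]]])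
    qed
    fix x assume x: "x \<in> H"
    have xc: "x \<in> carrier G" by (rule H.mem_carrier[OF x])
    show "\<exists>!h. h \<in> (\<lambda>h. r (?dc h)) ` H \<and> x \<in> ?dc h"
    proof (rule ex1I[of _ "r (?dc x)"])
      have "x \<in> ?dc (r (?dc x))" unfolding eq[OF xc r[OF xc]] by (rule self[OF xc])
      then show "r (?dc x) \<in> (\<lambda>h. r (?dc h)) ` H \<and> x \<in> ?dc (r (?dc x))"
        by (rule conjI[OF imageI[OF x]])
    next
      fix h assume h: "h \<in> (\<lambda>h. r (?dc h)) ` H \<and> x \<in> ?dc h"
      then obtain y where y: "y \<in> H" "h = r (?dc y)"
        using h by (elim conjE imageE) (rule that)
      have yc: "y \<in> carrier G" by (rule H.mem_carrier[OF y(1)])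
      have "h \<in> ?dc y" unfolding y(2) by (rule r[OF yc])
      then have hc: "h \<in> carrier G" using sub[OF y(1)] by auto
      have "?dc h = ?dc y" unfolding y(2) by (rule eq[OF yc r[OF yc]])
      moreover have "?dc x = ?dc h" by (rule eq[OF hc conjunct2[OF h]])
      ultimately have "?dc x = ?dc y" by simp
      then show "h = r (?dc x)" using y(2) by simp
    qed
  qed
  then show thesis by (rule that)
qed

end

text \<open>The rewriting of words into standard form uses only that the relations hold. Carrying it
  out for an arbitrary interpretation \<open>e\<close> of the generators keeps the cosets of the
  quotient construction out of the computations.\<close>

locale mackey_algebra_rep = G: group G + unital_algebra R A
  for G :: "('g, 'm) monoid_scheme" and R :: "('r, 'n) ring_scheme" (structure)
    and A :: "('r, 'a, 'q) module_scheme" (structure) +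
  fixes e :: "'g mackey_gen \<Rightarrow> 'a"
  assumes finite_group: "finite (carrier G)"
    and e_closed: "x \<in> mackey_gens G \<Longrightarrow> e x \<in> carrier A"
    and relations: "(u, v) \<in> mackey_relations G A e \<Longrightarrow> u = v"
begin

abbreviation cj :: "'g \<Rightarrow> 'g set \<Rightarrow> 'g set" where "cj \<equiv> conj_subgroup G"

text \<open>\<open>rels(1)\<close> to \<open>rels(10)\<close> are the defining relations as
  equations, in the order of the introduction rules from \<open>unit\<close> to
  \<open>zero\<close>.\<close>

lemmas rels = mackey_relations.intros[where G = G and A = A and e = e, THEN relations]

definition std_elem :: "'g set \<times> 'g set \<times> 'g \<times> 'g set \<Rightarrow> 'a" where
  "std_elem = (\<lambda>(K, L, g, H). e (Tr K L) \<otimes>\<^bsub>A\<^esub> e (Conj g (cj (inv\<^bsub>G\<^esub> g) L)) \<otimes>\<^bsub>A\<^esub> e (Res H (cj (inv\<^bsub>G\<^esub> g) L)))"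

lemma std_gens_closed:
  assumes "(K, L, g, H) \<in> G.std_index"
  shows "e (Tr K L) \<in> carrier A" "e (Conj g (cj (inv\<^bsub>G\<^esub> g) L)) \<in> carrier A"
    "e (Res H (cj (inv\<^bsub>G\<^esub> g) L)) \<in> carrier A"
  using G.std_indexD[OF assms] by (auto intro!: e_closed)

lemma std_elem_closed: "q \<in> G.std_index \<Longrightarrow> std_elem q \<in> carrier A"
  using std_gens_closed by (cases q) (auto simp: std_elem_def)

text \<open>Conjugation by \<open>a\<close> commutes with the transfer, and on \<open>K\<close>
  itself it is the identity generator because \<open>a\<close> lies in \<open>K\<close>.\<close>

lemma tr_conj_self:
  assumes "subgroup K G" "subgroup L G" "L \<subseteq> K" "a \<in> K"
  shows "e (Tr K (cj a L)) \<otimes>\<^bsub>A\<^esub> e (Conj a L) = e (Tr K L)"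
proof -
  have a: "a \<in> carrier G" using assms subgroup.subset by blast
  have "e (Tr (cj a K) (cj a L)) \<otimes>\<^bsub>A\<^esub> e (Conj a L) = e (Conj a K) \<otimes>\<^bsub>A\<^esub> e (Tr K L)"
    using rels(7)[OF assms(2,1,3) a] .
  also have "e (Conj a K) = e (Tr K K)" using rels(2)[OF assms(1)] rels(3)[OF assms(1,4)] by simp
  also have "e (Tr K K) \<otimes>\<^bsub>A\<^esub> e (Tr K L) = e (Tr K L)"
    using rels(4)[OF assms(2,1,1,3)] by simp
  finally show ?thesis using G.conj_subgroup_self[OF assms(1,4)] by simp
qed

lemma conj_res_self:
  assumes "subgroup H G" "subgroup M G" "M \<subseteq> H" "b \<in> H"
  shows "e (Conj b (cj (inv\<^bsub>G\<^esub> b) M)) \<otimes>\<^bsub>A\<^esub> e (Res H (cj (inv\<^bsub>G\<^esub> b) M)) = e (Res H M)"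
proof -
  have b: "b \<in> carrier G" and bi: "inv\<^bsub>G\<^esub> b \<in> H" "inv\<^bsub>G\<^esub> b \<in> carrier G"
    using assms subgroup.subset subgroup.m_inv_closed by fastforce+
  let ?N = "cj (inv\<^bsub>G\<^esub> b) M"
  have N: "subgroup ?N G" using G.conj_subgroup_is_subgroup[OF assms(2) bi(2)] .
  have NH: "?N \<subseteq> H"
    using G.conj_subgroup_mono[OF assms(3) subgroup.subset[OF assms(1)] bi(2)] G.conj_subgroup_self[OF assms(1) bi(1)] by simp
  have NM: "cj b ?N = M" using G.conj_subgroup_cancel(1)[OF subgroup.subset[OF assms(2)] b] .
  have "e (Res (cj b H) (cj b ?N)) \<otimes>\<^bsub>A\<^esub> e (Conj b H) = e (Conj b ?N) \<otimes>\<^bsub>A\<^esub> e (Res H ?N)"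
    using rels(8)[OF N assms(1) NH b] .
  moreover have "e (Conj b H) = e (Res H H)" using rels(3)[OF assms(1,4)] by simp
  moreover have "e (Res H M) \<otimes>\<^bsub>A\<^esub> e (Res H H) = e (Res H M)"
    using rels(5)[OF assms(2,1,1,3)] by simp
  ultimately show ?thesis using G.conj_subgroup_self[OF assms(1,4)] NM by simp
qed

lemma std_elem_conj_left:
  assumes q: "(K, L, g, H) \<in> G.std_index" and a: "a \<in> K"
  shows "std_elem (K, cj a L, a \<otimes>\<^bsub>G\<^esub> g, H) = std_elem (K, L, g, H)"
proof -
  note I = G.std_indexD[OF q]
  have ac: "a \<in> carrier G" using a I(1) subgroup.subset by blast
  let ?M = "cj (inv\<^bsub>G\<^esub> g) L"
  have M: "cj (inv\<^bsub>G\<^esub> (a \<otimes>\<^bsub>G\<^esub> g)) (cj a L) = ?M"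
    using ac I by (simp add: G.conj_subgroup_conj subgroup.subset G.group_normalize)
  have L: "cj g ?M = L" using G.conj_subgroup_cancel(1)[OF subgroup.subset[OF I(2)] I(4)] .
  have cjaK: "cj a L \<subseteq> K"
    using G.conj_subgroup_mono[OF I(5) subgroup.subset[OF I(1)] ac] G.conj_subgroup_self[OF I(1) a] by simp
  have "e (Conj (a \<otimes>\<^bsub>G\<^esub> g) ?M) = e (Conj a L) \<otimes>\<^bsub>A\<^esub> e (Conj g ?M)"
    using rels(6)[OF I(7) I(4) ac] L by simp
  then have "e (Tr K (cj a L)) \<otimes>\<^bsub>A\<^esub> e (Conj (a \<otimes>\<^bsub>G\<^esub> g) ?M)
      = (e (Tr K (cj a L)) \<otimes>\<^bsub>A\<^esub> e (Conj a L)) \<otimes>\<^bsub>A\<^esub> e (Conj g ?M)"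
    using I ac cjaK G.conj_subgroup_is_subgroup[OF I(2) ac] by (simp add: A.m_assoc e_closed)
  also have "\<dots> = e (Tr K L) \<otimes>\<^bsub>A\<^esub> e (Conj g ?M)" using tr_conj_self[OF I(1,2,5) a] by simp
  finally show ?thesis by (simp add: std_elem_def M)
qed

lemma std_elem_conj_right:
  assumes q: "(K, L, g, H) \<in> G.std_index" and b: "b \<in> H"
  shows "std_elem (K, L, g \<otimes>\<^bsub>G\<^esub> b, H) = std_elem (K, L, g, H)"
proof -
  note I = G.std_indexD[OF q]
  have bc: "b \<in> carrier G" using b I(3) subgroup.subset by blast
  let ?M = "cj (inv\<^bsub>G\<^esub> g) L"
  let ?N = "cj (inv\<^bsub>G\<^esub> b) ?M"
  have N: "cj (inv\<^bsub>G\<^esub> (g \<otimes>\<^bsub>G\<^esub> b)) L = ?N"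
    using bc I by (simp add: G.conj_subgroup_conj subgroup.subset G.inv_mult_group)
  have NM: "cj b ?N = ?M" using G.conj_subgroup_cancel(1)[OF subgroup.subset[OF I(7)] bc] .
  have Ns: "subgroup ?N G" using G.conj_subgroup_is_subgroup[OF I(7)] bc by simp
  have NH: "?N \<subseteq> H"
    using G.conj_subgroup_mono[OF I(6) subgroup.subset[OF I(3)], of "inv\<^bsub>G\<^esub> b"] bc
      G.conj_subgroup_self[OF I(3) subgroup.m_inv_closed[OF I(3) b]] by simp
  have "e (Conj (g \<otimes>\<^bsub>G\<^esub> b) ?N) = e (Conj g ?M) \<otimes>\<^bsub>A\<^esub> e (Conj b ?N)"
    using rels(6)[OF Ns bc I(4)] NM by simp
  moreover have "e (Conj b ?N) \<otimes>\<^bsub>A\<^esub> e (Res H ?N) = e (Res H ?M)"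
    by (rule conj_res_self[OF I(3,7,6) b])
  ultimately show ?thesis
    using I Ns NH bc by (simp add: std_elem_def N A.m_assoc e_closed)
qed

text \<open>This is the ambiguity in the index of a standard element. By
  \<open>wcount_std_std_nonzeroD\<close>, the indices with equally large middle groups at which such
  an element has nonzero entries all arise in this way, so their contributions can be
  collected.\<close>

lemma std_elem_conj:
  assumes q: "(K, L, g, H) \<in> G.std_index" and a: "a \<in> K" and b: "b \<in> H"
  shows "std_elem (K, cj a L, a \<otimes>\<^bsub>G\<^esub> g \<otimes>\<^bsub>G\<^esub> b, H) = std_elem (K, L, g, H)"
proof -
  note I = G.std_indexD[OF q]
  have ac: "a \<in> carrier G" using a I(1) subgroup.subset by blast
  have "(K, cj a L, a \<otimes>\<^bsub>G\<^esub> g, H) \<in> G.std_index"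
    using I ac G.conj_subgroup_is_subgroup[OF I(2) ac] G.conj_subgroup_mono[OF I(5) subgroup.subset[OF I(1)] ac]
      G.conj_subgroup_self[OF I(1) a]
    by (simp add: G.std_index_def G.conj_subgroup_conj subgroup.subset G.group_normalize)
  from std_elem_conj_right[OF this b] show ?thesis using std_elem_conj_left[OF q a] by simp
qed

abbreviation std_span :: "'a set" where "std_span \<equiv> span (std_elem ` G.std_index)"

lemma std_elems_carrier: "std_elem ` G.std_index \<subseteq> carrier A"
  using std_elem_closed by blast

lemma std_span_submodule: "LinearCombinations.submodule R std_span A"
  by (rule span_is_submodule[OF std_elems_carrier])

lemma std_elem_in_span: "q \<in> G.std_index \<Longrightarrow> std_elem q \<in> std_span"
  using in_own_span[OF std_elems_carrier] by blast

lemma std_span_finsum: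
  assumes "finite I" "\<And>i. i \<in> I \<Longrightarrow> h i \<in> std_span"
  shows "(\<Oplus>\<^bsub>A\<^esub>i\<in>I. h i) \<in> std_span"
  using assms
proof (induction I rule: finite_induct)
  case empty
  then show ?case using submodule.zero_closed[OF std_span_submodule] by simp
next
  case (insert i I)
  have "h j \<in> carrier A" if "j \<in> insert i I" for j
    using insert.prems[OF that] submodule.subset[OF std_span_submodule] by blast
  then have "(\<Oplus>\<^bsub>A\<^esub>i\<in>insert i I. h i) = h i \<oplus>\<^bsub>A\<^esub> (\<Oplus>\<^bsub>A\<^esub>i\<in>I. h i)"
    using insert by (intro M.finsum_insert) auto
  then show ?case using insert submodule.m_closed[OF std_span_submodule] by simp
qed

lemma one_in_std_span: "\<one>\<^bsub>A\<^esub> \<in> std_span"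
proof -
  have "e (Tr H H) \<in> std_span" if H: "subgroup H G" for H
  proof -
    have "(H, H, \<one>\<^bsub>G\<^esub>, H) \<in> G.std_index"
      using H by (simp add: G.std_index_def G.conj_subgroup_one subgroup.subset)
    moreover have "std_elem (H, H, \<one>\<^bsub>G\<^esub>, H) = e (Tr H H)"
      using H rels(2)[OF H] rels(3)[OF H subgroup.one_closed[OF H]] rels(4)[OF H H H]
      by (simp add: std_elem_def G.conj_subgroup_one subgroup.subset)
    ultimately show ?thesis using std_elem_in_span by metis
  qed
  then have "(\<Oplus>\<^bsub>A\<^esub>H\<in>{H. subgroup H G}. e (Tr H H)) \<in> std_span"
    using G.finite_subgroups[OF finite_group] by (intro std_span_finsum) auto
  then show ?thesis using rels(1) by simp
qed

lemma tr_std_elem: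
  assumes q: "(K, L, g, H) \<in> G.std_index" and M: "subgroup M G" "K \<subseteq> M"
  shows "e (Tr M K) \<otimes>\<^bsub>A\<^esub> std_elem (K, L, g, H) \<in> std_span"
proof -
  note I = G.std_indexD[OF q] and c = std_gens_closed[OF q]
  have "(M, L, g, H) \<in> G.std_index" using I M by (auto simp: G.std_index_def)
  moreover have "e (Tr M K) \<otimes>\<^bsub>A\<^esub> std_elem (K, L, g, H) = std_elem (M, L, g, H)"
    using rels(4)[OF I(2,1) M(1) I(5) M(2)] c I M by (simp add: std_elem_def e_closed flip: A.m_assoc)
  ultimately show ?thesis using std_elem_in_span by metis
qed

lemma conj_std_elem:
  assumes q: "(K, L, g, H) \<in> G.std_index" and h: "h \<in> carrier G"
  shows "e (Conj h K) \<otimes>\<^bsub>A\<^esub> std_elem (K, L, g, H) \<in> std_span"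
proof -
  note I = G.std_indexD[OF q] and c = std_gens_closed[OF q]
  let ?M = "cj (inv\<^bsub>G\<^esub> g) L"
  have L: "cj g ?M = L" using G.conj_subgroup_cancel(1)[OF subgroup.subset[OF I(2)] I(4)] .
  have M: "cj (inv\<^bsub>G\<^esub> (h \<otimes>\<^bsub>G\<^esub> g)) (cj h L) = ?M"
    using h I by (simp add: G.conj_subgroup_conj subgroup.subset G.group_normalize)
  have sub: "subgroup (cj h K) G" "subgroup (cj h L) G" "cj h L \<subseteq> cj h K"
    using I h G.conj_subgroup_is_subgroup G.conj_subgroup_mono[OF I(5) subgroup.subset[OF I(1)] h] by auto
  have idx: "(cj h K, cj h L, h \<otimes>\<^bsub>G\<^esub> g, H) \<in> G.std_index"
    using I h sub M by (simp add: G.std_index_def)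
  have cc: "e (Conj h K) \<in> carrier A" "e (Conj h L) \<in> carrier A" "e (Tr (cj h K) (cj h L)) \<in> carrier A"
    using I h sub by (auto intro!: e_closed)
  have "e (Conj h K) \<otimes>\<^bsub>A\<^esub> std_elem (K, L, g, H)
      = (e (Conj h K) \<otimes>\<^bsub>A\<^esub> e (Tr K L)) \<otimes>\<^bsub>A\<^esub> e (Conj g ?M) \<otimes>\<^bsub>A\<^esub> e (Res H ?M)"
    using c cc by (simp add: std_elem_def A.m_assoc)
  also have "\<dots> = (e (Tr (cj h K) (cj h L)) \<otimes>\<^bsub>A\<^esub> e (Conj h L)) \<otimes>\<^bsub>A\<^esub> e (Conj g ?M) \<otimes>\<^bsub>A\<^esub> e (Res H ?M)"
    using rels(7)[OF I(2,1,5) h] by simp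
  also have "\<dots> = e (Tr (cj h K) (cj h L)) \<otimes>\<^bsub>A\<^esub> (e (Conj h L) \<otimes>\<^bsub>A\<^esub> e (Conj g ?M)) \<otimes>\<^bsub>A\<^esub> e (Res H ?M)"
    using c cc by (simp add: A.m_assoc)
  also have "\<dots> = std_elem (cj h K, cj h L, h \<otimes>\<^bsub>G\<^esub> g, H)"
    using rels(6)[OF I(7,4) h] L M by (simp add: std_elem_def)
  finally show ?thesis using std_elem_in_span[OF idx] by simp
qed

text \<open>The Mackey relation expands r^K_M t^K_L over double cosets. In each summand the
  restriction is moved past c_g; then adjacent conjugations and adjacent restrictions merge. The
  result is the standard element with middle group M \<inter> hLh^{-1} and group element hg.\<close>

lemma res_std_elem:
  assumes q: "(K, L, g, H) \<in> G.std_index" and M: "subgroup M G" "M \<subseteq> K"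
  shows "e (Res K M) \<otimes>\<^bsub>A\<^esub> std_elem (K, L, g, H) \<in> std_span"
proof -
  note I = G.std_indexD[OF q] and c = std_gens_closed[OF q]
  let ?L' = "cj (inv\<^bsub>G\<^esub> g) L"
  obtain D where D: "double_coset_reps G M K L D"
    using G.double_coset_reps_exists[OF I(1,2) M(1) I(5) M(2)] .
  have DK: "D \<subseteq> K" using D by (simp add: double_coset_reps_def)
  have finD: "finite D" using finite_subset[OF DK G.finite_subgroup[OF finite_group I(1)]] .
  let ?N = "\<lambda>h. cj (inv\<^bsub>G\<^esub> h) M \<inter> L"
  let ?t = "\<lambda>h. e (Tr M (M \<inter> cj h L)) \<otimes>\<^bsub>A\<^esub> e (Conj h (?N h)) \<otimes>\<^bsub>A\<^esub> e (Res L (?N h))"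
  have cr: "e (Res K M) \<in> carrier A" "e (Tr K L) \<in> carrier A" using I M by (auto intro!: e_closed)
  have L: "cj g ?L' = L" using G.conj_subgroup_cancel(1)[OF subgroup.subset[OF I(2)] I(4)] .
  have step: "?t h \<in> carrier A \<and> ?t h \<otimes>\<^bsub>A\<^esub> (e (Conj g ?L') \<otimes>\<^bsub>A\<^esub> e (Res H ?L')) \<in> std_span" if hD: "h \<in> D" for h
  proof -
    have h: "h \<in> carrier G" using hD DK subgroup.subset[OF I(1)] by blast
    have idx1: "(M, M \<inter> cj h L, h, L) \<in> G.std_index" using G.mackey_index[OF finite_group I(2) M(1) h] .
    have N: "cj (inv\<^bsub>G\<^esub> h) (M \<inter> cj h L) = ?N h"
      using G.mackey_Int[OF finite_group subgroup.subset[OF I(2)] subgroup.subset[OF M(1)] h] .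
    note J = G.std_indexD[OF idx1] and cJ = std_gens_closed[OF idx1, unfolded N]
    have Ns: "subgroup (?N h) G" using J(7) N by simp
    let ?N' = "cj (inv\<^bsub>G\<^esub> g) (?N h)"
    have N's: "subgroup ?N' G" using G.conj_subgroup_is_subgroup[OF Ns] I(4) by simp
    have N'L': "?N' \<subseteq> ?L'"
      using G.conj_subgroup_mono[of "?N h" L "inv\<^bsub>G\<^esub> g"] subgroup.subset[OF I(2)] I(4) by simp
    have NN': "cj g ?N' = ?N h" using G.conj_subgroup_cancel(1)[OF subgroup.subset[OF Ns] I(4)] .
    have c': "e (Conj g ?N') \<in> carrier A" "e (Res ?L' ?N') \<in> carrier A" "e (Res H ?N') \<in> carrier A"
      using I N's N'L' by (auto intro!: e_closed)
    have eqN: "cj (inv\<^bsub>G\<^esub> (h \<otimes>\<^bsub>G\<^esub> g)) (M \<inter> cj h L) = ?N'"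
      using h I(4) N G.conj_subgroup_conj[OF subgroup.subset[OF J(2)], of "inv\<^bsub>G\<^esub> g" "inv\<^bsub>G\<^esub> h"]
      by (simp add: G.inv_mult_group)
    have idx: "(M, M \<inter> cj h L, h \<otimes>\<^bsub>G\<^esub> g, H) \<in> G.std_index"
      using J I h eqN N'L' by (auto simp: G.std_index_def)
    have r: "e (Res L (?N h)) \<otimes>\<^bsub>A\<^esub> e (Conj g ?L') = e (Conj g ?N') \<otimes>\<^bsub>A\<^esub> e (Res ?L' ?N')"
      using rels(8)[OF N's I(7) N'L' I(4)] L NN' by simp
    have rr: "e (Res ?L' ?N') \<otimes>\<^bsub>A\<^esub> e (Res H ?L') = e (Res H ?N')"
      using rels(5)[OF N's I(7) I(3) N'L' I(6)] .
    have cjj: "e (Conj h (?N h)) \<otimes>\<^bsub>A\<^esub> e (Conj g ?N') = e (Conj (h \<otimes>\<^bsub>G\<^esub> g) ?N')"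
      using rels(6)[OF N's I(4) h] NN' by simp
    have "?t h \<otimes>\<^bsub>A\<^esub> (e (Conj g ?L') \<otimes>\<^bsub>A\<^esub> e (Res H ?L'))
        = e (Tr M (M \<inter> cj h L)) \<otimes>\<^bsub>A\<^esub> e (Conj h (?N h)) \<otimes>\<^bsub>A\<^esub> (e (Res L (?N h)) \<otimes>\<^bsub>A\<^esub> e (Conj g ?L')) \<otimes>\<^bsub>A\<^esub> e (Res H ?L')"
      using cJ c by (simp add: A.m_assoc)
    also have "\<dots> = e (Tr M (M \<inter> cj h L)) \<otimes>\<^bsub>A\<^esub> (e (Conj h (?N h)) \<otimes>\<^bsub>A\<^esub> e (Conj g ?N')) \<otimes>\<^bsub>A\<^esub> (e (Res ?L' ?N') \<otimes>\<^bsub>A\<^esub> e (Res H ?L'))"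
      unfolding r using cJ c c' by (simp add: A.m_assoc)
    also have "\<dots> = std_elem (M, M \<inter> cj h L, h \<otimes>\<^bsub>G\<^esub> g, H)"
      unfolding rr cjj by (simp add: std_elem_def eqN)
    finally show ?thesis using std_elem_in_span[OF idx] cJ by simp
  qed
  have "e (Res K M) \<otimes>\<^bsub>A\<^esub> std_elem (K, L, g, H)
      = (e (Res K M) \<otimes>\<^bsub>A\<^esub> e (Tr K L)) \<otimes>\<^bsub>A\<^esub> (e (Conj g ?L') \<otimes>\<^bsub>A\<^esub> e (Res H ?L'))"
    using c cr by (simp add: std_elem_def A.m_assoc)
  also have "\<dots> = (\<Oplus>\<^bsub>A\<^esub>h\<in>D. ?t h) \<otimes>\<^bsub>A\<^esub> (e (Conj g ?L') \<otimes>\<^bsub>A\<^esub> e (Res H ?L'))"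
    using rels(9)[OF I(1,2) M(1) I(5) M(2) D] by simp
  also have "\<dots> = (\<Oplus>\<^bsub>A\<^esub>h\<in>D. ?t h \<otimes>\<^bsub>A\<^esub> (e (Conj g ?L') \<otimes>\<^bsub>A\<^esub> e (Res H ?L')))"
    using c step finD by (intro A.finsum_ldistr) auto
  also have "\<dots> \<in> std_span" using step finD by (intro std_span_finsum) auto
  finally show ?thesis .
qed

lemma gen_std_elem:
  assumes "x \<in> mackey_gens G" "q \<in> G.std_index"
  shows "e x \<otimes>\<^bsub>A\<^esub> std_elem q \<in> std_span"
proof -
  obtain K L g H where q: "q = (K, L, g, H)" by (cases q)
  note idx = assms(2)[unfolded q]
  note I = G.std_indexD[OF idx] and c = std_gens_closed[OF idx]
  show ?thesis
  proof (cases "gen_source x = K")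
    case True
    show ?thesis
    proof (cases x)
      case (Tr M K')
      then show ?thesis using True assms(1) tr_std_elem[OF idx] q by simp
    next
      case (Res K' M)
      then show ?thesis using True assms(1) res_std_elem[OF idx] q by simp
    next
      case (Conj h K')
      then show ?thesis using True assms(1) conj_std_elem[OF idx] q by simp
    qed
  next
    case False
    have "e x \<otimes>\<^bsub>A\<^esub> e (Tr K L) = \<zero>\<^bsub>A\<^esub>" using rels(10)[of x "Tr K L"] assms(1) I False by simp
    then have "e x \<otimes>\<^bsub>A\<^esub> std_elem q = \<zero>\<^bsub>A\<^esub>"
      using c e_closed[OF assms(1)] by (simp add: q std_elem_def flip: A.m_assoc)
    then show ?thesis using submodule.zero_closed[OF std_span_submodule] by simp
  qed
qed

text \<open>Left multiplication by a generator is linear, so the elements that it sends into the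
  span form a submodule, and it contains the standard elements.\<close>

lemma gen_std_span:
  assumes x: "x \<in> mackey_gens G" and y: "y \<in> std_span"
  shows "e x \<otimes>\<^bsub>A\<^esub> y \<in> std_span"
proof -
  note S = std_span_submodule
  have "LinearCombinations.submodule R {y \<in> carrier A. e x \<otimes>\<^bsub>A\<^esub> y \<in> std_span} A"
  proof (rule submodule.intro[OF module_axioms])
    fix a y assume "a \<in> carrier R" "y \<in> {y \<in> carrier A. e x \<otimes>\<^bsub>A\<^esub> y \<in> std_span}"
    then show "a \<odot>\<^bsub>A\<^esub> y \<in> {y \<in> carrier A. e x \<otimes>\<^bsub>A\<^esub> y \<in> std_span}"
      using e_closed[OF x] submodule.smult_closed[OF S] by (simp add: smult_mult_right)
  next
    fix y z assume "y \<in> {y \<in> carrier A. e x \<otimes>\<^bsub>A\<^esub> y \<in> std_span}" "z \<in> {y \<in> carrier A. e x \<otimes>\<^bsub>A\<^esub> y \<in> std_span}"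
    then show "y \<oplus>\<^bsub>A\<^esub> z \<in> {y \<in> carrier A. e x \<otimes>\<^bsub>A\<^esub> y \<in> std_span}"
      using e_closed[OF x] submodule.m_closed[OF S] by (simp add: A.r_distr)
  qed (use e_closed[OF x] submodule.zero_closed[OF S] in auto)
  then have "std_span \<subseteq> {y \<in> carrier A. e x \<otimes>\<^bsub>A\<^esub> y \<in> std_span}"
    using gen_std_elem[OF x] std_elem_closed by (intro span_is_subset) auto
  then show ?thesis using y by blast
qed

definition word_elem :: "'g mackey_gen list \<Rightarrow> 'a" where
  "word_elem w = foldr (\<lambda>x y. e x \<otimes>\<^bsub>A\<^esub> y) w \<one>\<^bsub>A\<^esub>"

text \<open>Words are built from the identity by left multiplication, so closure of the span under
  left multiplication by generators suffices.\<close>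

lemma word_elem_in_span: "w \<in> lists (mackey_gens G) \<Longrightarrow> word_elem w \<in> std_span"
  by (induction w) (auto simp: word_elem_def one_in_std_span gen_std_span)

end

section \<open>The trace form of the Mackey algebra\<close>

lemma finsum_free_algebra: "finsum (free_algebra R X) h I = finsum (free_module R (lists X)) h I"
proof -
  have "add_monoid (free_algebra R X) = add_monoid (free_module R (lists X))"
    by (simp add: free_algebra_def)
  then show ?thesis by (simp add: finsum_def)
qed

text \<open>Both cases of the characteristic hypothesis enter only through
  \<open>order_invertible\<close>. It is stated for all divisors of the order of G since it is
  applied to orders of subgroups and to indices.\<close>

locale mackey_algebra_coprime = G: group G + k: field k
  for G :: "('g, 'm) monoid_scheme" and k :: "('k, 'n) ring_scheme" +
  assumes finite_group: "finite (carrier G)"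
    and order_invertible: "n dvd order G \<Longrightarrow> nat_emb k n \<noteq> \<zero>\<^bsub>k\<^esub>"
begin

abbreviation "X \<equiv> mackey_gens G"
abbreviation "W \<equiv> lists X"
abbreviation "F \<equiv> free_algebra k X"
abbreviation "E \<equiv> mackey_relations G F (free_gen k X)"
abbreviation "I \<equiv> Idl\<^bsub>F\<^esub> {u \<ominus>\<^bsub>F\<^esub> v | u v. (u, v) \<in> E}"
abbreviation "A \<equiv> mackey_algebra k G"
abbreviation "wmon \<equiv> monomial k W"
abbreviation "proj \<equiv> \<lambda>f. I +>\<^bsub>F\<^esub> f"
abbreviation "fixed \<equiv> group.fixed_cosets G"

lemma A_eq: "A = quotient_algebra F I"
  by (simp add: mackey_algebra_def presented_algebra_def Let_def)

interpretation F: unital_algebra k F by (rule k.free_algebra_unital)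

lemmas gen_eq = k.free_gen_eq_monomial
lemmas F_carrier = k.free_algebra_ops(1)[of X]

lemma mon_closed [simp]: "wmon w \<in> carrier F"
  by (simp add: F_carrier)

lemma mon_mult: "u \<in> W \<Longrightarrow> v \<in> W \<Longrightarrow> wmon u \<otimes>\<^bsub>F\<^esub> wmon v = wmon (u @ v)"
  by (rule k.monomial_mult)

definition rho :: "'g set \<Rightarrow> 'g set \<Rightarrow> 'g set \<Rightarrow> ('g mackey_gen list \<Rightarrow> 'k) \<Rightarrow> 'k" where
  "rho P x y = k.lin_ext W (\<lambda>w. nat_emb k (G.wcount P w x y))"

lemma nat_emb_funcset: "(\<lambda>w. nat_emb k (h w)) \<in> W \<rightarrow> carrier k"
  by simp

lemma rho_mon: "w \<in> W \<Longrightarrow> rho P x y (wmon w) = nat_emb k (G.wcount P w x y)"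
  unfolding rho_def by (rule k.lin_ext_monomial) simp_all

lemma rho_linear: "rho P x y \<in> module_hom k F (regular_module k)"
  unfolding rho_def
  using k.lin_ext_closed[OF _ nat_emb_funcset] k.lin_ext_add[OF _ _ nat_emb_funcset] k.lin_ext_smult[OF _ _ nat_emb_funcset]
  by (intro module_hom_regularI) (simp_all add: k.free_algebra_ops)

lemmas rhoD = module_hom_regularD[OF rho_linear]

lemma rho_finsum:
  assumes "finite J" "\<And>i. i \<in> J \<Longrightarrow> h i \<in> carrier F"
  shows "rho P x y (\<Oplus>\<^bsub>F\<^esub>i\<in>J. h i) = (\<Oplus>\<^bsub>k\<^esub>i\<in>J. rho P x y (h i))"
  unfolding rho_def finsum_free_algebra
  using assms by (intro k.lin_ext_finsum) (auto simp: F_carrier)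

lemma rho_word_finsum:
  assumes "finite J" "\<And>i. i \<in> J \<Longrightarrow> w i \<in> W"
  shows "rho P x y (\<Oplus>\<^bsub>F\<^esub>i\<in>J. wmon (w i)) = nat_emb k (\<Sum>i\<in>J. G.wcount P (w i) x y)"
proof -
  have "rho P x y (\<Oplus>\<^bsub>F\<^esub>i\<in>J. wmon (w i)) = (\<Oplus>\<^bsub>k\<^esub>i\<in>J. rho P x y (wmon (w i)))"
    using assms by (intro rho_finsum) auto
  also have "\<dots> = (\<Oplus>\<^bsub>k\<^esub>i\<in>J. nat_emb k (G.wcount P (w i) x y))"
    using assms by (intro k.finsum_cong') (auto simp: rho_mon)
  finally show ?thesis using assms(1) by (simp add: k.nat_emb_sum)
qed

lemma relation_mackey_word:
  assumes "subgroup H G" "subgroup K G" "subgroup L G" "K \<subseteq> H" "L \<subseteq> H" "double_coset_reps G L H K D" "h \<in> D"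
  shows "[Tr L (L \<inter> conj_subgroup G h K), Conj h (conj_subgroup G (inv\<^bsub>G\<^esub> h) L \<inter> K),
      Res K (conj_subgroup G (inv\<^bsub>G\<^esub> h) L \<inter> K)] \<in> W"
    and "free_gen k X (Tr L (L \<inter> conj_subgroup G h K)) \<otimes>\<^bsub>F\<^esub> free_gen k X (Conj h (conj_subgroup G (inv\<^bsub>G\<^esub> h) L \<inter> K))
        \<otimes>\<^bsub>F\<^esub> free_gen k X (Res K (conj_subgroup G (inv\<^bsub>G\<^esub> h) L \<inter> K))
      = wmon [Tr L (L \<inter> conj_subgroup G h K), Conj h (conj_subgroup G (inv\<^bsub>G\<^esub> h) L \<inter> K),
      Res K (conj_subgroup G (inv\<^bsub>G\<^esub> h) L \<inter> K)]"
proof -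
  have h: "h \<in> carrier G"
    using assms(1,6,7) subgroup.subset by (auto simp: double_coset_reps_def)
  note idx = G.mackey_index[OF finite_group assms(2,3) h]
  note J = G.std_indexD[OF idx, unfolded G.mackey_Int[OF finite_group subgroup.subset[OF assms(2)] subgroup.subset[OF assms(3)] h]]
  show w: "[Tr L (L \<inter> conj_subgroup G h K), Conj h (conj_subgroup G (inv\<^bsub>G\<^esub> h) L \<inter> K),
      Res K (conj_subgroup G (inv\<^bsub>G\<^esub> h) L \<inter> K)] \<in> W"
    using J by simp
  then show "free_gen k X (Tr L (L \<inter> conj_subgroup G h K)) \<otimes>\<^bsub>F\<^esub> free_gen k X (Conj h (conj_subgroup G (inv\<^bsub>G\<^esub> h) L \<inter> K))
        \<otimes>\<^bsub>F\<^esub> free_gen k X (Res K (conj_subgroup G (inv\<^bsub>G\<^esub> h) L \<inter> K))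
      = wmon [Tr L (L \<inter> conj_subgroup G h K), Conj h (conj_subgroup G (inv\<^bsub>G\<^esub> h) L \<inter> K),
      Res K (conj_subgroup G (inv\<^bsub>G\<^esub> h) L \<inter> K)]"
    by (simp add: gen_eq mon_mult)
qed

text \<open>Both sides of a relation are sums of words, the empty sum in the case
  \<open>zero\<close>. Equality of their entries is therefore the image in \<open>k\<close> of an
  identity of path counts.\<close>

lemma relation_words:
  assumes uv: "(u, v) \<in> E" and P: "subgroup P G" and xy: "x \<in> fixed P" "y \<in> fixed P"
  shows "u \<in> carrier F" "v \<in> carrier F" "rho P x y u = rho P x y v"
proof -
  note conj = G.conj_subgroup_is_subgroup
  have two: "free_gen k X a \<otimes>\<^bsub>F\<^esub> free_gen k X b = wmon [a, b]" if "a \<in> X" "b \<in> X" for a b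
    using that by (simp add: gen_eq mon_mult)
  note count = finite_group P
  have "u \<in> carrier F \<and> v \<in> carrier F \<and> rho P x y u = rho P x y v"
    using uv
  proof (cases rule: mackey_relations.cases)
    case unit
    have fs: "finite {H. subgroup H G}" by (rule G.finite_subgroups[OF finite_group])
    have "rho P x y (\<Oplus>\<^bsub>F\<^esub>H\<in>{H. subgroup H G}. wmon [Tr H H]) = rho P x y (wmon [])"
      using G.wcount_unit[OF count xy] fs by (subst rho_word_finsum) (auto simp: rho_mon)
    then show ?thesis using unit by (simp add: gen_eq k.free_algebra_ops(5)[of X] F.M.finsum_closed)
  next
    case (tr_res_id H)
    then show ?thesis using G.wcount_tr_res_id[OF finite_group _ xy(2), of H x]
      by (simp add: gen_eq rho_mon del: G.wcount.simps)
  next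
    case (res_conj_id H h)
    then have "h \<in> carrier G" using subgroup.subset by blast
    then show ?thesis using res_conj_id G.wcount_res_conj_id[OF finite_group _ _ xy(2), of H h x]
      by (simp add: gen_eq rho_mon del: G.wcount.simps)
  next
    case (tr_tr H K L)
    then show ?thesis using G.wcount_tr_tr[OF count, of H K L y x] xy subset_trans[OF tr_tr(6,7)]
      by (simp add: gen_eq mon_mult rho_mon del: G.wcount.simps)
  next
    case (res_res H K L)
    then show ?thesis using G.wcount_res_res[OF count, of H K L x y] xy subset_trans[OF res_res(6,7)]
      by (simp add: gen_eq mon_mult rho_mon del: G.wcount.simps)
  next
    case (conj_conj H g g')
    then show ?thesis using G.wcount_conj_conj[OF count, of H g g' y x] xy conj
      by (simp add: gen_eq mon_mult rho_mon del: G.wcount.simps)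
  next
    case (tr_conj H K g)
    then show ?thesis
      using G.wcount_tr_conj[OF count, of H K g x y] xy conj
        G.conj_subgroup_mono[OF tr_conj(5) subgroup.subset[OF tr_conj(4)] tr_conj(6)]
      by (simp add: gen_eq mon_mult rho_mon del: G.wcount.simps)
  next
    case (res_conj H K g)
    then show ?thesis
      using G.wcount_res_conj[OF count, of H K g x y] xy conj
        G.conj_subgroup_mono[OF res_conj(5) subgroup.subset[OF res_conj(4)] res_conj(6)]
      by (simp add: gen_eq mon_mult rho_mon del: G.wcount.simps)
  next
    case (mackey H K L D)
    let ?w = "\<lambda>h. [Tr L (L \<inter> conj_subgroup G h K), Conj h (conj_subgroup G (inv\<^bsub>G\<^esub> h) L \<inter> K),
      Res K (conj_subgroup G (inv\<^bsub>G\<^esub> h) L \<inter> K)]"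
    note rw = relation_mackey_word[OF mackey(3-8)]
    have "D \<subseteq> H" using mackey by (simp add: double_coset_reps_def)
    then have finD: "finite D" using G.finite_subgroup[OF finite_group mackey(3)] finite_subset by blast
    have v: "v = (\<Oplus>\<^bsub>F\<^esub>h\<in>D. wmon (?w h))"
      unfolding mackey(2) using rw(2) by (intro F.M.finsum_cong') auto
    have u: "u = wmon [Res H L, Tr H K]" using mackey two by simp
    have "rho P x y u = rho P x y v"
      unfolding u v using mackey rw(1) finD G.wcount_mackey[OF finite_group mackey(3-8) P xy]
      by (subst rho_word_finsum) (simp_all add: rho_mon del: G.wcount.simps)
    then show ?thesis unfolding u v by (auto intro!: F.M.finsum_closed)
  next
    case (zero a b)
    have "rho P x y (\<zero>\<^bsub>k\<^esub> \<odot>\<^bsub>F\<^esub> \<zero>\<^bsub>F\<^esub>) = \<zero>\<^bsub>k\<^esub> \<otimes>\<^bsub>k\<^esub> rho P x y \<zero>\<^bsub>F\<^esub>"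
      by (rule rhoD(3)[OF k.zero_closed F.M.zero_closed])
    then have "rho P x y \<zero>\<^bsub>F\<^esub> = \<zero>\<^bsub>k\<^esub>" using rhoD(1)[OF F.M.zero_closed] by simp
    then show ?thesis using zero G.wcount_zero[OF finite_group P zero(3-5) xy(2)]
      by (simp add: two rho_mon del: G.wcount.simps)
  qed
  then show "u \<in> carrier F" "v \<in> carrier F" "rho P x y u = rho P x y v" by auto
qed

text \<open>\<open>relation_words\<close> gives membership in the free algebra only for some
  \<open>P\<close> with fixed cosets \<open>x\<close> and \<open>y\<close>; the trivial subgroup
  supplies such a choice.\<close>

lemma trivial_fixed: "subgroup {\<one>\<^bsub>G\<^esub>} G" "{\<one>\<^bsub>G\<^esub>} \<in> fixed {\<one>\<^bsub>G\<^esub>}"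
proof -
  show 1: "subgroup {\<one>\<^bsub>G\<^esub>} G" by (rule G.triv_subgroup)
  show "{\<one>\<^bsub>G\<^esub>} \<in> fixed {\<one>\<^bsub>G\<^esub>}"
    using G.subgroup_in_lcos[OF 1] 1 by (auto simp: G.fixed_cosets_def G.fixes_set_def)
qed

lemmas relation_carrier = relation_words(1,2)[OF _ trivial_fixed(1) trivial_fixed(2) trivial_fixed(2)]

lemma relators_carrier: "{u \<ominus>\<^bsub>F\<^esub> v | u v. (u, v) \<in> E} \<subseteq> carrier F"
  using relation_carrier by auto

lemma I_ideal: "ideal I F"
  by (rule F.A.genideal_ideal[OF relators_carrier])

text \<open>For a fixed \<open>P\<close> the common kernel of all entries is an ideal, and it
  contains the differences of the two sides of the relations. Hence it contains
  \<open>I\<close>.\<close>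

lemma rho_ideal:
  assumes f: "f \<in> I" and P: "subgroup P G" and xy: "x \<in> fixed P" "y \<in> fixed P"
  shows "rho P x y f = \<zero>\<^bsub>k\<^esub>"
proof -
  let ?N = "{f \<in> carrier F. \<forall>x\<in>fixed P. \<forall>y\<in>fixed P. k.lin_ext W (\<lambda>w. nat_emb k (G.wcount P w x y)) f = \<zero>\<^bsub>k\<^esub>}"
  have fin: "finite (fixed P)" by (rule G.finite_fixed_cosets[OF finite_group])
  have "ideal ?N F"
    using fin by (intro k.matrix_kernel_ideal)
      (simp_all add: G.wcount_append[OF finite_group] k.nat_emb_sum k.nat_emb_mult)
  moreover have "{u \<ominus>\<^bsub>F\<^esub> v | u v. (u, v) \<in> E} \<subseteq> ?N"
  proof safe
    fix u v assume uv: "(u, v) \<in> E"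
    then show "u \<ominus>\<^bsub>F\<^esub> v \<in> carrier F" using relation_carrier[OF uv] by simp
    fix x y assume xy: "x \<in> fixed P" "y \<in> fixed P"
    note r = relation_words[OF uv P xy]
    have "u \<ominus>\<^bsub>F\<^esub> v = u \<oplus>\<^bsub>F\<^esub> (\<ominus>\<^bsub>k\<^esub> \<one>\<^bsub>k\<^esub>) \<odot>\<^bsub>F\<^esub> v"
      using r by (simp add: a_minus_def F.smult_l_minus)
    then have "rho P x y (u \<ominus>\<^bsub>F\<^esub> v) = rho P x y u \<oplus>\<^bsub>k\<^esub> (\<ominus>\<^bsub>k\<^esub> \<one>\<^bsub>k\<^esub>) \<otimes>\<^bsub>k\<^esub> rho P x y v"
      using r(1,2) by (simp add: rhoD)
    also have "\<dots> = \<zero>\<^bsub>k\<^esub>" using r rhoD(1)[OF r(2)] by (simp add: k.l_minus k.r_neg)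
    finally show "k.lin_ext W (\<lambda>w. nat_emb k (G.wcount P w x y)) (u \<ominus>\<^bsub>F\<^esub> v) = \<zero>\<^bsub>k\<^esub>"
      unfolding rho_def .
  qed
  ultimately have "I \<subseteq> ?N" by (rule F.A.genideal_minimal)
  then show ?thesis using f xy unfolding rho_def by blast
qed

section \<open>The Mackey algebra as a quotient spanned by finitely many standard elements\<close>

lemma A_unital: "unital_algebra k A"
  unfolding A_eq by (rule F.quotient_unital[OF I_ideal])

interpretation A: unital_algebra k A by (rule A_unital)

lemma proj_hom: "proj \<in> ring_hom F A"
  unfolding A_eq by (rule F.quotient_hom[OF I_ideal])

interpretation H: ring_hom_ring F A proj
  by (rule ring_hom_ringI2[OF F.A.ring_axioms A.A.ring_axioms proj_hom])

lemma A_carrier: "carrier A = proj ` carrier F"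
  unfolding A_eq by (rule F.quotient_carrier)

lemma proj_smult: "a \<in> carrier k \<Longrightarrow> f \<in> carrier F \<Longrightarrow> proj (a \<odot>\<^bsub>F\<^esub> f) = a \<odot>\<^bsub>A\<^esub> proj f"
  unfolding A_eq by (rule F.quotient_smult[OF I_ideal, symmetric])

lemma proj_relation:
  assumes "(u, v) \<in> E" shows "proj u = proj v"
proof (rule F.quotient_eqI[OF I_ideal relation_carrier(1)[OF assms] relation_carrier(2)[OF assms]])
  show "u \<ominus>\<^bsub>F\<^esub> v \<in> I" using assms F.A.genideal_self[OF relators_carrier] by blast
qed

definition gen_elem :: "'g mackey_gen \<Rightarrow> ('g mackey_gen list \<Rightarrow> 'k) set" where
  "gen_elem x = proj (free_gen k X x)"

lemma gen_closed: "free_gen k X x \<in> carrier F"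
  by (simp add: gen_eq)

lemma gen_elem_closed: "gen_elem x \<in> carrier A"
  unfolding gen_elem_def by (rule H.hom_closed[OF gen_closed])

text \<open>Each relation between the images of the generators is the image of a relation in the
  free algebra, because \<open>proj\<close> preserves sums and products.\<close>

lemma gen_elem_relation:
  assumes "(u, v) \<in> mackey_relations G A gen_elem"
  shows "u = v"
proof -
  note [simp] = gen_closed F.A.m_closed
  note defs = gen_elem_def
  have "\<exists>u' v'. (u', v') \<in> E \<and> u = proj u' \<and> v = proj v'"
    using assms
  proof (cases rule: mackey_relations.cases)
    case unit
    have "u = proj (\<Oplus>\<^bsub>F\<^esub>H\<in>{H. subgroup H G}. free_gen k X (Tr H H))"
      unfolding unit(1) defs by (subst H.hom_finsum) (auto simp: comp_def)
    moreover have "v = proj \<one>\<^bsub>F\<^esub>" using unit(2) by simp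
    ultimately show ?thesis using mackey_relations.unit[where G = G and A = F and e = "free_gen k X"] by blast
  next
    case (tr_res_id H)
    show ?thesis using mackey_relations.tr_res_id[where A = F and e = "free_gen k X", OF tr_res_id(3)] tr_res_id(1,2)
      by (auto simp: defs)
  next
    case (res_conj_id H h)
    show ?thesis using mackey_relations.res_conj_id[where A = F and e = "free_gen k X", OF res_conj_id(3,4)] res_conj_id(1,2)
      by (auto simp: defs)
  next
    case (tr_tr H K L)
    then have "u = proj (free_gen k X (Tr L K) \<otimes>\<^bsub>F\<^esub> free_gen k X (Tr K H))" "v = proj (free_gen k X (Tr L H))"
      by (simp_all add: defs H.hom_mult)
    then show ?thesis using mackey_relations.tr_tr[where A = F and e = "free_gen k X", OF tr_tr(3-7)] by blast
  next
    case (res_res H K L)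
    then have "u = proj (free_gen k X (Res K H) \<otimes>\<^bsub>F\<^esub> free_gen k X (Res L K))" "v = proj (free_gen k X (Res L H))"
      by (simp_all add: defs H.hom_mult)
    then show ?thesis using mackey_relations.res_res[where A = F and e = "free_gen k X", OF res_res(3-7)] by blast
  next
    case (conj_conj H g g')
    then have "u = proj (free_gen k X (Conj g' (conj_subgroup G g H)) \<otimes>\<^bsub>F\<^esub> free_gen k X (Conj g H))"
      "v = proj (free_gen k X (Conj (g' \<otimes>\<^bsub>G\<^esub> g) H))"
      by (simp_all add: defs H.hom_mult)
    then show ?thesis using mackey_relations.conj_conj[where A = F and e = "free_gen k X", OF conj_conj(3-5)] by blast
  next
    case (tr_conj H K g)
    then have "u = proj (free_gen k X (Tr (conj_subgroup G g K) (conj_subgroup G g H)) \<otimes>\<^bsub>F\<^esub> free_gen k X (Conj g H))"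
      "v = proj (free_gen k X (Conj g K) \<otimes>\<^bsub>F\<^esub> free_gen k X (Tr K H))"
      by (simp_all add: defs H.hom_mult)
    then show ?thesis using mackey_relations.tr_conj[where A = F and e = "free_gen k X", OF tr_conj(3-6)] by blast
  next
    case (res_conj H K g)
    then have "u = proj (free_gen k X (Res (conj_subgroup G g K) (conj_subgroup G g H)) \<otimes>\<^bsub>F\<^esub> free_gen k X (Conj g K))"
      "v = proj (free_gen k X (Conj g H) \<otimes>\<^bsub>F\<^esub> free_gen k X (Res K H))"
      by (simp_all add: defs H.hom_mult)
    then show ?thesis using mackey_relations.res_conj[where A = F and e = "free_gen k X", OF res_conj(3-6)] by blast
  next
    case (mackey H K L D)
    have u: "u = proj (free_gen k X (Res H L) \<otimes>\<^bsub>F\<^esub> free_gen k X (Tr H K))"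
      using mackey by (simp add: defs H.hom_mult)
    have v: "v = proj (\<Oplus>\<^bsub>F\<^esub>h\<in>D. free_gen k X (Tr L (L \<inter> conj_subgroup G h K))
        \<otimes>\<^bsub>F\<^esub> free_gen k X (Conj h (conj_subgroup G (inv\<^bsub>G\<^esub> h) L \<inter> K))
        \<otimes>\<^bsub>F\<^esub> free_gen k X (Res K (conj_subgroup G (inv\<^bsub>G\<^esub> h) L \<inter> K)))"
      unfolding mackey(2) defs by (subst H.hom_finsum) (auto simp: comp_def H.hom_mult)
    show ?thesis using mackey_relations.mackey[where A = F and e = "free_gen k X", OF mackey(3-8)] u v by blast
  next
    case (zero a b)
    then have "u = proj (free_gen k X a \<otimes>\<^bsub>F\<^esub> free_gen k X b)" "v = proj \<zero>\<^bsub>F\<^esub>"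
      by (simp_all add: defs H.hom_mult)
    then show ?thesis using mackey_relations.zero[where A = F and e = "free_gen k X", OF zero(3-5)] by blast
  qed
  then show ?thesis using proj_relation by blast
qed

interpretation M: mackey_algebra_rep G k A gen_elem
  by (intro mackey_algebra_rep.intro mackey_algebra_rep_axioms.intro G.group_axioms A_unital
      finite_group gen_elem_closed) (rule gen_elem_relation)

lemma word_elem_eq: "w \<in> W \<Longrightarrow> M.word_elem w = proj (wmon w)"
proof (induction w)
  case Nil
  then show ?case using H.hom_one by (simp add: M.word_elem_def k.free_algebra_ops(5)[of X])
next
  case (Cons a w)
  then have "proj (wmon (a # w)) = proj (wmon [a] \<otimes>\<^bsub>F\<^esub> wmon w)" by (simp add: mon_mult)
  also have "\<dots> = gen_elem a \<otimes>\<^bsub>A\<^esub> proj (wmon w)" by (simp add: gen_elem_def gen_eq H.hom_mult)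
  finally show ?case using Cons by (simp add: M.word_elem_def)
qed

lemma std_elem_eq:
  assumes "(K, L, g, H) \<in> G.std_index"
  shows "G.std_word K L g H \<in> W" "M.std_elem (K, L, g, H) = proj (wmon (G.std_word K L g H))"
proof -
  note J = G.std_indexD[OF assms]
  show W: "G.std_word K L g H \<in> W" using J by (simp add: G.std_word_def)
  have "wmon (G.std_word K L g H) = free_gen k X (Tr K L) \<otimes>\<^bsub>F\<^esub> free_gen k X (Conj g (conj_subgroup G (inv\<^bsub>G\<^esub> g) L))
      \<otimes>\<^bsub>F\<^esub> free_gen k X (Res H (conj_subgroup G (inv\<^bsub>G\<^esub> g) L))"
    using J by (simp add: gen_eq mon_mult G.std_word_def)
  then show "M.std_elem (K, L, g, H) = proj (wmon (G.std_word K L g H))"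
    by (simp add: M.std_elem_def gen_elem_def H.hom_mult gen_closed)
qed

lemma std_span_eq: "M.std_span = carrier A"
proof
  show "M.std_span \<subseteq> carrier A"
    using submodule.subset[OF M.std_span_submodule] .
  show "carrier A \<subseteq> M.std_span"
  proof
    fix x assume "x \<in> carrier A"
    then obtain f where f: "f \<in> carrier F" "x = proj f" by (auto simp: A_carrier)
    note f' = f(1)[unfolded F_carrier]
    let ?S = "{w \<in> W. f w \<noteq> \<zero>\<^bsub>k\<^esub>}"
    have fin: "finite ?S" using k.free_module_finite_support[OF f'] .
    have fc: "f w \<in> carrier k" if "w \<in> W" for w using k.free_module_closed[OF f' that] .
    have "f = (\<Oplus>\<^bsub>F\<^esub>w\<in>?S. f w \<odot>\<^bsub>F\<^esub> wmon w)"
      using k.free_module_decomp[OF f'] by (simp only: finsum_free_algebra k.free_algebra_ops(3))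
    then have "x = proj (\<Oplus>\<^bsub>F\<^esub>w\<in>?S. f w \<odot>\<^bsub>F\<^esub> wmon w)" using f(2) by (rule back_subst[of "\<lambda>f. x = proj f", rotated])
    also have "\<dots> = (\<Oplus>\<^bsub>A\<^esub>w\<in>?S. proj (f w \<odot>\<^bsub>F\<^esub> wmon w))"
      using fc by (subst H.hom_finsum) (auto simp: comp_def)
    also have "\<dots> \<in> M.std_span"
    proof (rule M.std_span_finsum[OF fin])
      fix w assume w: "w \<in> ?S"
      then have "proj (f w \<odot>\<^bsub>F\<^esub> wmon w) = f w \<odot>\<^bsub>A\<^esub> M.word_elem w"
        using fc by (simp add: proj_smult word_elem_eq)
      also have "\<dots> \<in> M.std_span"
        using w fc M.word_elem_in_span submodule.smult_closed[OF M.std_span_submodule] by simp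
      finally show "proj (f w \<odot>\<^bsub>F\<^esub> wmon w) \<in> M.std_span" .
    qed
    finally show "x \<in> M.std_span" .
  qed
qed

text \<open>This is the linear form that \<open>rho P x y\<close> induces on the quotient. It exists
  if \<open>P\<close> is a subgroup with fixed cosets \<open>x\<close> and \<open>y\<close>; for
  other arguments the choice is unspecified.\<close>

definition entry :: "'g set \<Rightarrow> 'g set \<Rightarrow> 'g set \<Rightarrow> ('g mackey_gen list \<Rightarrow> 'k) set \<Rightarrow> 'k" where
  "entry P x y = (SOME r. r \<in> module_hom k A (regular_module k) \<and> (\<forall>f\<in>carrier F. r (proj f) = rho P x y f))"

lemma entry:
  assumes "subgroup P G" "x \<in> fixed P" "y \<in> fixed P"
  shows "entry P x y \<in> module_hom k A (regular_module k)"
    and "f \<in> carrier F \<Longrightarrow> entry P x y (proj f) = rho P x y f"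
proof -
  obtain r where "r \<in> module_hom k A (regular_module k)" "\<And>f. f \<in> carrier F \<Longrightarrow> r (proj f) = rho P x y f"
    using F.quotient_linear_form[OF I_ideal rho_linear, of P x y] rho_ideal[OF _ assms] unfolding A_eq by blast
  then have "\<exists>r. r \<in> module_hom k A (regular_module k) \<and> (\<forall>f\<in>carrier F. r (proj f) = rho P x y f)" by blast
  from someI_ex[OF this]
  show "entry P x y \<in> module_hom k A (regular_module k)"
    and "f \<in> carrier F \<Longrightarrow> entry P x y (proj f) = rho P x y f"
    unfolding entry_def by blast+
qed

lemma entry_std_elem:
  assumes "subgroup P G" "x \<in> fixed P" "y \<in> fixed P" "(K, L, g, H) \<in> G.std_index"
  shows "entry P x y (M.std_elem (K, L, g, H)) = nat_emb k (G.wcount P (G.std_word K L g H) x y)"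
  using entry(2)[OF assms(1-3)] std_elem_eq[OF assms(4)] rho_mon by simp

text \<open>The linear extension of \<open>wtrace\<close> is a sum of diagonal entries
  \<open>rho P x x\<close>, each of which vanishes on \<open>I\<close>.\<close>

lemma trace_form:
  obtains t where "t \<in> module_hom k A (regular_module k)"
    and "\<And>f. f \<in> carrier F \<Longrightarrow> t (proj f) = k.lin_ext W (\<lambda>w. nat_emb k (G.wtrace w)) f"
proof -
  let ?t = "k.lin_ext W (\<lambda>w. nat_emb k (G.wtrace w))"
  have lin: "?t \<in> module_hom k F (regular_module k)"
    using k.lin_ext_closed[OF _ nat_emb_funcset] k.lin_ext_add[OF _ _ nat_emb_funcset] k.lin_ext_smult[OF _ _ nat_emb_funcset]
    by (intro module_hom_regularI) (simp_all add: k.free_algebra_ops)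
  have "?t f = \<zero>\<^bsub>k\<^esub>" if f: "f \<in> I" for f
  proof -
    have fF: "f \<in> carrier (free_module k W)" using ideal.Icarr[OF I_ideal f] F_carrier by simp
    have fs: "finite {P. subgroup P G}" by (rule G.finite_subgroups[OF finite_group])
    note ff = G.finite_fixed_cosets[OF finite_group]
    have "?t f = k.lin_ext W (\<lambda>w. \<Oplus>\<^bsub>k\<^esub>P\<in>{P. subgroup P G}. \<Oplus>\<^bsub>k\<^esub>x\<in>fixed P. nat_emb k (G.wcount P w x x)) f"
      unfolding G.wtrace_def using fs ff by (simp add: k.nat_emb_sum)
    also have "\<dots> = (\<Oplus>\<^bsub>k\<^esub>P\<in>{P. subgroup P G}. k.lin_ext W (\<lambda>w. \<Oplus>\<^bsub>k\<^esub>x\<in>fixed P. nat_emb k (G.wcount P w x x)) f)"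
      using fs by (intro k.lin_ext_fun_finsum[OF fF]) (auto intro!: k.finsum_closed)
    also have "\<dots> = (\<Oplus>\<^bsub>k\<^esub>P\<in>{P. subgroup P G}. \<Oplus>\<^bsub>k\<^esub>x\<in>fixed P. rho P x x f)"
    proof (intro k.finsum_cong' refl)
      fix P
      show "k.lin_ext W (\<lambda>w. \<Oplus>\<^bsub>k\<^esub>x\<in>fixed P. nat_emb k (G.wcount P w x x)) f = (\<Oplus>\<^bsub>k\<^esub>x\<in>fixed P. rho P x x f)"
        unfolding rho_def using ff by (intro k.lin_ext_fun_finsum[OF fF]) auto
    qed (use rhoD(1) ideal.Icarr[OF I_ideal f] in \<open>auto intro!: k.finsum_closed\<close>)
    also have "\<dots> = \<zero>\<^bsub>k\<^esub>"
      using rho_ideal[OF f] by (intro k.finsum_eq_zeroI) auto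
    finally show ?thesis .
  qed
  from F.quotient_linear_form[OF I_ideal lin this] that show thesis unfolding A_eq by blast
qed

section \<open>Recovering an element of the algebra from its matrix entries\<close>

lemma nat_emb_card_subgroup:
  assumes "subgroup H G" shows "nat_emb k (card H) \<noteq> \<zero>\<^bsub>k\<^esub>"
  using G.lagrange_finite[OF finite_group assms] by (intro order_invertible) (metis dvd_triv_right)

abbreviation index_upto :: "nat \<Rightarrow> ('g set \<times> 'g set \<times> 'g \<times> 'g set) set" where
  "index_upto n \<equiv> {q \<in> G.std_index. card (fst (snd q)) \<le> n}"

text \<open>An element of the span of the standard elements with \<open>card L \<le> n\<close> differs from its
  ``top part'', read off from the entries at \<open>(L, K, g H)\<close> with \<open>card L = n\<close>, by standard elements
  with \<open>card L < n\<close>.\<close>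

definition top_coeff :: "'g set \<times> 'g set \<times> 'g \<times> 'g set \<Rightarrow> 'k" where
  "top_coeff = (\<lambda>(K, L, g, H). nat_emb k (card L) \<otimes>\<^bsub>k\<^esub> inv\<^bsub>k\<^esub> (nat_emb k (card K * card H)))"

definition top_entry :: "'g set \<times> 'g set \<times> 'g \<times> 'g set \<Rightarrow> ('g mackey_gen list \<Rightarrow> 'k) set \<Rightarrow> 'k" where
  "top_entry = (\<lambda>(K, L, g, H) x. entry L K (g <#\<^bsub>G\<^esub> H) x)"

definition top_part :: "nat \<Rightarrow> ('g mackey_gen list \<Rightarrow> 'k) set \<Rightarrow> ('g mackey_gen list \<Rightarrow> 'k) set" where
  "top_part n x = (\<Oplus>\<^bsub>A\<^esub>q\<in>{q \<in> G.std_index. card (fst (snd q)) = n}.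
     (top_coeff q \<otimes>\<^bsub>k\<^esub> top_entry q x) \<odot>\<^bsub>A\<^esub> M.std_elem q)"

lemma card_prod_unit:
  assumes "subgroup K G" "subgroup H G"
  shows "nat_emb k (card K * card H) \<in> Units k"
  using nat_emb_card_subgroup[OF assms(1)] nat_emb_card_subgroup[OF assms(2)]
  by (simp add: k.field_Units k.nat_emb_mult k.integral_iff)

lemma top_coeff_closed: "q \<in> G.std_index \<Longrightarrow> top_coeff q \<in> carrier k"
proof -
  assume q: "q \<in> G.std_index"
  obtain K L g H where qq: "q = (K, L, g, H)" by (cases q)
  show ?thesis
    using card_prod_unit[OF G.std_indexD(1,3)[OF q[unfolded qq]]] by (simp add: top_coeff_def qq)
qed

lemma top_entry_linear:
  assumes "q \<in> G.std_index" shows "top_entry q \<in> module_hom k A (regular_module k)"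
proof -
  obtain K L g H where q: "q = (K, L, g, H)" by (cases q)
  note idx = assms[unfolded q]
  have "top_entry q = entry L K (g <#\<^bsub>G\<^esub> H)" by (simp add: top_entry_def q)
  then show ?thesis using entry(1)[OF G.std_indexD(2)[OF idx] G.std_fixed[OF finite_group idx]] by simp
qed

lemmas top_entryD = module_hom_regularD[OF top_entry_linear]

lemma finite_index: "finite {q \<in> G.std_index. Q q}"
  using G.finite_std_index[OF finite_group] by simp

lemma top_part_closed: "x \<in> carrier A \<Longrightarrow> top_part n x \<in> carrier A"
  unfolding top_part_def using top_coeff_closed top_entryD(1) M.std_elem_closed
  by (intro A.M.finsum_closed) auto

lemma top_part_add:
  assumes "x \<in> carrier A" "y \<in> carrier A"
  shows "top_part n (x \<oplus>\<^bsub>A\<^esub> y) = top_part n x \<oplus>\<^bsub>A\<^esub> top_part n y"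
proof -
  have "top_part n (x \<oplus>\<^bsub>A\<^esub> y) = (\<Oplus>\<^bsub>A\<^esub>q\<in>{q \<in> G.std_index. card (fst (snd q)) = n}.
      (top_coeff q \<otimes>\<^bsub>k\<^esub> top_entry q x) \<odot>\<^bsub>A\<^esub> M.std_elem q \<oplus>\<^bsub>A\<^esub> (top_coeff q \<otimes>\<^bsub>k\<^esub> top_entry q y) \<odot>\<^bsub>A\<^esub> M.std_elem q)"
    unfolding top_part_def using assms top_coeff_closed top_entryD M.std_elem_closed
    by (intro A.M.finsum_cong') (auto simp: k.r_distr A.smult_l_distr)
  also have "\<dots> = top_part n x \<oplus>\<^bsub>A\<^esub> top_part n y"
    unfolding top_part_def using assms top_coeff_closed top_entryD M.std_elem_closed
    by (intro A.M.finsum_addf) auto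
  finally show ?thesis .
qed

lemma top_part_smult:
  assumes "a \<in> carrier k" "x \<in> carrier A"
  shows "top_part n (a \<odot>\<^bsub>A\<^esub> x) = a \<odot>\<^bsub>A\<^esub> top_part n x"
proof -
  have "top_part n (a \<odot>\<^bsub>A\<^esub> x) = (\<Oplus>\<^bsub>A\<^esub>q\<in>{q \<in> G.std_index. card (fst (snd q)) = n}.
      a \<odot>\<^bsub>A\<^esub> ((top_coeff q \<otimes>\<^bsub>k\<^esub> top_entry q x) \<odot>\<^bsub>A\<^esub> M.std_elem q))"
    unfolding top_part_def using assms top_coeff_closed top_entryD M.std_elem_closed
    by (intro A.M.finsum_cong') (auto simp: k.m_lcomm simp flip: A.smult_assoc1)
  also have "\<dots> = a \<odot>\<^bsub>A\<^esub> top_part n x"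
    unfolding top_part_def using assms top_coeff_closed top_entryD M.std_elem_closed finite_index
    by (intro A.finsum_smult_ldistr[symmetric]) auto
  finally show ?thesis .
qed

text \<open>All entries that \<open>top_part n\<close> reads off are at subgroups of order
  \<open>n\<close>, which are too large to fit into a conjugate of \<open>L0\<close>.\<close>

lemma top_part_std_elem_less:
  assumes q0: "(K0, L0, g0, H0) \<in> G.std_index" and less: "card L0 < n"
  shows "top_part n (M.std_elem (K0, L0, g0, H0)) = \<zero>\<^bsub>A\<^esub>"
  unfolding top_part_def
proof (rule A.M.finsum_eq_zeroI)
  fix q assume q: "q \<in> {q \<in> G.std_index. card (fst (snd q)) = n}"
  obtain K L g H where qq: "q = (K, L, g, H)" by (cases q)
  then have idx: "(K, L, g, H) \<in> G.std_index" and c: "card L = n" using q by auto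
  have "G.wcount L (G.std_word K0 L0 g0 H0) K (g <#\<^bsub>G\<^esub> H) = 0"
    using G.wcount_std_std_nonzeroD(1)[OF finite_group q0 idx] c less by fastforce
  then have "top_entry q (M.std_elem (K0, L0, g0, H0)) = \<zero>\<^bsub>k\<^esub>"
    using entry_std_elem[OF G.std_indexD(2)[OF idx] G.std_fixed[OF finite_group idx] q0]
    by (simp add: top_entry_def qq)
  then show "(top_coeff q \<otimes>\<^bsub>k\<^esub> top_entry q (M.std_elem (K0, L0, g0, H0))) \<odot>\<^bsub>A\<^esub> M.std_elem q = \<zero>\<^bsub>A\<^esub>"
    using q top_coeff_closed M.std_elem_closed by simp
qed

text \<open>Only indices of the same standard element have a nonzero entry, and they share the same
  coefficient. By \<open>sum_wcount_std_std\<close> their entries add up to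
  \<open>card K0 * card H0\<close> divided by \<open>card L0\<close>, which the coefficient
  normalizes to 1.\<close>

lemma top_part_std_elem_eq:
  assumes q0: "(K0, L0, g0, H0) \<in> G.std_index"
  shows "top_part (card L0) (M.std_elem (K0, L0, g0, H0)) = M.std_elem (K0, L0, g0, H0)"
proof -
  note I0 = G.std_indexD[OF q0]
  let ?q0 = "(K0, L0, g0, H0)"
  let ?Q = "{q \<in> G.std_index. card (fst (snd q)) = card L0}"
  let ?n = "\<lambda>(K, L, g, H). G.wcount L (G.std_word K0 L0 g0 H0) K (g <#\<^bsub>G\<^esub> H)"
  have s: "M.std_elem ?q0 \<in> carrier A" and c0: "top_coeff ?q0 \<in> carrier k"
    using M.std_elem_closed[OF q0] top_coeff_closed[OF q0] by auto
  have "top_part (card L0) (M.std_elem ?q0)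
      = (\<Oplus>\<^bsub>A\<^esub>q\<in>?Q. (top_coeff ?q0 \<otimes>\<^bsub>k\<^esub> nat_emb k (?n q)) \<odot>\<^bsub>A\<^esub> M.std_elem ?q0)"
    unfolding top_part_def
  proof (intro A.M.finsum_cong' refl)
    fix q assume q: "q \<in> ?Q"
    obtain K L g H where qq: "q = (K, L, g, H)" by (cases q)
    then have idx: "(K, L, g, H) \<in> G.std_index" and c: "card L = card L0" using q by auto
    have ent: "top_entry q (M.std_elem ?q0) = nat_emb k (?n q)"
      using entry_std_elem[OF G.std_indexD(2)[OF idx] G.std_fixed[OF finite_group idx] q0]
      by (simp add: top_entry_def qq)
    show "(top_coeff q \<otimes>\<^bsub>k\<^esub> top_entry q (M.std_elem ?q0)) \<odot>\<^bsub>A\<^esub> M.std_elem q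
        = (top_coeff ?q0 \<otimes>\<^bsub>k\<^esub> nat_emb k (?n q)) \<odot>\<^bsub>A\<^esub> M.std_elem ?q0"
    proof (cases "?n q = 0")
      case True
      then show ?thesis using ent q s c0 top_coeff_closed M.std_elem_closed by simp
    next
      case False
      then have "G.wcount L (G.std_word K0 L0 g0 H0) K (g <#\<^bsub>G\<^esub> H) \<noteq> 0" by (simp add: qq)
      from G.wcount_std_std_nonzeroD(2)[OF finite_group q0 idx this c]
      obtain a b where KH: "K = K0" "H = H0" and ab: "a \<in> K0" "b \<in> H0"
        and L: "L = conj_subgroup G a L0" "g = a \<otimes>\<^bsub>G\<^esub> g0 \<otimes>\<^bsub>G\<^esub> b" by blast
      have "M.std_elem q = M.std_elem ?q0"
        unfolding qq KH L by (rule M.std_elem_conj[OF q0 ab])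
      moreover have "top_coeff q = top_coeff ?q0" using c KH by (simp add: top_coeff_def qq)
      ultimately show ?thesis using ent by simp
    qed
  qed (use s c0 in auto)
  also have "\<dots> = (\<Oplus>\<^bsub>k\<^esub>q\<in>?Q. top_coeff ?q0 \<otimes>\<^bsub>k\<^esub> nat_emb k (?n q)) \<odot>\<^bsub>A\<^esub> M.std_elem ?q0"
    using s c0 by (intro A.finsum_smult_r[symmetric]) auto
  also have "(\<Oplus>\<^bsub>k\<^esub>q\<in>?Q. top_coeff ?q0 \<otimes>\<^bsub>k\<^esub> nat_emb k (?n q)) = top_coeff ?q0 \<otimes>\<^bsub>k\<^esub> nat_emb k (\<Sum>q\<in>?Q. ?n q)"
    using c0 finite_index by (simp add: k.nat_emb_sum k.finsum_rdistr)
  also have "\<dots> = \<one>\<^bsub>k\<^esub>"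
  proof -
    have "nat_emb k (card L0) \<otimes>\<^bsub>k\<^esub> nat_emb k (\<Sum>q\<in>?Q. ?n q) = nat_emb k (card K0 * card H0)"
      using G.sum_wcount_std_std[OF finite_group q0] by (simp flip: k.nat_emb_mult)
    moreover have "top_coeff ?q0 \<otimes>\<^bsub>k\<^esub> nat_emb k (\<Sum>q\<in>?Q. ?n q)
        = inv\<^bsub>k\<^esub> (nat_emb k (card K0 * card H0)) \<otimes>\<^bsub>k\<^esub> (nat_emb k (card L0) \<otimes>\<^bsub>k\<^esub> nat_emb k (\<Sum>q\<in>?Q. ?n q))"
      unfolding top_coeff_def prod.case
      using card_prod_unit[OF I0(1,3)] by (simp only: k.m_ac k.nat_emb_closed k.Units_inv_closed k.m_closed)
    ultimately show ?thesis using card_prod_unit[OF I0(1,3)] by simp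
  qed
  finally show ?thesis using s by simp
qed

text \<open>\<open>top_part\<close> is linear, so the elements with such a decomposition form a
  submodule, and it suffices to treat standard elements. The remainder is zero for those of order
  \<open>Suc n\<close> and the element itself for the smaller ones. No independence of the standard
  elements enters.\<close>

lemma top_part_decomposition:
  assumes "x \<in> A.span (M.std_elem ` index_upto (Suc n))"
  shows "\<exists>z \<in> A.span (M.std_elem ` index_upto n). x = top_part (Suc n) x \<oplus>\<^bsub>A\<^esub> z"
proof -
  let ?S = "A.span (M.std_elem ` index_upto n)"
  let ?N = "{x \<in> carrier A. \<exists>z\<in>?S. x = top_part (Suc n) x \<oplus>\<^bsub>A\<^esub> z}"
  have car: "M.std_elem ` index_upto n \<subseteq> carrier A" using M.std_elem_closed by auto
  have S: "LinearCombinations.submodule k ?S A" by (rule A.span_is_submodule[OF car])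
  note Sc = subsetD[OF submodule.subset[OF S]]
  have N: "LinearCombinations.submodule k ?N A"
  proof (rule submodule.intro[OF A.module_axioms])
    fix x y assume "x \<in> ?N" "y \<in> ?N"
    then obtain z w where x: "x \<in> carrier A" "z \<in> ?S" "x = top_part (Suc n) x \<oplus>\<^bsub>A\<^esub> z"
      and y: "y \<in> carrier A" "w \<in> ?S" "y = top_part (Suc n) y \<oplus>\<^bsub>A\<^esub> w" by blast
    have "x \<oplus>\<^bsub>A\<^esub> y = (top_part (Suc n) x \<oplus>\<^bsub>A\<^esub> z) \<oplus>\<^bsub>A\<^esub> (top_part (Suc n) y \<oplus>\<^bsub>A\<^esub> w)"
      using x(3) y(3) by simp
    also have "\<dots> = top_part (Suc n) (x \<oplus>\<^bsub>A\<^esub> y) \<oplus>\<^bsub>A\<^esub> (z \<oplus>\<^bsub>A\<^esub> w)"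
      using x(1,2) y(1,2) Sc by (simp add: top_part_add top_part_closed A.M.a_ac)
    finally show "x \<oplus>\<^bsub>A\<^esub> y \<in> ?N"
      using x(1,2) y(1,2) submodule.m_closed[OF S] by blast
  next
    fix a x assume a: "a \<in> carrier k" and "x \<in> ?N"
    then obtain z where x: "x \<in> carrier A" "z \<in> ?S" "x = top_part (Suc n) x \<oplus>\<^bsub>A\<^esub> z" by blast
    have "a \<odot>\<^bsub>A\<^esub> x = a \<odot>\<^bsub>A\<^esub> (top_part (Suc n) x \<oplus>\<^bsub>A\<^esub> z)" using x(3) by simp
    also have "\<dots> = top_part (Suc n) (a \<odot>\<^bsub>A\<^esub> x) \<oplus>\<^bsub>A\<^esub> a \<odot>\<^bsub>A\<^esub> z"
      using a x(1,2) Sc by (simp add: top_part_smult top_part_closed A.smult_r_distr)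
    finally show "a \<odot>\<^bsub>A\<^esub> x \<in> ?N"
      using a x(1,2) submodule.smult_closed[OF S] by blast
  next
    have "top_part (Suc n) (\<zero>\<^bsub>k\<^esub> \<odot>\<^bsub>A\<^esub> \<zero>\<^bsub>A\<^esub>) = \<zero>\<^bsub>k\<^esub> \<odot>\<^bsub>A\<^esub> top_part (Suc n) \<zero>\<^bsub>A\<^esub>"
      by (rule top_part_smult) auto
    then have "top_part (Suc n) \<zero>\<^bsub>A\<^esub> = \<zero>\<^bsub>A\<^esub>" using top_part_closed[OF A.M.zero_closed] by simp
    then have "\<zero>\<^bsub>A\<^esub> = top_part (Suc n) \<zero>\<^bsub>A\<^esub> \<oplus>\<^bsub>A\<^esub> \<zero>\<^bsub>A\<^esub>" by simp
    then show "\<zero>\<^bsub>A\<^esub> \<in> ?N" using submodule.zero_closed[OF S] by blast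
  qed auto
  have "M.std_elem q \<in> ?N" if q: "q \<in> index_upto (Suc n)" for q
  proof -
    obtain K L g H where qq: "q = (K, L, g, H)" by (cases q)
    then have idx: "(K, L, g, H) \<in> G.std_index" and c: "card L \<le> Suc n" using q by auto
    have s: "M.std_elem q \<in> carrier A" using M.std_elem_closed[OF idx] qq by simp
    show ?thesis
    proof (cases "card L = Suc n")
      case True
      then have "M.std_elem q = top_part (Suc n) (M.std_elem q) \<oplus>\<^bsub>A\<^esub> \<zero>\<^bsub>A\<^esub>"
        using top_part_std_elem_eq[OF idx] s by (simp add: qq)
      then show ?thesis using s submodule.zero_closed[OF S] by blast
    next
      case False
      then have "M.std_elem q = top_part (Suc n) (M.std_elem q) \<oplus>\<^bsub>A\<^esub> M.std_elem q"
        using top_part_std_elem_less[OF idx, of "Suc n"] c s by (simp add: qq)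
      moreover have "M.std_elem q \<in> ?S" using A.in_own_span[OF car] q qq c False by auto
      ultimately show ?thesis using s by blast
    qed
  qed
  then have "A.span (M.std_elem ` index_upto (Suc n)) \<subseteq> ?N"
    by (intro A.span_is_subset[OF _ N]) blast
  then show ?thesis using assms by blast
qed

text \<open>If all entries vanish, so do all top parts, and \<open>top_part_decomposition\<close>
  pushes \<open>x\<close> down the filtration by the order of the middle group. At order 0 the
  filtration is trivial, as a subgroup has at least one element.\<close>

lemma entries_separate:
  assumes x: "x \<in> carrier A"
    and 0: "\<And>P u v. subgroup P G \<Longrightarrow> u \<in> fixed P \<Longrightarrow> v \<in> fixed P \<Longrightarrow> entry P u v x = \<zero>\<^bsub>k\<^esub>"
  shows "x = \<zero>\<^bsub>A\<^esub>"
proof -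
  have "top_part n x = \<zero>\<^bsub>A\<^esub>" for n
    unfolding top_part_def
  proof (rule A.M.finsum_eq_zeroI)
    fix q assume q: "q \<in> {q \<in> G.std_index. card (fst (snd q)) = n}"
    obtain K L g H where qq: "q = (K, L, g, H)" by (cases q)
    then have idx: "(K, L, g, H) \<in> G.std_index" using q by auto
    have "top_entry q x = \<zero>\<^bsub>k\<^esub>"
      using 0[OF G.std_indexD(2)[OF idx] G.std_fixed[OF finite_group idx]] by (simp add: top_entry_def qq)
    then show "(top_coeff q \<otimes>\<^bsub>k\<^esub> top_entry q x) \<odot>\<^bsub>A\<^esub> M.std_elem q = \<zero>\<^bsub>A\<^esub>"
      using q top_coeff_closed M.std_elem_closed by simp
  qed
  then have step: "x \<in> A.span (M.std_elem ` index_upto n)" if xs: "x \<in> A.span (M.std_elem ` index_upto (Suc n))" for n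
  proof -
    obtain z where z: "z \<in> A.span (M.std_elem ` index_upto n)" "x = top_part (Suc n) x \<oplus>\<^bsub>A\<^esub> z"
      using top_part_decomposition[OF xs] by blast
    have "z \<in> carrier A"
      using z(1) A.span_is_subset2[of "M.std_elem ` index_upto n"] M.std_elem_closed by blast
    then show ?thesis using z \<open>\<And>n. top_part n x = \<zero>\<^bsub>A\<^esub>\<close> by simp
  qed
  have "x \<in> A.span (M.std_elem ` index_upto n) \<Longrightarrow> x \<in> A.span (M.std_elem ` index_upto 0)" for n
    by (induction n) (use step in blast)+
  then have "x \<in> A.span (M.std_elem ` index_upto 0)" if "x \<in> A.span (M.std_elem ` index_upto (card (carrier G)))"
    using that .
  moreover have "index_upto (card (carrier G)) = G.std_index"
    using card_mono[OF finite_group subgroup.subset] G.std_indexD(2) by fastforce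
  ultimately have "x \<in> A.span (M.std_elem ` index_upto 0)"
    using x std_span_eq by (simp only:)
  moreover have "index_upto 0 = {}"
    using G.card_subgroup_pos[OF finite_group] G.std_indexD(2) by fastforce
  moreover have "A.span {} = {\<zero>\<^bsub>A\<^esub>}"
    using A.finite_span[of "{}"] by (simp add: A.lincomb_def)
  ultimately show ?thesis by (simp only: image_empty singleton_iff)
qed

section \<open>Nondegeneracy and symmetry of the trace form\<close>

lemma rho_l_coset:
  assumes f: "f \<in> carrier F" and "subgroup P G" "g \<in> carrier G" "x \<subseteq> carrier G" "y \<subseteq> carrier G"
  shows "rho (conj_subgroup G g P) (g <#\<^bsub>G\<^esub> x) (g <#\<^bsub>G\<^esub> y) f = rho P x y f"
  unfolding rho_def using assms G.wcount_l_coset[of _ P g x y]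
  by (intro k.lin_ext_cong) (auto simp: F_carrier subgroup.subset)

text \<open>This is the trace of a product of two matrices, summed over all \<open>P\<close>, with
  the left factor an arbitrary element and the right factor a word. Words suffice on the right
  because the dual elements used for testing are standard words.\<close>

lemma trace_product:
  assumes f: "f \<in> carrier F" and v: "v \<in> W"
  shows "k.lin_ext W (\<lambda>w. nat_emb k (G.wtrace w)) (f \<otimes>\<^bsub>F\<^esub> wmon v)
    = (\<Oplus>\<^bsub>k\<^esub>P\<in>{P. subgroup P G}. \<Oplus>\<^bsub>k\<^esub>x\<in>fixed P. \<Oplus>\<^bsub>k\<^esub>y\<in>fixed P. rho P x y f \<otimes>\<^bsub>k\<^esub> nat_emb k (G.wcount P v y x))"
proof -
  have fF: "f \<in> carrier (free_module k W)" using f F_carrier by simp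
  have fs: "finite {P. subgroup P G}" by (rule G.finite_subgroups[OF finite_group])
  note ff = G.finite_fixed_cosets[OF finite_group]
  let ?h = "\<lambda>P x y u. nat_emb k (G.wcount P v y x) \<otimes>\<^bsub>k\<^esub> nat_emb k (G.wcount P u x y)"
  have "k.lin_ext W (\<lambda>w. nat_emb k (G.wtrace w)) (f \<otimes>\<^bsub>F\<^esub> wmon v)
      = k.lin_ext W (\<lambda>u. k.lin_ext W (\<lambda>v. nat_emb k (G.wtrace (u @ v))) (wmon v)) f"
    by (rule k.lin_ext_mult[OF f mon_closed nat_emb_funcset])
  also have "\<dots> = k.lin_ext W (\<lambda>u. \<Oplus>\<^bsub>k\<^esub>P\<in>{P. subgroup P G}. \<Oplus>\<^bsub>k\<^esub>x\<in>fixed P. \<Oplus>\<^bsub>k\<^esub>y\<in>fixed P. ?h P x y u) f"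
  proof (rule k.lin_ext_cong[OF _ _ fF])
    fix u
    have "k.lin_ext W (\<lambda>v. nat_emb k (G.wtrace (u @ v))) (wmon v) = nat_emb k (G.wtrace (u @ v))"
      by (rule k.lin_ext_monomial[OF v nat_emb_funcset])
    also have "\<dots> = (\<Oplus>\<^bsub>k\<^esub>P\<in>{P. subgroup P G}. \<Oplus>\<^bsub>k\<^esub>x\<in>fixed P. \<Oplus>\<^bsub>k\<^esub>y\<in>fixed P. ?h P x y u)"
      unfolding G.wtrace_append[OF finite_group] using fs ff
      by (simp add: k.nat_emb_sum k.nat_emb_mult k.m_comm)
    finally show "k.lin_ext W (\<lambda>v. nat_emb k (G.wtrace (u @ v))) (wmon v)
      = (\<Oplus>\<^bsub>k\<^esub>P\<in>{P. subgroup P G}. \<Oplus>\<^bsub>k\<^esub>x\<in>fixed P. \<Oplus>\<^bsub>k\<^esub>y\<in>fixed P. ?h P x y u)" .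
  qed (auto intro!: k.finsum_closed)
  also have "\<dots> = (\<Oplus>\<^bsub>k\<^esub>P\<in>{P. subgroup P G}. k.lin_ext W (\<lambda>u. \<Oplus>\<^bsub>k\<^esub>x\<in>fixed P. \<Oplus>\<^bsub>k\<^esub>y\<in>fixed P. ?h P x y u) f)"
    by (intro k.lin_ext_fun_finsum[OF fF fs]) (auto intro!: k.finsum_closed)
  also have "\<dots> = (\<Oplus>\<^bsub>k\<^esub>P\<in>{P. subgroup P G}. \<Oplus>\<^bsub>k\<^esub>x\<in>fixed P. \<Oplus>\<^bsub>k\<^esub>y\<in>fixed P. rho P x y f \<otimes>\<^bsub>k\<^esub> nat_emb k (G.wcount P v y x))"
  proof (intro k.finsum_cong' refl)
    fix P
    have "k.lin_ext W (\<lambda>u. \<Oplus>\<^bsub>k\<^esub>x\<in>fixed P. \<Oplus>\<^bsub>k\<^esub>y\<in>fixed P. ?h P x y u) f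
        = (\<Oplus>\<^bsub>k\<^esub>x\<in>fixed P. k.lin_ext W (\<lambda>u. \<Oplus>\<^bsub>k\<^esub>y\<in>fixed P. ?h P x y u) f)"
      by (intro k.lin_ext_fun_finsum[OF fF ff]) (auto intro!: k.finsum_closed)
    also have "\<dots> = (\<Oplus>\<^bsub>k\<^esub>x\<in>fixed P. \<Oplus>\<^bsub>k\<^esub>y\<in>fixed P. rho P x y f \<otimes>\<^bsub>k\<^esub> nat_emb k (G.wcount P v y x))"
    proof (intro k.finsum_cong' refl)
      fix x
      have "k.lin_ext W (\<lambda>u. \<Oplus>\<^bsub>k\<^esub>y\<in>fixed P. ?h P x y u) f = (\<Oplus>\<^bsub>k\<^esub>y\<in>fixed P. k.lin_ext W (?h P x y) f)"
        by (intro k.lin_ext_fun_finsum[OF fF ff]) auto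
      also have "\<dots> = (\<Oplus>\<^bsub>k\<^esub>y\<in>fixed P. rho P x y f \<otimes>\<^bsub>k\<^esub> nat_emb k (G.wcount P v y x))"
      proof (intro k.finsum_cong' refl)
        fix y
        have "k.lin_ext W (?h P x y) f = nat_emb k (G.wcount P v y x) \<otimes>\<^bsub>k\<^esub> rho P x y f"
          unfolding rho_def by (rule k.lin_ext_fun_smult[OF fF nat_emb_funcset]) simp
        then show "k.lin_ext W (?h P x y) f = rho P x y f \<otimes>\<^bsub>k\<^esub> nat_emb k (G.wcount P v y x)"
          using rhoD(1)[OF f] by (simp add: k.m_comm)
      qed (use rhoD(1)[OF f] in auto)
      finally show "k.lin_ext W (\<lambda>u. \<Oplus>\<^bsub>k\<^esub>y\<in>fixed P. ?h P x y u) f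
          = (\<Oplus>\<^bsub>k\<^esub>y\<in>fixed P. rho P x y f \<otimes>\<^bsub>k\<^esub> nat_emb k (G.wcount P v y x))" .
    qed (use rhoD(1)[OF f] in \<open>auto intro!: k.finsum_closed\<close>)
    finally show "k.lin_ext W (\<lambda>u. \<Oplus>\<^bsub>k\<^esub>x\<in>fixed P. \<Oplus>\<^bsub>k\<^esub>y\<in>fixed P. ?h P x y u) f
        = (\<Oplus>\<^bsub>k\<^esub>x\<in>fixed P. \<Oplus>\<^bsub>k\<^esub>y\<in>fixed P. rho P x y f \<otimes>\<^bsub>k\<^esub> nat_emb k (G.wcount P v y x))" .
  qed (use rhoD(1)[OF f] in \<open>auto intro!: k.finsum_closed\<close>)
  finally show ?thesis .
qed


text \<open>Multiplication by a dual standard word isolates the entries on one orbit of left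
  translation, apart from entries at smaller subgroups. The entries on the orbit coincide, so the
  trace becomes a single entry times a natural number that divides the order of G.\<close>

lemma trace_separates_entries:
  assumes f: "f \<in> carrier F"
    and 0: "\<And>v. v \<in> W \<Longrightarrow> k.lin_ext W (\<lambda>w. nat_emb k (G.wtrace w)) (f \<otimes>\<^bsub>F\<^esub> wmon v) = \<zero>\<^bsub>k\<^esub>"
    and "subgroup P G" "x \<in> fixed P" "y \<in> fixed P"
  shows "rho P x y f = \<zero>\<^bsub>k\<^esub>"
  using assms(3-5)
proof (induction "card P" arbitrary: P x y rule: less_induct)
  case less
  note P = less.prems(1)
  note Pc = subgroup.subset[OF P]
  obtain K where K: "subgroup K G" "x \<in> G.lcos K" using less.prems(2) by (auto simp: G.fixed_cosets_def)
  obtain H where H: "subgroup H G" "y \<in> G.lcos H" using less.prems(3) by (auto simp: G.fixed_cosets_def)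
  obtain a where a: "a \<in> carrier G" "x = a <#\<^bsub>G\<^esub> K" using K(2) by (auto simp: G.lcos_def)
  obtain c where c: "c \<in> carrier G" "y = c <#\<^bsub>G\<^esub> H" using H(2) by (auto simp: G.lcos_def)
  have ai: "inv\<^bsub>G\<^esub> a \<in> carrier G" using a(1) by simp
  \<comment> \<open>Left translation by the inverse of \<open>a\<close> moves \<open>x\<close> to
    the subgroup \<open>K\<close> itself and \<open>y\<close> to bH, the position for which the dual
    index is defined.\<close>
  define P1 where "P1 = conj_subgroup G (inv\<^bsub>G\<^esub> a) P"
  define b where "b = inv\<^bsub>G\<^esub> a \<otimes>\<^bsub>G\<^esub> c"
  have b: "b \<in> carrier G" using a(1) c(1) by (simp add: b_def)
  have P1: "subgroup P1 G" unfolding P1_def by (rule G.conj_subgroup_is_subgroup[OF P ai])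
  have cP1: "card P1 = card P" unfolding P1_def by (rule G.card_conj_subgroup[OF Pc ai])
  have "P \<subseteq> conj_subgroup G a K"
    using less.prems(2) G.l_coset_fixed[OF Pc K(1) a(1)] a(2) by simp
  then have P1K: "P1 \<subseteq> K"
    using G.conj_subgroup_mono[of P "conj_subgroup G a K" "inv\<^bsub>G\<^esub> a"] a(1) K(1)
    by (simp add: P1_def G.conj_subgroup_closed G.conj_subgroup_cancel subgroup.subset)
  have "P \<subseteq> conj_subgroup G c H"
    using less.prems(3) G.l_coset_fixed[OF Pc H(1) c(1)] c(2) by simp
  then have P1H: "P1 \<subseteq> conj_subgroup G b H"
    using G.conj_subgroup_mono[of P "conj_subgroup G c H" "inv\<^bsub>G\<^esub> a"] a(1) c(1) H(1)
    by (simp add: P1_def b_def G.conj_subgroup_closed G.conj_subgroup_conj subgroup.subset)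
  let ?r = "rho P x y f"
  have r: "rho P1 K (b <#\<^bsub>G\<^esub> H) f = ?r"
  proof -
    have "inv\<^bsub>G\<^esub> a <#\<^bsub>G\<^esub> x = K"
      using a K(1) by (simp add: G.l_coset_image_cancel subgroup.subset)
    moreover have "inv\<^bsub>G\<^esub> a <#\<^bsub>G\<^esub> y = b <#\<^bsub>G\<^esub> H"
      using c a(1) H(1) by (simp add: b_def G.lcos_m_assoc subgroup.subset)
    ultimately show ?thesis
      using rho_l_coset[OF f P ai G.fixed_cosets_subset[OF less.prems(2)] G.fixed_cosets_subset[OF less.prems(3)]]
      by (simp add: P1_def)
  qed
  have rc: "?r \<in> carrier k" using rhoD(1)[OF f] .
  let ?v = "G.std_word H (conj_subgroup G (inv\<^bsub>G\<^esub> b) P1) (inv\<^bsub>G\<^esub> b) K"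
  note dual = K(1) H(1) P1 b P1K P1H
  have v: "?v \<in> W" by (rule std_elem_eq(1)[OF G.dual_index[OF finite_group dual]])
  \<comment> \<open>Subgroups smaller than \<open>P1\<close> drop out because \<open>f\<close> has
    zero entries there by induction, larger ones because the dual word has none there. Only
    subgroups of the same order are kept.\<close>
  let ?n = "\<lambda>P' x' y'. if card P' = card P1 then G.wcount P' ?v y' x' else 0"
  let ?S = "{P'. subgroup P' G}"
  have fs: "finite ?S" by (rule G.finite_subgroups[OF finite_group])
  note ff = G.finite_fixed_cosets[OF finite_group]
  have summand: "rho P' x' y' f \<otimes>\<^bsub>k\<^esub> nat_emb k (G.wcount P' ?v y' x') = ?r \<otimes>\<^bsub>k\<^esub> nat_emb k (?n P' x' y')"
    if P': "subgroup P' G" and xy: "x' \<in> fixed P'" "y' \<in> fixed P'" for P' x' y'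
  proof (cases "G.wcount P' ?v y' x' = 0")
    case True
    then show ?thesis using rhoD(1)[OF f] by simp
  next
    case False
    note nz = G.wcount_dual_nonzeroD[OF finite_group dual P' xy(1) False]
    show ?thesis
    proof (cases "card P' = card P1")
      case True
      obtain d where d: "d \<in> carrier G" "P' = conj_subgroup G d P1" "x' = d <#\<^bsub>G\<^esub> K" "y' = d <#\<^bsub>G\<^esub> (b <#\<^bsub>G\<^esub> H)"
        using nz(2)[OF True] by blast
      have "rho P' x' y' f = ?r"
        unfolding d(2-4) r[symmetric]
        using rho_l_coset[OF f P1 d(1) subgroup.subset[OF K(1)] G.l_coset_subset_G[OF subgroup.subset[OF H(1)] b]] .
      then show ?thesis using True by simp
    next
      case False
      then have "card P' < card P" using nz(1) cP1 by simp
      then have "rho P' x' y' f = \<zero>\<^bsub>k\<^esub>" using less.hyps[OF _ P' xy] by simp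
      then show ?thesis using False rc by simp
    qed
  qed
  have "\<zero>\<^bsub>k\<^esub> = (\<Oplus>\<^bsub>k\<^esub>P'\<in>?S. \<Oplus>\<^bsub>k\<^esub>x'\<in>fixed P'. \<Oplus>\<^bsub>k\<^esub>y'\<in>fixed P'.
      rho P' x' y' f \<otimes>\<^bsub>k\<^esub> nat_emb k (G.wcount P' ?v y' x'))"
    using 0[OF v] trace_product[OF f v] by simp
  also have "\<dots> = (\<Oplus>\<^bsub>k\<^esub>P'\<in>?S. \<Oplus>\<^bsub>k\<^esub>x'\<in>fixed P'. \<Oplus>\<^bsub>k\<^esub>y'\<in>fixed P'. ?r \<otimes>\<^bsub>k\<^esub> nat_emb k (?n P' x' y'))"
    using summand rc by (intro k.finsum_cong' refl funcsetI k.finsum_closed) auto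
  also have "\<dots> = ?r \<otimes>\<^bsub>k\<^esub> nat_emb k (\<Sum>P'\<in>?S. \<Sum>x'\<in>fixed P'. \<Sum>y'\<in>fixed P'. ?n P' x' y')"
    using fs ff rc by (simp add: k.nat_emb_sum k.finsum_rdistr k.finsum_closed Pi_iff del: if_split)
  finally have "?r \<otimes>\<^bsub>k\<^esub> nat_emb k (\<Sum>P'\<in>?S. \<Sum>x'\<in>fixed P'. \<Sum>y'\<in>fixed P'. ?n P' x' y') = \<zero>\<^bsub>k\<^esub>" ..
  moreover have "nat_emb k (\<Sum>P'\<in>?S. \<Sum>x'\<in>fixed P'. \<Sum>y'\<in>fixed P'. ?n P' x' y') \<noteq> \<zero>\<^bsub>k\<^esub>"
  \<comment> \<open>The remaining factor is the index of \<open>P1\<close> in G, since multiplying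
    it by \<open>card P1\<close> gives the order of G.\<close>
  proof (rule order_invertible)
    have "(\<Sum>P'\<in>?S. \<Sum>x'\<in>fixed P'. \<Sum>y'\<in>fixed P'. ?n P' x' y')
        = (\<Sum>P'\<in>?S. if card P' = card P1 then \<Sum>x'\<in>fixed P'. \<Sum>y'\<in>fixed P'. G.wcount P' ?v y' x' else 0)"
      by (intro sum.cong) auto
    also have "\<dots> = (\<Sum>P'\<in>{P' \<in> ?S. card P' = card P1}. \<Sum>x'\<in>fixed P'. \<Sum>y'\<in>fixed P'. G.wcount P' ?v y' x')"
      by (rule sum.inter_filter[OF fs, symmetric])
    finally have eq: "card P1 * (\<Sum>P'\<in>?S. \<Sum>x'\<in>fixed P'. \<Sum>y'\<in>fixed P'. ?n P' x' y') = order G"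
      using G.sum_wcount_dual[OF finite_group dual] by simp
    show "(\<Sum>P'\<in>?S. \<Sum>x'\<in>fixed P'. \<Sum>y'\<in>fixed P'. ?n P' x' y') dvd order G"
      unfolding eq[symmetric] by (rule dvd_triv_right)
  qed
  ultimately show ?case using rc by (simp add: k.integral_iff)
qed

text \<open>Both traces are double extensions of \<open>wtrace\<close> over pairs of words.
  Interchanging the finite sums reduces the claim to invariance of \<open>wtrace\<close> under
  swapping the two parts of a word.\<close>

lemma trace_commute:
  assumes f: "f \<in> carrier F" and g: "g \<in> carrier F"
  shows "k.lin_ext W (\<lambda>w. nat_emb k (G.wtrace w)) (f \<otimes>\<^bsub>F\<^esub> g)
    = k.lin_ext W (\<lambda>w. nat_emb k (G.wtrace w)) (g \<otimes>\<^bsub>F\<^esub> f)"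
proof -
  have "k.lin_ext W (\<lambda>w. nat_emb k (G.wtrace w)) (f \<otimes>\<^bsub>F\<^esub> g)
      = k.lin_ext W (\<lambda>u. k.lin_ext W (\<lambda>v. nat_emb k (G.wtrace (u @ v))) g) f"
    by (rule k.lin_ext_mult[OF f g nat_emb_funcset])
  also have "\<dots> = k.lin_ext W (\<lambda>v. k.lin_ext W (\<lambda>u. nat_emb k (G.wtrace (u @ v))) f) g"
    using f g by (intro k.lin_ext_swap) (auto simp: F_carrier)
  also have "\<dots> = k.lin_ext W (\<lambda>v. k.lin_ext W (\<lambda>u. nat_emb k (G.wtrace (v @ u))) f) g"
    by (simp only: G.wtrace_commute[OF finite_group])
  also have "\<dots> = k.lin_ext W (\<lambda>w. nat_emb k (G.wtrace w)) (g \<otimes>\<^bsub>F\<^esub> f)"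
    by (rule k.lin_ext_mult[OF g f nat_emb_funcset, symmetric])
  finally show ?thesis .
qed

theorem mackey_algebra_symmetric: "symmetric_algebra k A"
proof -
  obtain t where t: "t \<in> module_hom k A (regular_module k)"
    and tf: "\<And>f. f \<in> carrier F \<Longrightarrow> t (proj f) = k.lin_ext W (\<lambda>w. nat_emb k (G.wtrace w)) f"
    using trace_form by blast
  show ?thesis
  proof (rule symmetric_algebra_if_trace_form[OF k.field_axioms A_unital _ _ std_span_eq t])
    show "finite (M.std_elem ` G.std_index)"
      using G.finite_std_index[OF finite_group] by simp
    show "M.std_elem ` G.std_index \<subseteq> carrier A" by (rule M.std_elems_carrier)
    fix x y assume "x \<in> carrier A" "y \<in> carrier A"
    then obtain f g where f: "f \<in> carrier F" "x = proj f" and g: "g \<in> carrier F" "y = proj g"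
      by (auto simp: A_carrier)
    have "t (proj (f \<otimes>\<^bsub>F\<^esub> g)) = t (proj (g \<otimes>\<^bsub>F\<^esub> f))"
      unfolding tf[OF F.A.m_closed[OF f(1) g(1)]] tf[OF F.A.m_closed[OF g(1) f(1)]]
      by (rule trace_commute[OF f(1) g(1)])
    then show "t (x \<otimes>\<^bsub>A\<^esub> y) = t (y \<otimes>\<^bsub>A\<^esub> x)"
      using f g by (simp add: H.hom_mult)
  next
    fix x assume x: "x \<in> carrier A" and 0: "\<And>y. y \<in> carrier A \<Longrightarrow> t (x \<otimes>\<^bsub>A\<^esub> y) = \<zero>\<^bsub>k\<^esub>"
    obtain f where f: "f \<in> carrier F" "x = proj f" using x by (auto simp: A_carrier)
    have "k.lin_ext W (\<lambda>w. nat_emb k (G.wtrace w)) (f \<otimes>\<^bsub>F\<^esub> wmon v) = \<zero>\<^bsub>k\<^esub>" for v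
    proof -
      have "k.lin_ext W (\<lambda>w. nat_emb k (G.wtrace w)) (f \<otimes>\<^bsub>F\<^esub> wmon v) = t (proj (f \<otimes>\<^bsub>F\<^esub> wmon v))"
        by (rule tf[OF F.A.m_closed[OF f(1) mon_closed], symmetric])
      also have "\<dots> = t (x \<otimes>\<^bsub>A\<^esub> proj (wmon v))" using f by (simp add: H.hom_mult)
      also have "\<dots> = \<zero>\<^bsub>k\<^esub>" by (rule 0[OF H.hom_closed[OF mon_closed]])
      finally show ?thesis .
    qed
    then have "rho P u v f = \<zero>\<^bsub>k\<^esub>" if "subgroup P G" "u \<in> fixed P" "v \<in> fixed P" for P u v
      using trace_separates_entries[OF f(1) _ that] by blast
    then show "x = \<zero>\<^bsub>A\<^esub>"
      using f entry(2) by (intro entries_separate[OF x]) simp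
  qed
qed

end

theorem corollary2p5:
  fixes G :: "('g, 'm) monoid_scheme" and k :: "('k, 'n) ring_scheme"
  assumes "group G" and "finite (carrier G)"
    and "field k"
    and "ring_characteristic k = 0 \<or>
         (\<exists>p. p > 0 \<and> ring_characteristic k = p \<and> \<not> p dvd order G)"
  shows "symmetric_algebra k (mackey_algebra k G)"
proof -
  interpret G: group G by fact
  interpret k: field k by fact
  have "nat_emb k n \<noteq> \<zero>\<^bsub>k\<^esub>" if n: "n dvd order G" for n
  proof
    assume "nat_emb k n = \<zero>\<^bsub>k\<^esub>"
    then have "ring_characteristic k dvd n" by (simp add: k.nat_emb_eq_zero_iff)
    then have "ring_characteristic k dvd order G" using n by (rule dvd_trans)
    \<comment> \<open>In characteristic zero the divisibility just obtained would force the order of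
      G to be 0.\<close>
    moreover have "order G > 0" using assms(2) G.order_gt_0_iff_finite by simp
    ultimately show False using assms(4) by auto
  qed
  then interpret mackey_algebra_coprime G k
    using assms(2) by unfold_locales
  show ?thesis by (rule mackey_algebra_symmetric)
qed

end
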